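(* Let $v\in\mathfrak{S}_k$ be a pattern and let $A\subsetneq[k-1]$ with $|A|=q$. Let $\{\lambda^{(n)}\}$ be a sequence of partitions, $\lambda^{(n)}\vdash n$, with all long cycles, and let $\Sigma_n$ be uniformly random among permutations of cycle type $\lambda^{(n)}$. Then there exists $\sigma_{v,A}>0$ such that $$\frac{N_{v,A}(\Sigma_n)-\frac{n^{k-q}}{k!\,(k-q)!}}{n^{k-q-\frac12}}\xrightarrow{d}\mathcal N(0,\sigma_{v,A}^2)\quad(n\to\infty).$$
   Context: For $w\in\mathfrak{S}_n$, $N_{v,A}(w)$ is the number of index sets $\{i_1<\dots<i_k\}\subseteq[n]$ such that $i_{a+1}=i_a+1$ for all $a\in A$ and the sequence $(w(i_1),\dots,w(i_k))$ is in the same relative order as $(v(1),\dots,v(k))$ (a vincular pattern occurrence). A sequence $\{\lambda^{(n)}\}$ has all long cycles if $\lim_{n\to\infty}m_i(\lambda^{(n)})=0$ for every $i\ge1$, where $m_i(\lambda)$ is the multiplicity of $i$ as a part of $\lambda$. $\mathcal N(0,\sigma^2)$ is the normal distribution and $\xrightarrow{d}$ denotes convergence in distribution. *)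

theory Defs
  imports "HOL-Probability.Probability" "HOL-Combinatorics.Combinatorics"
begin

(* The symmetric group on [n] is rendered as {w. w permutes {1..n}}, with w :: nat => nat. *)

definition vincular_count :: "nat \<Rightarrow> (nat \<Rightarrow> nat) \<Rightarrow> nat set \<Rightarrow> nat \<Rightarrow> (nat \<Rightarrow> nat) \<Rightarrow> nat" where
  "vincular_count k v A n w = card {i ` {1..k} | i.
     strict_mono_on {1..k} i \<and> i ` {1..k} \<subseteq> {1..n} \<and>
     (\<forall>a\<in>A. i (a + 1) = i a + 1) \<and>
     (\<forall>a\<in>{1..k}. \<forall>b\<in>{1..k}. w (i a) < w (i b) \<longleftrightarrow> v a < v b)}"

definition partition_of :: "nat multiset \<Rightarrow> nat \<Rightarrow> bool" (infix "partition'_of" 50) where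
  "p partition_of n \<longleftrightarrow> 0 \<notin># p \<and> sum_mset p = n"

(* Inside mset_set the orbits form a set, so each cycle contributes exactly one part;
   fixed points are orbits of size 1. *)
definition cycle_type :: "nat \<Rightarrow> (nat \<Rightarrow> nat) \<Rightarrow> nat multiset" where
  "cycle_type n w = image_mset card (mset_set (orbit w ` {1..n}))"

definition perms_of_cycle_type :: "nat \<Rightarrow> nat multiset \<Rightarrow> (nat \<Rightarrow> nat) set" where
  "perms_of_cycle_type n p = {w. w permutes {1..n} \<and> cycle_type n w = p}"

definition all_long_cycles :: "(nat \<Rightarrow> nat multiset) \<Rightarrow> bool" where
  "all_long_cycles lam \<longleftrightarrow> (\<forall>i\<ge>1. (\<lambda>n. real (count (lam n) i)) \<longlonglongrightarrow> 0)"

end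

(* Number the points 1, ..., n along the cycles of a fixed permutation s of cycle type lambda; then
   Sigma_n is p s p^-1 for a uniform permutation p.  Two permutations s, s' having r and r' cycles can be
   conjugated so that both agree with the shift x -> x + 1 off r + r' points.  A Poincare inequality for
   transpositions shows that the pattern counts of p s p^-1 and p s' p^-1 then differ by a variable of
   variance O((r + r') n^(2(k-q)-2)), and in the absence of fixed points their means differ by
   O(n^(k-q-1)).  Long cycles mean r = o(n), and a uniform s' has O(log n) cycles on average, so Sigma_n may
   be replaced by a uniform permutation.

   A uniform permutation is the relative order of n independent letters from a large alphabet.  For a
   function of independent coordinates with small first and second differences, Stein's method applied to
   the characteristic function gives a normal approximation whose variance is that of the function itself.
   The normalized variance converges because pairs of occurrences with a given relative order are counted
   by a binomial coefficient.  Its limit is positive because the count correlates with the number of small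
   letters in an initial segment of positions: for A a proper subset of [k-1] the first block of the pattern
   misses some value. *)

theory Submission
  imports Defs "HOL-Real_Asymp.Real_Asymp"
begin

section \<open>Finite averages\<close>

text \<open>A conjugate p s p^-1 is not a function of independent coordinates, which is why a
  uniform permutation has to stand in for it before Stein's argument can be run. Write m = k - q.
  The comparison is delicate: one transposition changes a pattern count by order n^(m-1), and this
  alone bounds the variance of the difference of two counts only by order n^(2m-1), the very order
  of the limiting fluctuations. The gain comes from the fact that a swap changes the difference only
  through index sets that meet both the few points touched by the swap and the set where the two
  permutations disagree; such sets are rarer by a factor (r + r')/n. The limiting variance is never
  computed. It is a limit of variances in the word model, so it depends on v and A but not on the
  cycle types. The alphabet has size 8 k! n^4: large enough that repeated letters are negligible
  both in law and, on the scale n^(m-1/2), in the mean, and a multiple of 8 k! so that the letters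
  regarded as small form an exact proportion.\<close>

definition avg :: "'a set \<Rightarrow> ('a \<Rightarrow> 'b::real_normed_field) \<Rightarrow> 'b" where
  "avg A f = (\<Sum>x\<in>A. f x) / of_nat (card A)"

lemma avg_add: "avg A (\<lambda>x. f x + g x) = avg A f + avg A g"
  by (simp add: avg_def sum.distrib add_divide_distrib)

lemma avg_diff: "avg A (\<lambda>x. f x - g x) = avg A f - avg A g"
  by (simp add: avg_def sum_subtractf diff_divide_distrib)

lemma avg_uminus: "avg A (\<lambda>x. - f x) = - avg A f"
  by (simp add: avg_def sum_negf)

lemma avg_cmult: "avg A (\<lambda>x. c * f x) = c * avg A f"
  by (simp add: avg_def sum_distrib_left)

lemma avg_cmult2: "avg A (\<lambda>x. f x * c) = avg A f * c"
  by (simp add: avg_def sum_distrib_right)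

lemma avg_divide: "avg A (\<lambda>x. f x / c) = avg A f / c"
  by (simp add: avg_def sum_divide_distrib mult.commute)

lemma avg_sum: "avg A (\<lambda>x. \<Sum>i\<in>I. f i x) = (\<Sum>i\<in>I. avg A (f i))"
  unfolding avg_def by (subst sum.swap) (simp add: sum_divide_distrib)

lemma avg_const: "finite A \<Longrightarrow> A \<noteq> {} \<Longrightarrow> avg A (\<lambda>x. c) = c"
  by (simp add: avg_def)

lemma avg_cong: "(\<And>x. x \<in> A \<Longrightarrow> f x = g x) \<Longrightarrow> avg A f = avg A g"
  by (simp add: avg_def)

lemma avg_mono:
  fixes f g :: "'a \<Rightarrow> real"
  shows "(\<And>x. x \<in> A \<Longrightarrow> f x \<le> g x) \<Longrightarrow> avg A f \<le> avg A g"
  by (simp add: avg_def divide_right_mono sum_mono)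

lemma avg_nonneg:
  fixes f :: "'a \<Rightarrow> real"
  shows "(\<And>x. x \<in> A \<Longrightarrow> 0 \<le> f x) \<Longrightarrow> 0 \<le> avg A f"
  by (simp add: avg_def sum_nonneg)

lemma avg_le_const:
  fixes f :: "'a \<Rightarrow> real"
  assumes "\<And>x. x \<in> A \<Longrightarrow> f x \<le> c" "0 \<le> c"
  shows "avg A f \<le> c"
proof (cases "finite A \<and> A \<noteq> {}")
  case True
  then show ?thesis using avg_mono[of A f "\<lambda>_. c"] assms by (simp add: avg_const)
next
  case False
  then show ?thesis using assms by (auto simp: avg_def)
qed

lemma norm_avg_le: "norm (avg A f) \<le> avg A (\<lambda>x. norm (f x))"
  by (simp add: avg_def norm_divide divide_right_mono norm_sum)

lemma avg_bij:
  assumes "bij_betw h A B"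
  shows "avg A (\<lambda>x. f (h x)) = avg B f"
  unfolding avg_def using sum.reindex_bij_betw[OF assms, of f] bij_betw_same_card[OF assms] by simp

lemma avg_Times: "avg (A \<times> B) f = avg A (\<lambda>x. avg B (\<lambda>y. f (x, y)))"
  by (simp add: avg_def sum.cartesian_product card_cartesian_product sum_divide_distrib[symmetric] mult.commute)

lemma avg_swap: "avg A (\<lambda>x. avg B (\<lambda>y. f x y)) = avg B (\<lambda>y. avg A (\<lambda>x. f x y))"
  unfolding avg_def by (simp add: sum_divide_distrib[symmetric] sum.swap[of _ A] mult.commute)

lemma avg_of_real: "avg A (\<lambda>x. of_real (f x)) = of_real (avg A f)"
  by (simp add: avg_def)

lemma avg_fst: "finite B \<Longrightarrow> B \<noteq> {} \<Longrightarrow> avg (A \<times> B) (\<lambda>z. f (fst z)) = avg A f"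
  by (simp add: avg_Times avg_const)

lemma avg_square_le:
  fixes f :: "'a \<Rightarrow> real"
  shows "(avg A f)\<^sup>2 \<le> avg A (\<lambda>x. (f x)\<^sup>2)"
proof (cases "finite A \<and> A \<noteq> {}")
  case True
  then have "0 \<le> avg A (\<lambda>x. (f x - avg A f)\<^sup>2)" by (intro avg_nonneg) auto
  also have "avg A (\<lambda>x. (f x - avg A f)\<^sup>2) = avg A (\<lambda>x. (f x)\<^sup>2 - 2 * avg A f * f x + (avg A f)\<^sup>2)"
    by (intro avg_cong) (simp add: power2_eq_square algebra_simps)
  also have "\<dots> = avg A (\<lambda>x. (f x)\<^sup>2) - (avg A f)\<^sup>2"
    using True by (simp add: avg_add avg_diff avg_cmult avg_const power2_eq_square)
  finally show ?thesis by simp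
qed (auto simp: avg_def)

definition var :: "'a set \<Rightarrow> ('a \<Rightarrow> real) \<Rightarrow> real" where
  "var A f = avg A (\<lambda>x. (f x - avg A f)\<^sup>2)"

lemma var_nonneg: "0 \<le> var A f"
  unfolding var_def by (intro avg_nonneg) auto

lemma cov_eq:
  fixes f :: "'a \<Rightarrow> real"
  assumes "finite A" "A \<noteq> {}"
  shows "avg A (\<lambda>x. (f x - avg A f) * (g x - avg A g)) = avg A (\<lambda>x. f x * g x) - avg A f * avg A g"
proof -
  have "avg A (\<lambda>x. (f x - avg A f) * (g x - avg A g)) =
    avg A (\<lambda>x. f x * g x - f x * avg A g - avg A f * g x + avg A f * avg A g)"
    by (intro avg_cong) (simp add: algebra_simps)
  then show ?thesis using assms
    by (simp add: avg_add avg_diff avg_cmult avg_cmult2 avg_const)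
qed

lemma var_eq:
  assumes "finite A" "A \<noteq> {}"
  shows "var A f = avg A (\<lambda>x. (f x)\<^sup>2) - (avg A f)\<^sup>2"
  using cov_eq[OF assms, of f f] by (simp add: var_def power2_eq_square)

lemma avg_abs_dev_le: "avg A (\<lambda>x. \<bar>f x - avg A f\<bar>) \<le> sqrt (var A f)"
  unfolding var_def using avg_square_le[of A "\<lambda>x. \<bar>f x - avg A f\<bar>"]
  by (simp add: real_le_rsqrt)

lemma avg_Cauchy_Schwarz:
  fixes f g :: "'a \<Rightarrow> real"
  shows "(avg A (\<lambda>x. f x * g x))\<^sup>2 \<le> avg A (\<lambda>x. (f x)\<^sup>2) * avg A (\<lambda>x. (g x)\<^sup>2)"
proof -
  have "(\<Sum>x\<in>A. f x * g x)\<^sup>2 / (real (card A))\<^sup>2 \<le> (\<Sum>x\<in>A. (f x)\<^sup>2) * (\<Sum>x\<in>A. (g x)\<^sup>2) / (real (card A))\<^sup>2"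
    by (intro divide_right_mono Cauchy_Schwarz_ineq_sum) auto
  then show ?thesis by (simp add: avg_def power_divide power2_eq_square)
qed

section \<open>Replacing the letters of a random word by those of an independent copy, one at a
  time\<close>

definition mix :: "nat \<Rightarrow> (nat \<Rightarrow> 'b) \<Rightarrow> (nat \<Rightarrow> 'b) \<Rightarrow> nat \<Rightarrow> 'b" where
  "mix p V V' = (\<lambda>i. if i \<le> p then V' i else V i)"

lemma mix_PiE: "V \<in> PiE {1..n} (\<lambda>_. S) \<Longrightarrow> V' \<in> PiE {1..n} (\<lambda>_. S) \<Longrightarrow> mix p V V' \<in> PiE {1..n} (\<lambda>_. S)"
  by (auto simp: mix_def PiE_iff extensional_def)

lemma mix_0: "V \<in> PiE {1..n} (\<lambda>_. S) \<Longrightarrow> V' \<in> PiE {1..n} (\<lambda>_. S) \<Longrightarrow> mix 0 V V' = V"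
  by (auto simp: mix_def PiE_iff extensional_def fun_eq_iff)

lemma mix_n: "V \<in> PiE {1..n} (\<lambda>_. S) \<Longrightarrow> V' \<in> PiE {1..n} (\<lambda>_. S) \<Longrightarrow> mix n V V' = V'"
  by (auto simp: mix_def PiE_iff extensional_def fun_eq_iff)

lemma mix_step: "1 \<le> p \<Longrightarrow> mix p V V' = (mix (p - 1) V V')(p := V' p)"
  by (auto simp: mix_def fun_eq_iff)

lemma fun_upd_PiE: "V \<in> PiE I (\<lambda>_. S) \<Longrightarrow> p \<in> I \<Longrightarrow> y \<in> S \<Longrightarrow> V(p := y) \<in> PiE I (\<lambda>_. S)"
  by (auto simp: PiE_iff extensional_def)

text \<open>Exchanging the p-th letters of two independent words preserves the uniform law on pairs
  and interchanges the hybrids \<open>mix (p - 1)\<close> and \<open>mix p\<close>; this symmetry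
  drives the covariance formula.\<close>

definition swap_at :: "nat \<Rightarrow> (nat \<Rightarrow> 'b) \<times> (nat \<Rightarrow> 'b) \<Rightarrow> (nat \<Rightarrow> 'b) \<times> (nat \<Rightarrow> 'b)" where
  "swap_at p z = ((fst z)(p := snd z p), (snd z)(p := fst z p))"

lemma swap_at_bij:
  fixes S :: "'b set"
  assumes "p \<in> {1..n}"
  defines "\<Omega> \<equiv> PiE {1..n} (\<lambda>_. S)"
  shows "bij_betw (swap_at p) (\<Omega> \<times> \<Omega>) (\<Omega> \<times> \<Omega>)"
proof (rule bij_betwI[where g = "swap_at p"])
  show "swap_at p \<in> \<Omega> \<times> \<Omega> \<rightarrow> \<Omega> \<times> \<Omega>" "swap_at p \<in> \<Omega> \<times> \<Omega> \<rightarrow> \<Omega> \<times> \<Omega>"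
    using assms(1) by (auto simp: \<Omega>_def swap_at_def PiE_iff extensional_def)
qed (auto simp: swap_at_def)

text \<open>\<open>F V - F V'\<close> telescopes along the hybrids. Exchanging the p-th letters
  negates the p-th increment and replaces the p-th letter in the argument of G, so averaging the two
  expressions puts a difference of G in place of G and produces the factor 1/2. G takes values in a
  general field because it will be both F itself and a complex exponential of F.\<close>

lemma cov_telescope:
  fixes F :: "(nat \<Rightarrow> 'b) \<Rightarrow> real" and G :: "(nat \<Rightarrow> 'b) \<Rightarrow> 'c::real_normed_field" and n :: nat
  assumes "finite S" "S \<noteq> {}"
  defines "\<Omega> \<equiv> PiE {1..n} (\<lambda>_. S)"
  shows "avg \<Omega> (\<lambda>V. of_real (F V - avg \<Omega> F) * G V) =
    (\<Sum>p=1..n. avg (\<Omega> \<times> \<Omega>) (\<lambda>(V,V'). of_real (F (mix (p-1) V V') - F (mix p V V')) * (G V - G (V(p := V' p))))) / 2"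
proof -
  have fin: "finite \<Omega>" "\<Omega> \<noteq> {}" unfolding \<Omega>_def using assms by (auto intro!: finite_PiE simp: PiE_eq_empty_iff)
  let ?D = "\<lambda>p V V'. F (mix (p-1) V V') - F (mix p V V')"
  have tele: "(\<Sum>p=1..n. ?D p V V') = F V - F V'" if "V \<in> \<Omega>" "V' \<in> \<Omega>" for V V'
  proof -
    have "(\<Sum>p=1..j. ?D p V V') = F (mix 0 V V') - F (mix j V V')" for j
      by (induction j) auto
    then show ?thesis using mix_0[OF that[unfolded \<Omega>_def]] mix_n[OF that[unfolded \<Omega>_def]] by simp
  qed
  have "avg \<Omega> (\<lambda>V. of_real (F V - avg \<Omega> F) * G V) = avg (\<Omega> \<times> \<Omega>) (\<lambda>(V,V'). of_real (F V - F V') * G V)"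
    using fin by (simp add: avg_Times avg_diff avg_cmult2 avg_of_real avg_const)
  also have "\<dots> = avg (\<Omega> \<times> \<Omega>) (\<lambda>z. \<Sum>p=1..n. of_real (?D p (fst z) (snd z)) * G (fst z))"
  proof (rule avg_cong)
    fix z assume z: "z \<in> \<Omega> \<times> \<Omega>"
    have "F (fst z) - F (snd z) = (\<Sum>p=1..n. ?D p (fst z) (snd z))" using tele z by (simp add: mem_Times_iff)
    then show "(case z of (V, V') \<Rightarrow> of_real (F V - F V') * G V) = (\<Sum>p=1..n. of_real (?D p (fst z) (snd z)) * G (fst z))"
      by (simp only: case_prod_unfold of_real_sum sum_distrib_right)
  qed
  also have "\<dots> = (\<Sum>p=1..n. avg (\<Omega> \<times> \<Omega>) (\<lambda>z. of_real (?D p (fst z) (snd z)) * G (fst z)))"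
    by (rule avg_sum)
  also have "\<dots> = (\<Sum>p=1..n. avg (\<Omega> \<times> \<Omega>) (\<lambda>(V,V'). of_real (?D p V V') * (G V - G (V(p := V' p)))) / 2)"
  proof (rule sum.cong)
    fix p assume p: "p \<in> {1..n}"
    have m1: "mix p (fst (swap_at p z)) (snd (swap_at p z)) = mix (p-1) (fst z) (snd z)"
      and m2: "mix (p-1) (fst (swap_at p z)) (snd (swap_at p z)) = mix p (fst z) (snd z)" for z :: "(nat \<Rightarrow> 'b) \<times> (nat \<Rightarrow> 'b)"
      using p by (auto simp: mix_def swap_at_def fun_eq_iff)
    have "avg (\<Omega> \<times> \<Omega>) (\<lambda>z. of_real (?D p (fst z) (snd z)) * G (fst z))
      = avg (\<Omega> \<times> \<Omega>) (\<lambda>z. of_real (?D p (fst (swap_at p z)) (snd (swap_at p z))) * G (fst (swap_at p z)))"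
      using avg_bij[OF swap_at_bij[OF p, of S], of "\<lambda>z. of_real (?D p (fst z) (snd z)) * G (fst z)"]
      unfolding \<Omega>_def by simp
    also have "\<dots> = - avg (\<Omega> \<times> \<Omega>) (\<lambda>z. of_real (?D p (fst z) (snd z)) * G ((fst z)(p := snd z p)))"
      unfolding m1 m2 avg_uminus[symmetric] by (intro avg_cong) (simp add: swap_at_def algebra_simps)
    moreover have "avg (\<Omega> \<times> \<Omega>) (\<lambda>z. of_real (?D p (fst z) (snd z)) * (G (fst z) - G ((fst z)(p := snd z p)))) =
      avg (\<Omega> \<times> \<Omega>) (\<lambda>z. of_real (?D p (fst z) (snd z)) * G (fst z)) -
      avg (\<Omega> \<times> \<Omega>) (\<lambda>z. of_real (?D p (fst z) (snd z)) * G ((fst z)(p := snd z p)))"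
      unfolding avg_diff[symmetric] by (intro avg_cong) (simp add: algebra_simps)
    ultimately have "avg (\<Omega> \<times> \<Omega>) (\<lambda>z. of_real (?D p (fst z) (snd z)) * (G (fst z) - G ((fst z)(p := snd z p))))
      = 2 * avg (\<Omega> \<times> \<Omega>) (\<lambda>z. of_real (?D p (fst z) (snd z)) * G (fst z))"
      by simp
    then show "avg (\<Omega> \<times> \<Omega>) (\<lambda>z. of_real (?D p (fst z) (snd z)) * G (fst z)) =
      avg (\<Omega> \<times> \<Omega>) (\<lambda>(V,V'). of_real (?D p V V') * (G V - G (V(p := V' p)))) / 2"
      by (simp add: case_prod_unfold)
  qed simp
  finally show ?thesis by (simp add: sum_divide_distrib)
qed

definition bdd_diff :: "nat \<Rightarrow> 'b set \<Rightarrow> real \<Rightarrow> ((nat \<Rightarrow> 'b) \<Rightarrow> real) \<Rightarrow> bool" where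
  "bdd_diff n S c F \<longleftrightarrow> (\<forall>V\<in>PiE {1..n} (\<lambda>_. S). \<forall>p\<in>{1..n}. \<forall>y\<in>S. \<bar>F V - F (V(p := y))\<bar> \<le> c)"

lemma bdd_diff_mix:
  assumes "bdd_diff n S c F" "V \<in> PiE {1..n} (\<lambda>_. S)" "V' \<in> PiE {1..n} (\<lambda>_. S)" "p \<in> {1..n}"
  shows "\<bar>F (mix (p-1) V V') - F (mix p V V')\<bar> \<le> c"
proof -
  have "V' p \<in> S" using assms by (auto simp: PiE_iff)
  then show ?thesis using assms mix_PiE[OF assms(2,3), of "p-1"] mix_step[of p V V']
    unfolding bdd_diff_def by auto
qed

text \<open>An Efron-Stein bound: the covariance formula with G = F is half a sum of n products of
  two increments, each at most \<open>c\<close>.\<close>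

lemma var_bdd_diff:
  fixes F :: "(nat \<Rightarrow> 'b) \<Rightarrow> real"
  assumes S: "finite S" "S \<noteq> {}" and F: "bdd_diff n S c F" "0 \<le> c"
  shows "var (PiE {1..n} (\<lambda>_. S)) F \<le> n * c\<^sup>2 / 2"
proof -
  define \<Omega> where "\<Omega> = PiE {1..n} (\<lambda>_. S)"
  have fin: "finite \<Omega>" "\<Omega> \<noteq> {}" unfolding \<Omega>_def using S by (auto intro!: finite_PiE simp: PiE_eq_empty_iff)
  let ?D = "\<lambda>p V V'. F (mix (p-1) V V') - F (mix p V V')"
  have "var \<Omega> F = avg \<Omega> (\<lambda>V. (F V - avg \<Omega> F) * F V) - avg \<Omega> (\<lambda>V. (F V - avg \<Omega> F) * avg \<Omega> F)"
    unfolding var_def avg_diff[symmetric] by (intro avg_cong) (simp add: power2_eq_square algebra_simps)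
  also have "avg \<Omega> (\<lambda>V. (F V - avg \<Omega> F) * avg \<Omega> F) = 0"
    using fin by (simp add: avg_cmult2 avg_diff avg_const)
  also have "avg \<Omega> (\<lambda>V. (F V - avg \<Omega> F) * F V) =
     (\<Sum>p=1..n. avg (\<Omega> \<times> \<Omega>) (\<lambda>(V,V'). ?D p V V' * (F V - F (V(p := V' p))))) / 2"
    using cov_telescope[OF S, of n F F] unfolding \<Omega>_def by simp
  also have "\<dots> \<le> (\<Sum>p=1..n. c\<^sup>2) / 2"
  proof (intro divide_right_mono sum_mono avg_le_const)
    fix p z assume p: "p \<in> {1..n}" and z: "z \<in> \<Omega> \<times> \<Omega>"
    obtain V V' where [simp]: "z = (V,V')" and V: "V \<in> \<Omega>" "V' \<in> \<Omega>" using z by auto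
    have "V' p \<in> S" using p V by (auto simp: \<Omega>_def PiE_iff)
    then have "\<bar>F V - F (V(p := V' p))\<bar> \<le> c" "\<bar>?D p V V'\<bar> \<le> c"
      using F(1) p V bdd_diff_mix[OF F(1) _ _ p] unfolding bdd_diff_def \<Omega>_def by auto
    then have "\<bar>?D p V V' * (F V - F (V(p := V' p)))\<bar> \<le> c * c"
      unfolding abs_mult by (intro mult_mono) auto
    then show "(case z of (V,V') \<Rightarrow> ?D p V V' * (F V - F (V(p := V' p)))) \<le> c\<^sup>2"
      by (simp add: power2_eq_square)
  qed auto
  finally show ?thesis unfolding \<Omega>_def by simp
qed

section \<open>Normal approximation for functions of independent coordinates\<close>

text \<open>The bound depends on the pair of coordinates because only its row sums will be small:
  two neighbouring positions can lie in one block of the pattern, and the bound on their mixed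
  difference is then of the order of a first difference.\<close>

definition bdd_diff2 :: "nat \<Rightarrow> 'b set \<Rightarrow> (nat \<Rightarrow> nat \<Rightarrow> real) \<Rightarrow> ((nat \<Rightarrow> 'b) \<Rightarrow> real) \<Rightarrow> bool" where
  "bdd_diff2 n S d F \<longleftrightarrow> (\<forall>V\<in>PiE {1..n} (\<lambda>_. S). \<forall>p\<in>{1..n}. \<forall>q\<in>{1..n}. \<forall>x\<in>S. \<forall>y\<in>S. p \<noteq> q \<longrightarrow>
    \<bar>F V - F (V(p := x)) - F (V(q := y)) + F (V(p := x, q := y))\<bar> \<le> d p q)"

text \<open>The mean of the kernel is the variance of $F$; Stein's identity for $F$ holds up to the fluctuation of
  the kernel around this mean, which is bounded by applying the variance bound to the kernel itself.\<close>

definition stein_kernel :: "nat \<Rightarrow> ((nat \<Rightarrow> 'b) \<Rightarrow> real) \<Rightarrow> (nat \<Rightarrow> 'b) \<times> (nat \<Rightarrow> 'b) \<Rightarrow> real" where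
  "stein_kernel n F z = (\<Sum>p=1..n. (F (mix (p-1) (fst z) (snd z)) - F (mix p (fst z) (snd z)))
     * (F (fst z) - F ((fst z)(p := snd z p)))) / 2"

text \<open>A pair of words over S is read as one word over \<open>S \<times> S\<close>, so that the
  variance bound applies to the kernel, a function of both words.\<close>

lemma pair_coords_bij:
  fixes S :: "'b set" and n :: nat
  defines "\<Omega> \<equiv> PiE {1..n} (\<lambda>_. S)"
  shows "bij_betw (\<lambda>W. (restrict (fst \<circ> W) {1..n}, restrict (snd \<circ> W) {1..n})) (PiE {1..n} (\<lambda>_. S \<times> S)) (\<Omega> \<times> \<Omega>)"
proof (rule bij_betwI[where g = "\<lambda>z. restrict (\<lambda>i. (fst z i, snd z i)) {1..n}"])
  show "(\<lambda>W. (restrict (fst \<circ> W) {1..n}, restrict (snd \<circ> W) {1..n})) \<in> (PiE {1..n} (\<lambda>_. S \<times> S)) \<rightarrow> \<Omega> \<times> \<Omega>"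
    by (auto simp: \<Omega>_def PiE_iff mem_Times_iff)
  show "(\<lambda>z. restrict (\<lambda>i. (fst z i, snd z i)) {1..n}) \<in> \<Omega> \<times> \<Omega> \<rightarrow> PiE {1..n} (\<lambda>_. S \<times> S)"
    by (auto simp: \<Omega>_def PiE_iff)
qed (auto simp: \<Omega>_def PiE_iff fun_eq_iff extensional_def restrict_def)

lemma abs_mult_diff_le:
  fixes a b a' b' :: real
  assumes "\<bar>a\<bar> \<le> c" "\<bar>b'\<bar> \<le> c" "\<bar>a - a'\<bar> \<le> d" "\<bar>b - b'\<bar> \<le> d"
  shows "\<bar>a * b - a' * b'\<bar> \<le> 2 * c * d"
proof -
  have "a * b - a' * b' = a * (b - b') + (a - a') * b'" by (simp add: algebra_simps)
  then have "\<bar>a * b - a' * b'\<bar> \<le> \<bar>a\<bar> * \<bar>b - b'\<bar> + \<bar>a - a'\<bar> * \<bar>b'\<bar>"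
    using abs_triangle_ineq[of "a * (b - b')" "(a - a') * b'"] by (simp add: abs_mult)
  also have "\<dots> \<le> c * d + d * c" using assms by (intro add_mono mult_mono) auto
  finally show ?thesis by simp
qed

lemma abs_mult_le_square:
  fixes a b :: real
  assumes "\<bar>a\<bar> \<le> c" "\<bar>b\<bar> \<le> c"
  shows "\<bar>a * b\<bar> \<le> c * c"
  unfolding abs_mult using assms by (intro mult_mono) auto

lemma abs_half_add_le:
  fixes x y :: real
  shows "\<bar>x\<bar> \<le> a \<Longrightarrow> \<bar>y\<bar> \<le> b \<Longrightarrow> \<bar>(x + y) / 2\<bar> \<le> (a + b) / 2"
  by (simp add: abs_le_iff)

text \<open>Replacing the p-th pair of letters changes the factors of the q-th summand, q \<noteq>
  p, only by mixed differences of F in p and q, which costs \<open>2 * c * d p q\<close>; the p-th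
  summand is bounded trivially by \<open>2 * c\<^sup>2\<close>. Summing over q and halving gives the
  stated constant.\<close>

lemma stein_kernel_bdd_diff:
  fixes F :: "(nat \<Rightarrow> 'b) \<Rightarrow> real" and n :: nat
  assumes F: "bdd_diff n S c F" "0 \<le> c" and F2: "bdd_diff2 n S d F"
    and e: "\<And>p. p \<in> {1..n} \<Longrightarrow> (\<Sum>q\<in>{1..n}-{p}. d p q) \<le> e"
  shows "bdd_diff n (S \<times> S) (c\<^sup>2 + c * e)
    (\<lambda>W. stein_kernel n F (restrict (fst \<circ> W) {1..n}, restrict (snd \<circ> W) {1..n}))"
  unfolding bdd_diff_def
proof (intro ballI)
  fix W p w assume W: "W \<in> PiE {1..n} (\<lambda>_. S \<times> S)" and p: "p \<in> {1..n}" and w: "w \<in> S \<times> S"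
  obtain y y' where [simp]: "w = (y, y')" and y: "y \<in> S" "y' \<in> S" using w by auto
  define V V' where "V = restrict (fst \<circ> W) {1..n}" and "V' = restrict (snd \<circ> W) {1..n}"
  have V: "V \<in> PiE {1..n} (\<lambda>_. S)" "V' \<in> PiE {1..n} (\<lambda>_. S)"
    using W by (auto simp: V_def V'_def PiE_iff mem_Times_iff)
  define U U' where "U = V(p := y)" and "U' = V'(p := y')"
  have U: "U \<in> PiE {1..n} (\<lambda>_. S)" "U' \<in> PiE {1..n} (\<lambda>_. S)"
    unfolding U_def U'_def using V p y by (auto intro!: fun_upd_PiE)
  have r: "restrict (fst \<circ> W(p := w)) {1..n} = U" "restrict (snd \<circ> W(p := w)) {1..n} = U'"
    using p by (auto simp: U_def U'_def V_def V'_def fun_eq_iff)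
  define D where "D = (\<lambda>q V V'. F (mix (q-1) V V') - F (mix q V V'))"
  define E where "E = (\<lambda>q V V'. F V - F (V(q := V' q)))"
  have bD: "\<bar>D q X X'\<bar> \<le> c" if "q \<in> {1..n}" "X \<in> PiE {1..n} (\<lambda>_. S)" "X' \<in> PiE {1..n} (\<lambda>_. S)" for q X X'
    using bdd_diff_mix[OF F(1) that(2,3,1)] unfolding D_def .
  have bE: "\<bar>E q X X'\<bar> \<le> c" if "q \<in> {1..n}" "X \<in> PiE {1..n} (\<lambda>_. S)" "X' \<in> PiE {1..n} (\<lambda>_. S)" for q X X'
    using F(1) that unfolding bdd_diff_def E_def by (auto simp: PiE_iff)
  have far: "\<bar>D q V V' * E q V V' - D q U U' * E q U U'\<bar> \<le> 2 * c * d p q" if q: "q \<in> {1..n} - {p}" for q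
  proof -
    have qn: "q \<in> {1..n}" "p \<noteq> q" and q1: "1 \<le> q" using q by auto
    have V'q: "V' q \<in> S" using V qn by (auto simp: PiE_iff)
    have "E q V V' - E q U U' = F V - F (V(p := y)) - F (V(q := V' q)) + F (V(p := y, q := V' q))"
      using qn by (auto simp: E_def U_def U'_def)
    then have 1: "\<bar>E q V V' - E q U U'\<bar> \<le> d p q"
      using F2 V(1) p qn y V'q unfolding bdd_diff2_def by metis
    define X where "X = mix (q-1) V V'"
    \<comment> \<open>The hybrid before step q takes its p-th letter from the second word precisely
      when p \<le> q - 1.\<close>
    define x where "x = (if p \<le> q - 1 then y' else y)"
    have x: "x \<in> S" using y by (simp add: x_def)
    have X: "X \<in> PiE {1..n} (\<lambda>_. S)" using mix_PiE[OF V] X_def by auto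
    have 2: "mix (q-1) U U' = X(p := x)"
      by (auto simp: X_def x_def U_def U'_def mix_def fun_eq_iff)
    have 3: "mix q V V' = X(q := V' q)" using mix_step[OF q1, of V V'] X_def by simp
    have 4: "mix q U U' = X(p := x, q := V' q)"
      using mix_step[OF q1, of U U'] 2 qn(2) by (simp add: U'_def)
    have "D q V V' - D q U U' = F X - F (X(p := x)) - F (X(q := V' q)) + F (X(p := x, q := V' q))"
      unfolding D_def 2 3 4 X_def[symmetric] by simp
    then have 5: "\<bar>D q V V' - D q U U'\<bar> \<le> d p q"
      using F2 X p qn x V'q unfolding bdd_diff2_def by metis
    show ?thesis
      by (rule abs_mult_diff_le[OF bD[OF qn(1) V] bE[OF qn(1) U] 5 1])
  qed
  have near: "\<bar>D p V V' * E p V V' - D p U U' * E p U U'\<bar> \<le> 2 * c\<^sup>2"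
  proof -
    have "\<bar>D p V V' * E p V V'\<bar> \<le> c * c" "\<bar>D p U U' * E p U U'\<bar> \<le> c * c"
      using abs_mult_le_square[OF bD[OF p V] bE[OF p V]] abs_mult_le_square[OF bD[OF p U] bE[OF p U]] .
    then show ?thesis by (simp add: power2_eq_square)
  qed
  have eq: "stein_kernel n F (V, V') - stein_kernel n F (U, U') =
    ((D p V V' * E p V V' - D p U U' * E p U U') +
     (\<Sum>q\<in>{1..n}-{p}. D q V V' * E q V V' - D q U U' * E q U U')) / 2"
  proof -
    have "stein_kernel n F (V, V') - stein_kernel n F (U, U') =
      (\<Sum>q=1..n. D q V V' * E q V V' - D q U U' * E q U U') / 2"
      by (simp add: stein_kernel_def D_def E_def sum_subtractf diff_divide_distrib)
    then show ?thesis using p sum.remove[of "{1..n}" p "\<lambda>q. D q V V' * E q V V' - D q U U' * E q U U'"] by simp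
  qed
  have "\<bar>\<Sum>q\<in>{1..n}-{p}. D q V V' * E q V V' - D q U U' * E q U U'\<bar> \<le> (\<Sum>q\<in>{1..n}-{p}. 2 * c * d p q)"
    by (rule order_trans[OF sum_abs sum_mono[OF far]])
  also have "\<dots> = 2 * c * (\<Sum>q\<in>{1..n}-{p}. d p q)"
    by (simp only: sum_distrib_left)
  also have "\<dots> \<le> 2 * c * e"
    by (rule mult_left_mono) (use e[OF p] F(2) in auto)
  finally have "\<bar>stein_kernel n F (V, V') - stein_kernel n F (U, U')\<bar> \<le> (2 * c\<^sup>2 + 2 * c * e) / 2"
    unfolding eq by (rule abs_half_add_le[OF near])
  then show "\<bar>stein_kernel n F (restrict (fst \<circ> W) {1..n}, restrict (snd \<circ> W) {1..n}) -
    stein_kernel n F (restrict (fst \<circ> W(p := w)) {1..n}, restrict (snd \<circ> W(p := w)) {1..n})\<bar> \<le> c\<^sup>2 + c * e"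
    unfolding r V_def[symmetric] V'_def[symmetric] by simp
qed

text \<open>Stein's identity E(Z g(Z)) = Var E(g'(Z)) for g(x) = exp(itx), up to two errors: the
  mean deviation of the kernel from its mean, at most its standard deviation, and the second-order
  Taylor remainder of the exponential in each coordinate difference.\<close>

lemma stein_char_bound:
  fixes F :: "(nat \<Rightarrow> 'b) \<Rightarrow> real" and n :: nat and t :: real
  assumes S: "finite S" "S \<noteq> {}" and F: "bdd_diff n S c F" "0 \<le> c" and F2: "bdd_diff2 n S d F"
    and e: "\<And>p. p \<in> {1..n} \<Longrightarrow> (\<Sum>q\<in>{1..n}-{p}. d p q) \<le> e" "0 \<le> e"
  defines "\<Omega> \<equiv> PiE {1..n} (\<lambda>_. S)"
  defines "Z \<equiv> (\<lambda>V. F V - avg \<Omega> F)"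
  shows "norm (avg \<Omega> (\<lambda>V. of_real (Z V) * iexp (t * Z V)) - \<i> * of_real (t * var \<Omega> F) * avg \<Omega> (\<lambda>V. iexp (t * Z V)))
    \<le> \<bar>t\<bar> * (sqrt n * (c\<^sup>2 + c * e)) + n * t\<^sup>2 * c^3"
proof -
  have fin: "finite \<Omega>" "\<Omega> \<noteq> {}" unfolding \<Omega>_def using S by (auto intro!: finite_PiE simp: PiE_eq_empty_iff)
  then have fin2: "finite (\<Omega> \<times> \<Omega>)" "\<Omega> \<times> \<Omega> \<noteq> {}" by auto
  define D where "D = (\<lambda>p V V'. F (mix (p-1) V V') - F (mix p V V'))"
  define E where "E = (\<lambda>p V V'. F V - F (V(p := V' p)))"
  let ?T = "stein_kernel n F"
  define G where "G = (\<lambda>V. iexp (t * Z V))"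
  have nG: "norm (G V) = 1" for V by (simp add: G_def)
  have T: "?T z = (\<Sum>p=1..n. D p (fst z) (snd z) * E p (fst z) (snd z)) / 2" for z
    by (simp add: stein_kernel_def D_def E_def)
  have ET: "avg (\<Omega> \<times> \<Omega>) ?T = var \<Omega> F"
  proof -
    have "avg (\<Omega> \<times> \<Omega>) ?T = (\<Sum>p=1..n. avg (\<Omega> \<times> \<Omega>) (\<lambda>(V,V'). D p V V' * E p V V')) / 2"
      unfolding stein_kernel_def avg_divide avg_sum D_def E_def by (simp add: case_prod_unfold)
    also have "\<dots> = avg \<Omega> (\<lambda>V. (F V - avg \<Omega> F) * F V)"
      using cov_telescope[OF S, of n F F] unfolding \<Omega>_def D_def E_def by simp
    also have "\<dots> = avg \<Omega> (\<lambda>V. (F V)\<^sup>2) - (avg \<Omega> F)\<^sup>2"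
      by (simp add: left_diff_distrib avg_diff avg_cmult power2_eq_square)
    finally show ?thesis using var_eq[OF fin] by simp
  qed
  have "var (\<Omega> \<times> \<Omega>) ?T = var (PiE {1..n} (\<lambda>_. S \<times> S)) (\<lambda>W. ?T (restrict (fst \<circ> W) {1..n}, restrict (snd \<circ> W) {1..n}))"
    unfolding var_def \<Omega>_def by (simp only: avg_bij[OF pair_coords_bij, symmetric])
  also have "\<dots> \<le> n * (c\<^sup>2 + c * e)\<^sup>2 / 2"
    using S F(2) e by (intro var_bdd_diff stein_kernel_bdd_diff[OF F F2]) auto
  also have "\<dots> \<le> n * (c\<^sup>2 + c * e)\<^sup>2" by simp
  finally have varT: "var (\<Omega> \<times> \<Omega>) ?T \<le> n * (c\<^sup>2 + c * e)\<^sup>2" .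
  have sq: "sqrt (var (\<Omega> \<times> \<Omega>) ?T) \<le> sqrt n * (c\<^sup>2 + c * e)"
    using real_sqrt_le_mono[OF varT] F(2) e(2) by (simp add: real_sqrt_mult)
  have devT: "avg (\<Omega> \<times> \<Omega>) (\<lambda>z. \<bar>?T z - var \<Omega> F\<bar>) \<le> sqrt n * (c\<^sup>2 + c * e)"
    using avg_abs_dev_le[of "\<Omega> \<times> \<Omega>" ?T] sq unfolding ET by linarith
  \<comment> \<open>What remains after each increment of \<open>G\<close> is replaced by its linear
    part; the linear parts add up to the kernel.\<close>
  define R where "R = (\<lambda>z. (\<Sum>p=1..n. of_real (D p (fst z) (snd z)) * (G (fst z) - G ((fst z)(p := snd z p))
     - \<i> * of_real (t * E p (fst z) (snd z)) * G (fst z))) / 2)"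
  have "avg \<Omega> (\<lambda>V. of_real (Z V) * G V) =
    avg (\<Omega> \<times> \<Omega>) (\<lambda>z. (\<Sum>p=1..n. of_real (D p (fst z) (snd z)) * (G (fst z) - G ((fst z)(p := snd z p)))) / 2)"
    using cov_telescope[OF S, of n F G] unfolding Z_def \<Omega>_def[symmetric] avg_divide avg_sum D_def
    by (simp add: case_prod_unfold)
  also have "\<dots> = avg (\<Omega> \<times> \<Omega>) (\<lambda>z. \<i> * of_real t * of_real (?T z) * G (fst z) + R z)"
    by (intro avg_cong)
      (simp add: R_def T add_divide_distrib[symmetric] sum_distrib_left sum_distrib_right
         sum.distrib[symmetric] algebra_simps)
  finally have main: "avg \<Omega> (\<lambda>V. of_real (Z V) * G V) = avg (\<Omega> \<times> \<Omega>) (\<lambda>z. \<i> * of_real t * of_real (?T z) * G (fst z) + R z)" .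
  have "avg \<Omega> G = avg (\<Omega> \<times> \<Omega>) (\<lambda>z. G (fst z))" using fin by (simp add: avg_fst)
  then have "\<i> * of_real (t * var \<Omega> F) * avg \<Omega> G = avg (\<Omega> \<times> \<Omega>) (\<lambda>z. \<i> * of_real (t * var \<Omega> F) * G (fst z))"
    by (simp add: avg_cmult)
  then have "avg \<Omega> (\<lambda>V. of_real (Z V) * G V) - \<i> * of_real (t * var \<Omega> F) * avg \<Omega> G =
    avg (\<Omega> \<times> \<Omega>) (\<lambda>z. \<i> * of_real t * of_real (?T z - var \<Omega> F) * G (fst z) + R z)"
    unfolding main avg_diff[symmetric]
    by (simp only:) (simp add: avg_diff[symmetric] algebra_simps)
  also have "norm \<dots> \<le> avg (\<Omega> \<times> \<Omega>) (\<lambda>z. \<bar>t\<bar> * \<bar>?T z - var \<Omega> F\<bar> + n * t\<^sup>2 * c^3)"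
  proof (intro norm_avg_le[THEN order_trans] avg_mono)
    fix z assume z: "z \<in> \<Omega> \<times> \<Omega>"
    have R: "norm (R z) \<le> n * t\<^sup>2 * c^3"
    proof -
      have "norm (\<Sum>p=1..n. of_real (D p (fst z) (snd z)) * (G (fst z) - G ((fst z)(p := snd z p))
        - \<i> * of_real (t * E p (fst z) (snd z)) * G (fst z))) \<le> (\<Sum>p=1..n. c * (t\<^sup>2 * c\<^sup>2))"
      proof (intro sum_norm_le)
        fix p assume p: "p \<in> {1..n}"
        have bE: "\<bar>E p (fst z) (snd z)\<bar> \<le> c"
          using F(1) z p unfolding bdd_diff_def \<Omega>_def E_def by (auto simp: PiE_iff)
        have bD: "\<bar>D p (fst z) (snd z)\<bar> \<le> c"
          using bdd_diff_mix[OF F(1) _ _ p] z unfolding \<Omega>_def D_def by auto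
        define x where "x = t * E p (fst z) (snd z)"
        have "t * Z ((fst z)(p := snd z p)) = t * Z (fst z) + (- x)" by (simp add: x_def E_def Z_def algebra_simps)
        then have "G ((fst z)(p := snd z p)) = G (fst z) * iexp (- x)"
          unfolding G_def by (simp only: of_real_add distrib_left exp_add)
        then have "G (fst z) - G ((fst z)(p := snd z p)) - \<i> * of_real x * G (fst z) =
          - G (fst z) * (iexp (- x) - (\<Sum>k\<le>1. (\<i> * of_real (- x))^k / fact k))"
          by (simp add: algebra_simps)
        then have "norm (G (fst z) - G ((fst z)(p := snd z p)) - \<i> * of_real x * G (fst z)) =
          norm (iexp (- x) - (\<Sum>k\<le>1. (\<i> * of_real (- x))^k / fact k))"
          by (simp only: norm_mult norm_minus_cancel nG)
        also have "\<dots> \<le> \<bar>- x\<bar> ^ (Suc 1) / fact (Suc 1)" by (rule iexp_approx1)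
        also have "\<dots> \<le> x\<^sup>2" by (simp add: power2_eq_square)
        also have "\<dots> \<le> t\<^sup>2 * c\<^sup>2"
          unfolding x_def power_mult_distrib using bE F(2) by (intro mult_left_mono) (auto simp: abs_le_square_iff[symmetric])
        finally have "norm (G (fst z) - G ((fst z)(p := snd z p)) - \<i> * of_real x * G (fst z)) \<le> t\<^sup>2 * c\<^sup>2" .
        then show "norm (of_real (D p (fst z) (snd z)) * (G (fst z) - G ((fst z)(p := snd z p))
          - \<i> * of_real (t * E p (fst z) (snd z)) * G (fst z))) \<le> c * (t\<^sup>2 * c\<^sup>2)"
          unfolding norm_mult x_def[symmetric] norm_of_real using bD F(2) by (intro mult_mono) auto
      qed
      then have "norm (R z) \<le> n * (c * (t\<^sup>2 * c\<^sup>2)) / 2"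
        unfolding R_def norm_divide by simp
      also have "\<dots> \<le> n * (c * (t\<^sup>2 * c\<^sup>2))" using F(2) by simp
      finally show ?thesis by (simp add: power2_eq_square power3_eq_cube algebra_simps)
    qed
    have "norm (\<i> * of_real t * of_real (?T z - var \<Omega> F) * G (fst z)) = \<bar>t\<bar> * \<bar>?T z - var \<Omega> F\<bar>"
      by (simp only: norm_mult nG norm_of_real norm_ii mult_1_left mult_1_right)
    then show "norm (\<i> * of_real t * of_real (?T z - var \<Omega> F) * G (fst z) + R z) \<le> \<bar>t\<bar> * \<bar>?T z - var \<Omega> F\<bar> + n * t\<^sup>2 * c^3"
      by (intro order_trans[OF norm_triangle_ineq add_mono[OF eq_refl R]])
  qed
  also have "\<dots> = \<bar>t\<bar> * avg (\<Omega> \<times> \<Omega>) (\<lambda>z. \<bar>?T z - var \<Omega> F\<bar>) + n * t\<^sup>2 * c^3"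
    using fin2 by (simp add: avg_add avg_cmult avg_const)
  also have "\<dots> \<le> \<bar>t\<bar> * (sqrt n * (c\<^sup>2 + c * e)) + n * t\<^sup>2 * c^3"
    using devT by (intro add_right_mono mult_left_mono) auto
  finally show ?thesis unfolding G_def .
qed

text \<open>The approximate Stein identity says that the characteristic function \<phi> solves
  \<phi>' = -v t \<phi> up to an error. Multiplying by the integrating factor exp(v t^2 / 2) gives
  \<psi> with small derivative, and the mean value inequality compares \<psi>(t) with \<psi>(0) = 1.
  The factor lost in the derivative bound is regained on dividing it out, so the final error is free
  of v.\<close>

theorem char_normal_bound:
  fixes F :: "(nat \<Rightarrow> 'b) \<Rightarrow> real" and n :: nat and t :: real
  assumes S: "finite S" "S \<noteq> {}" and F: "bdd_diff n S c F" "0 \<le> c" and F2: "bdd_diff2 n S d F"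
    and e: "\<And>p. p \<in> {1..n} \<Longrightarrow> (\<Sum>q\<in>{1..n}-{p}. d p q) \<le> e" "0 \<le> e"
  defines "\<Omega> \<equiv> PiE {1..n} (\<lambda>_. S)"
  shows "norm (avg \<Omega> (\<lambda>V. iexp (t * (F V - avg \<Omega> F))) - of_real (exp (- (var \<Omega> F * t\<^sup>2 / 2))))
    \<le> \<bar>t\<bar> * (\<bar>t\<bar> * (sqrt n * (c\<^sup>2 + c * e)) + n * t\<^sup>2 * c^3)"
proof -
  define Z where "Z = (\<lambda>V. F V - avg \<Omega> F)"
  define \<phi> where "\<phi> = (\<lambda>t::real. avg \<Omega> (\<lambda>V. iexp (t * Z V)))"
  define v where "v = var \<Omega> F"
  define \<psi> where "\<psi> = (\<lambda>t::real. \<phi> t * of_real (exp (v * t\<^sup>2 / 2)))"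
  define \<epsilon> where "\<epsilon> = \<bar>t\<bar> * (sqrt n * (c\<^sup>2 + c * e)) + n * t\<^sup>2 * c^3"
  have fin: "finite \<Omega>" "\<Omega> \<noteq> {}" unfolding \<Omega>_def using S by (auto intro!: finite_PiE simp: PiE_eq_empty_iff)
  have v0: "0 \<le> v" unfolding v_def by (rule var_nonneg)
  define \<phi>' where "\<phi>' = (\<lambda>s::real. avg \<Omega> (\<lambda>V. \<i> * (of_real (Z V) * iexp (s * Z V))))"
  have d\<phi>: "(\<phi> has_vector_derivative \<phi>' s) (at s within A)" for s A
  proof -
    have "((\<lambda>x. iexp (x * Z V)) has_vector_derivative \<i> * (of_real (Z V) * iexp (s * Z V))) (at s within A)" for V
    proof -
      have "((\<lambda>z. exp (\<i> * (z * of_real (Z V)))) has_field_derivative \<i> * (of_real (Z V) * exp (\<i> * (of_real s * of_real (Z V))))) (at (of_real s))"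
        by (auto intro!: derivative_eq_intros)
      from has_vector_derivative_real_field[OF this] show ?thesis by simp
    qed
    then show ?thesis
      unfolding \<phi>_def \<phi>'_def avg_def by (intro has_vector_derivative_divide has_vector_derivative_sum)
  qed
  have d\<psi>: "(\<psi> has_vector_derivative ((\<phi>' s + of_real (v * s) * \<phi> s) * of_real (exp (v * s\<^sup>2 / 2)))) (at s within A)" for s A
  proof -
    have "((\<lambda>t. exp (v * t\<^sup>2 / 2)) has_field_derivative (v * s * exp (v * s\<^sup>2 / 2))) (at s within A)"
      by (auto intro!: derivative_eq_intros)
    then have "((\<lambda>t. complex_of_real (exp (v * t\<^sup>2 / 2))) has_vector_derivative of_real (v * s * exp (v * s\<^sup>2 / 2))) (at s within A)"
      by (rule has_vector_derivative_of_real)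
    from has_vector_derivative_mult[OF d\<phi> this] show ?thesis
      unfolding \<psi>_def by (simp add: algebra_simps)
  qed
  \<comment> \<open>Error term and integrating factor both grow with |s|, so their values at the
    endpoint t serve the whole segment.\<close>
  have bd: "norm ((\<phi>' s + of_real (v * s) * \<phi> s) * of_real (exp (v * s\<^sup>2 / 2))) \<le> \<epsilon> * exp (v * t\<^sup>2 / 2)"
    if "s \<in> closed_segment 0 t" for s
  proof -
    have st: "\<bar>s\<bar> \<le> \<bar>t\<bar>" using that by (auto simp: closed_segment_eq_real_ivl split: if_splits)
    have "\<phi>' s = \<i> * avg \<Omega> (\<lambda>V. of_real (Z V) * iexp (s * Z V))" unfolding \<phi>'_def by (rule avg_cmult)
    moreover have sb: "norm (avg \<Omega> (\<lambda>V. of_real (Z V) * iexp (s * Z V)) - \<i> * of_real (s * v) * \<phi> s)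
      \<le> \<bar>s\<bar> * (sqrt n * (c\<^sup>2 + c * e)) + n * s\<^sup>2 * c^3"
      using stein_char_bound[OF S F F2 e, of s] unfolding \<phi>_def Z_def v_def \<Omega>_def .
    ultimately have "\<phi>' s + of_real (v * s) * \<phi> s =
      \<i> * (avg \<Omega> (\<lambda>V. of_real (Z V) * iexp (s * Z V)) - \<i> * of_real (s * v) * \<phi> s)"
      by (simp add: algebra_simps)
    then have "norm (\<phi>' s + of_real (v * s) * \<phi> s) \<le> \<bar>s\<bar> * (sqrt n * (c\<^sup>2 + c * e)) + n * s\<^sup>2 * c^3"
      using sb by (simp only: norm_mult norm_ii mult_1_left)
    also have "\<dots> \<le> \<epsilon>" unfolding \<epsilon>_def
      using st F(2) e(2) by (intro add_mono mult_right_mono mult_left_mono) (auto simp: abs_le_square_iff)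
    finally have 1: "norm (\<phi>' s + of_real (v * s) * \<phi> s) \<le> \<epsilon>" .
    have 2: "exp (v * s\<^sup>2 / 2) \<le> exp (v * t\<^sup>2 / 2)"
      using st v0 by (auto simp: abs_le_square_iff intro!: mult_left_mono divide_right_mono)
    have "norm ((\<phi>' s + of_real (v * s) * \<phi> s) * of_real (exp (v * s\<^sup>2 / 2))) =
      norm (\<phi>' s + of_real (v * s) * \<phi> s) * exp (v * s\<^sup>2 / 2)"
      by (simp add: norm_mult)
    also have "\<dots> \<le> \<epsilon> * exp (v * t\<^sup>2 / 2)" using 1 2 by (intro mult_mono) (auto intro: order_trans[OF norm_ge_zero])
    finally show ?thesis .
  qed
  have "norm (\<psi> t - \<psi> 0) \<le> (\<epsilon> * exp (v * t\<^sup>2 / 2)) * norm (t - 0)"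
  proof (rule differentiable_bound[where S = "closed_segment 0 t" and f' = "\<lambda>s h. h *\<^sub>R ((\<phi>' s + of_real (v * s) * \<phi> s) * of_real (exp (v * s\<^sup>2 / 2)))"])
    show "(\<psi> has_derivative (\<lambda>h. h *\<^sub>R ((\<phi>' s + of_real (v * s) * \<phi> s) * of_real (exp (v * s\<^sup>2 / 2))))) (at s within closed_segment 0 t)" for s
      using d\<psi> unfolding has_vector_derivative_def .
    show "onorm (\<lambda>h. h *\<^sub>R ((\<phi>' s + of_real (v * s) * \<phi> s) * of_real (exp (v * s\<^sup>2 / 2)))) \<le> \<epsilon> * exp (v * t\<^sup>2 / 2)"
      if "s \<in> closed_segment 0 t" for s
      using bd[OF that] by (subst onorm_scaleR_left) (auto simp: onorm_id)
  qed auto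
  moreover have "\<psi> 0 = 1" unfolding \<psi>_def \<phi>_def using fin by (simp add: avg_const)
  moreover have "\<phi> t - of_real (exp (- (v * t\<^sup>2 / 2))) = (\<psi> t - 1) * of_real (exp (- (v * t\<^sup>2 / 2)))"
  proof -
    have "of_real (exp (v * t\<^sup>2 / 2)) * of_real (exp (- (v * t\<^sup>2 / 2))) = (1::complex)"
      by (simp only: of_real_mult[symmetric] exp_add[symmetric]) simp
    then show ?thesis unfolding \<psi>_def by (simp add: left_diff_distrib mult.assoc)
  qed
  ultimately have "norm (\<phi> t - of_real (exp (- (v * t\<^sup>2 / 2)))) \<le> (\<epsilon> * exp (v * t\<^sup>2 / 2)) * \<bar>t\<bar> * exp (- (v * t\<^sup>2 / 2))"
    by (simp add: norm_mult mult_right_mono)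
  also have "\<dots> = \<bar>t\<bar> * \<epsilon>" by (simp add: exp_minus field_simps)
  finally show ?thesis unfolding \<phi>_def Z_def v_def \<epsilon>_def .
qed

section \<open>A Poincare inequality for the symmetric group\<close>

abbreviation perms :: "'a set \<Rightarrow> ('a \<Rightarrow> 'a) set" where
  "perms S \<equiv> {p. p permutes S}"

abbreviation tr :: "'a \<Rightarrow> 'a \<Rightarrow> 'a \<Rightarrow> 'a" where
  "tr \<equiv> Transposition.transpose"

lemma perms_nonempty: "perms S \<noteq> {}"
  using permutes_id by blast

text \<open>Every permutation of \<open>insert z S\<close> is uniquely
  \<open>tr z x \<circ> p\<close> with p permuting S, and x is then the image of z. Conditioning on
  x is the inductive step of the Poincare inequality.\<close>

lemma avg_perms_insert:
  assumes "finite S" "z \<notin> S"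
  shows "avg (perms (insert z S)) f = avg (insert z S) (\<lambda>x. avg (perms S) (\<lambda>p. f (tr z x \<circ> p)))"
proof -
  have "card (perms (insert z S)) = Suc (card S) * card (perms S)"
    using assms by (simp add: card_permutations[OF refl])
  then show ?thesis
    unfolding avg_def using sum_over_permutations_insert[OF assms, of f] assms
    by (simp add: sum_divide_distrib[symmetric] algebra_simps)
qed

lemma perms_left_bij:
  assumes "\<tau> permutes S"
  shows "bij_betw (\<lambda>p. \<tau> \<circ> p) (perms S) (perms S)"
proof (rule bij_betwI[where g = "\<lambda>p. inv \<tau> \<circ> p"])
  show "(\<circ>) \<tau> \<in> perms S \<rightarrow> perms S" "(\<circ>) (inv \<tau>) \<in> perms S \<rightarrow> perms S"
    using assms permutes_compose permutes_inv by blast+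
qed (use permutes_inv_o[OF assms] in \<open>auto simp: o_assoc\<close>)

lemma perms_right_bij:
  assumes "\<tau> permutes S"
  shows "bij_betw (\<lambda>p. p \<circ> \<tau>) (perms S) (perms S)"
proof (rule bij_betwI[where g = "\<lambda>p. p \<circ> inv \<tau>"])
  show "(\<lambda>p. p \<circ> \<tau>) \<in> perms S \<rightarrow> perms S" "(\<lambda>p. p \<circ> inv \<tau>) \<in> perms S \<rightarrow> perms S"
    using assms permutes_compose permutes_inv by blast+
qed (use permutes_inv_o[OF assms] in \<open>auto simp: o_assoc[symmetric]\<close>)

lemma var_pairs:
  assumes "finite A" "A \<noteq> {}"
  shows "var A f = avg A (\<lambda>x. avg A (\<lambda>y. (f x - f y)\<^sup>2)) / 2"
proof -
  have "avg A (\<lambda>x. avg A (\<lambda>y. (f x - f y)\<^sup>2)) = avg A (\<lambda>x. avg A (\<lambda>y. (f x)\<^sup>2 - 2 * f x * f y + (f y)\<^sup>2))"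
    by (intro avg_cong) (simp add: power2_eq_square algebra_simps)
  also have "\<dots> = 2 * (avg A (\<lambda>x. (f x)\<^sup>2) - (avg A f)\<^sup>2)"
    using assms by (simp add: avg_add avg_diff avg_cmult avg_cmult2 avg_const power2_eq_square)
  finally show ?thesis using var_eq[OF assms] by simp
qed

definition swap_energy :: "'a set \<Rightarrow> (('a \<Rightarrow> 'a) \<Rightarrow> real) \<Rightarrow> 'a \<Rightarrow> 'a \<Rightarrow> real" where
  "swap_energy S f a b = avg (perms S) (\<lambda>p. (f p - f (p \<circ> tr a b))\<^sup>2)"

lemma swap_energy_nonneg: "0 \<le> swap_energy S f a b"
  unfolding swap_energy_def by (intro avg_nonneg) auto

lemma swap_energy_same: "swap_energy S f a a = 0"
  by (simp add: swap_energy_def avg_def)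

text \<open>Conditioning on the value at $z$: two conditional means differ by left multiplication with a transposition
  of values, which is right multiplication with a transposition involving $z$.\<close>

lemma var_perms_insert:
  fixes f :: "('a \<Rightarrow> 'a) \<Rightarrow> real"
  assumes S: "finite S" "z \<notin> S"
  shows "var (perms (insert z S)) f \<le> avg (insert z S) (\<lambda>x. var (perms S) (\<lambda>p. f (tr z x \<circ> p)))
    + (\<Sum>b\<in>insert z S. swap_energy (insert z S) f z b) / (2 * card (insert z S))"
proof -
  let ?X = "insert z S"
  have finX: "finite ?X" "?X \<noteq> {}" using S by auto
  have finP: "finite (perms S)" "perms S \<noteq> {}" "finite (perms ?X)" "perms ?X \<noteq> {}"
    using S by (simp_all add: finite_permutations perms_nonempty del: Collect_empty_eq)
  define g where "g = (\<lambda>x. avg (perms S) (\<lambda>p. f (tr z x \<circ> p)))"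
  have "var (perms ?X) f = avg ?X (\<lambda>x. avg (perms S) (\<lambda>p. (f (tr z x \<circ> p))\<^sup>2)) - (avg ?X g)\<^sup>2"
    unfolding var_eq[OF finP(3,4)] g_def by (simp only: avg_perms_insert[OF S])
  also have "avg ?X (\<lambda>x. avg (perms S) (\<lambda>p. (f (tr z x \<circ> p))\<^sup>2)) =
     avg ?X (\<lambda>x. var (perms S) (\<lambda>p. f (tr z x \<circ> p))) + avg ?X (\<lambda>x. (g x)\<^sup>2)"
    unfolding avg_add[symmetric] by (intro avg_cong) (simp add: var_eq[OF finP(1,2)] g_def)
  finally have dec: "var (perms ?X) f = avg ?X (\<lambda>x. var (perms S) (\<lambda>p. f (tr z x \<circ> p))) + var ?X g"
    by (simp add: var_eq[OF finX])
  have g2: "g y = avg (perms S) (\<lambda>p. f (tr x y \<circ> (tr z x \<circ> p)))" if "x \<in> ?X" "y \<in> ?X" for x y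
  proof -
    \<comment> \<open>The three factors carry z to x, then to y, then back to z; hence \<tau> fixes
      z, and translation by it preserves the average over \<open>perms S\<close>.\<close>
    define \<tau> where "\<tau> = tr z y \<circ> tr x y \<circ> tr z x"
    have "\<tau> permutes ?X" unfolding \<tau>_def using that
      by (intro permutes_compose permutes_swap_id) auto
    then have \<tau>: "\<tau> permutes S"
      by (rule permutes_superset) (auto simp: \<tau>_def Transposition.transpose_def)
    have "tr z y \<circ> (\<tau> \<circ> p) = tr x y \<circ> (tr z x \<circ> p)" for p :: "'a \<Rightarrow> 'a"
      by (simp add: \<tau>_def fun_eq_iff)
    then show ?thesis
      unfolding g_def using avg_bij[OF perms_left_bij[OF \<tau>], of "\<lambda>p. f (tr z y \<circ> p)"] by simp
  qed
  have "var ?X g = avg ?X (\<lambda>x. avg ?X (\<lambda>y. (g x - g y)\<^sup>2)) / 2"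
    by (rule var_pairs[OF finX])
  also have "\<dots> \<le> avg ?X (\<lambda>x. avg ?X (\<lambda>y. avg (perms S) (\<lambda>p.
      (f (tr z x \<circ> p) - f (tr x y \<circ> (tr z x \<circ> p)))\<^sup>2))) / 2"
  proof (intro divide_right_mono avg_mono)
    fix x y assume "x \<in> ?X" "y \<in> ?X"
    then have "g x - g y = avg (perms S) (\<lambda>p. f (tr z x \<circ> p) - f (tr x y \<circ> (tr z x \<circ> p)))"
      by (simp add: g2[of x y] avg_diff) (simp add: g_def)
    then show "(g x - g y)\<^sup>2 \<le> avg (perms S) (\<lambda>p. (f (tr z x \<circ> p) - f (tr x y \<circ> (tr z x \<circ> p)))\<^sup>2)"
      by (simp add: avg_square_le)
  qed simp
  also have "\<dots> = avg ?X (\<lambda>x. avg (perms S) (\<lambda>p. (\<Sum>y\<in>?X.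
      (f (tr z x \<circ> p) - f (tr x y \<circ> (tr z x \<circ> p)))\<^sup>2))) / (2 * card ?X)"
  proof -
    have "avg ?X (\<lambda>y. avg (perms S) (\<lambda>p. h y p)) = avg (perms S) (\<lambda>p. (\<Sum>y\<in>?X. h y p)) / card ?X"
      for h :: "'a \<Rightarrow> ('a \<Rightarrow> 'a) \<Rightarrow> real"
      by (simp only: avg_sum) (simp add: avg_def)
    then show ?thesis by (simp add: avg_divide)
  qed
  also have "avg ?X (\<lambda>x. avg (perms S) (\<lambda>p. (\<Sum>y\<in>?X.
      (f (tr z x \<circ> p) - f (tr x y \<circ> (tr z x \<circ> p)))\<^sup>2))) =
    avg ?X (\<lambda>x. avg (perms S) (\<lambda>p. (\<Sum>b\<in>?X.
      (f (tr z x \<circ> p) - f (tr z x \<circ> p \<circ> tr z b))\<^sup>2)))"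
  proof (intro avg_cong)
    fix x p assume x: "x \<in> ?X" and "p \<in> perms S"
    then have p: "p permutes S" by simp
    define q where "q = tr z x \<circ> p"
    have q: "q permutes ?X" unfolding q_def using x permutes_subset[OF p, of ?X]
      by (intro permutes_compose permutes_swap_id) auto
    have qz: "q z = x" using p S(2) by (simp add: q_def permutes_not_in)
    \<comment> \<open>Substituting y = q b turns the transposition of the values x and y into the
      transposition of the positions z and b, because q z = x.\<close>
    have "(\<Sum>y\<in>?X. (f q - f (tr x y \<circ> q))\<^sup>2) = (\<Sum>b\<in>?X. (f q - f (tr x (q b) \<circ> q))\<^sup>2)"
      using sum.reindex_bij_betw[OF permutes_imp_bij[OF q], of "\<lambda>y. (f q - f (tr x y \<circ> q))\<^sup>2"] by simp
    also have "\<dots> = (\<Sum>b\<in>?X. (f q - f (q \<circ> tr z b))\<^sup>2)"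
    proof (intro sum.cong refl)
      fix b
      have "tr x (q b) \<circ> q = q \<circ> tr z b"
        using transpose_comp_eq[OF permutes_bij[OF q], of x "q b"] qz permutes_inverses[OF q] by metis
      then show "(f q - f (tr x (q b) \<circ> q))\<^sup>2 = (f q - f (q \<circ> tr z b))\<^sup>2" by simp
    qed
    finally show "(\<Sum>y\<in>?X. (f (tr z x \<circ> p) - f (tr x y \<circ> (tr z x \<circ> p)))\<^sup>2) =
      (\<Sum>b\<in>?X. (f (tr z x \<circ> p) - f (tr z x \<circ> p \<circ> tr z b))\<^sup>2)"
      unfolding q_def .
  qed
  also have "\<dots> = (\<Sum>b\<in>?X. swap_energy ?X f z b)"
    unfolding swap_energy_def avg_sum[symmetric] by (rule avg_perms_insert[OF S, symmetric])
  finally show ?thesis using dec by simp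
qed

text \<open>A pair x \<noteq> y survives the deletion of z for exactly \<open>card X - 2\<close>
  choices of z, and diagonal terms vanish.\<close>

lemma sum_remove_pairs_le:
  fixes a :: "'a \<Rightarrow> 'a \<Rightarrow> real"
  assumes X: "finite X" "2 \<le> card X" and a: "\<And>x y. 0 \<le> a x y" "\<And>x. a x x = 0"
  shows "(\<Sum>z\<in>X. \<Sum>x\<in>X-{z}. \<Sum>y\<in>X-{z}. a x y) \<le> (card X - 2) * (\<Sum>x\<in>X. \<Sum>y\<in>X. a x y)"
proof -
  have "(\<Sum>x\<in>X-{z}. \<Sum>y\<in>X-{z}. a x y) = (\<Sum>x\<in>X. \<Sum>y\<in>X. if x \<noteq> z \<and> y \<noteq> z then a x y else 0)" for z
  proof -
    have r: "(\<Sum>x\<in>X-{z}. g x) = (\<Sum>x\<in>X. if x \<noteq> z then g x else 0)" for g :: "'a \<Rightarrow> real"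
      using X by (intro sum.mono_neutral_cong_left) auto
    show ?thesis unfolding r by (intro sum.cong refl) auto
  qed
  then have "(\<Sum>z\<in>X. \<Sum>x\<in>X-{z}. \<Sum>y\<in>X-{z}. a x y) = (\<Sum>x\<in>X. \<Sum>y\<in>X. \<Sum>z\<in>X. if x \<noteq> z \<and> y \<noteq> z then a x y else 0)"
    by (simp only:) (rule trans[OF sum.swap], intro sum.cong refl sum.swap)
  also have "\<dots> \<le> (\<Sum>x\<in>X. \<Sum>y\<in>X. (card X - 2) * a x y)"
  proof (intro sum_mono)
    fix x y assume xy: "x \<in> X" "y \<in> X"
    show "(\<Sum>z\<in>X. if x \<noteq> z \<and> y \<noteq> z then a x y else 0) \<le> (card X - 2) * a x y"
    proof (cases "x = y")
      case False
      have "(\<Sum>z\<in>X. if x \<noteq> z \<and> y \<noteq> z then a x y else 0) = (\<Sum>z\<in>X-{x,y}. a x y)"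
        using X by (intro sum.mono_neutral_cong_right) auto
      also have "\<dots> = card (X - {x,y}) * a x y" by simp
      also have "card (X - {x,y}) = card X - 2" using X xy False by (subst card_Diff_subset) auto
      finally show ?thesis by simp
    qed (use a in \<open>auto intro!: sum_nonpos\<close>)
  qed
  also have "\<dots> = (card X - 2) * (\<Sum>x\<in>X. \<Sum>y\<in>X. a x y)" by (simp add: sum_distrib_left)
  finally show ?thesis .
qed

text \<open>The one-step inequality singles out a point z; summing it over all z restores the
  symmetry. With n = \<open>card X\<close> - 1, each pair is counted n - 1 times among the pairs
  avoiding z, the step itself costs another half, and (n - 1) + 1/2 \<le> n closes the
  induction.\<close>

theorem var_perms_le:
  fixes f :: "('a \<Rightarrow> 'a) \<Rightarrow> real"
  assumes "finite X"
  shows "card X * var (perms X) f \<le> (\<Sum>a\<in>X. \<Sum>b\<in>X. swap_energy X f a b)"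
  using assms
proof (induction "card X" arbitrary: X f)
  case 0
  then show ?case by simp
next
  case (Suc n)
  define E where "E = (\<Sum>a\<in>X. \<Sum>b\<in>X. swap_energy X f a b)"
  have E0: "0 \<le> E" unfolding E_def by (intro sum_nonneg swap_energy_nonneg)
  define e where "e = (\<lambda>z. \<Sum>b\<in>X. swap_energy X f z b)"
  have e0: "0 \<le> e z" for z unfolding e_def by (intro sum_nonneg swap_energy_nonneg)
  have Ee: "E = (\<Sum>z\<in>X. e z)" unfolding E_def e_def ..
  have step: "n * var (perms X) f \<le> (\<Sum>a\<in>X-{z}. \<Sum>b\<in>X-{z}. swap_energy X f a b) + e z / 2" if z: "z \<in> X" for z
  proof -
    define S where "S = X - {z}"
    have S: "finite S" "z \<notin> S" "X = insert z S" "n = card S" using Suc z by (auto simp: S_def)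
    have "n * var (perms S) (\<lambda>p. f (tr z x \<circ> p)) \<le> (\<Sum>a\<in>S. \<Sum>b\<in>S. swap_energy S (\<lambda>p. f (tr z x \<circ> p)) a b)" for x
      using Suc(1)[OF S(4) S(1)] S(4) by simp
    then have "n * avg X (\<lambda>x. var (perms S) (\<lambda>p. f (tr z x \<circ> p))) \<le>
       avg X (\<lambda>x. \<Sum>a\<in>S. \<Sum>b\<in>S. swap_energy S (\<lambda>p. f (tr z x \<circ> p)) a b)"
      unfolding avg_cmult[symmetric] by (intro avg_mono)
    also have "\<dots> = (\<Sum>a\<in>S. \<Sum>b\<in>S. swap_energy X f a b)"
      unfolding avg_sum swap_energy_def S(3) avg_perms_insert[OF S(1,2)] by (simp add: o_assoc)
    finally have 1: "n * avg X (\<lambda>x. var (perms S) (\<lambda>p. f (tr z x \<circ> p))) \<le> (\<Sum>a\<in>S. \<Sum>b\<in>S. swap_energy X f a b)" .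
    have "n * var (perms X) f \<le> n * (avg X (\<lambda>x. var (perms S) (\<lambda>p. f (tr z x \<circ> p))) + e z / (2 * card X))"
      using var_perms_insert[OF S(1,2), of f] unfolding S(3)[symmetric] e_def by (intro mult_left_mono) auto
    also have "\<dots> \<le> (\<Sum>a\<in>S. \<Sum>b\<in>S. swap_energy X f a b) + n * (e z / (2 * card X))"
      using 1 by (simp add: distrib_left)
    also have "n * (e z / (2 * card X)) \<le> e z / 2"
      unfolding Suc(2)[symmetric] using e0[of z] by (simp add: field_simps)
    finally show ?thesis unfolding S_def by simp
  qed
  show ?case
  proof (cases "n = 0")
    case True
    then obtain z where z: "X = {z}" using Suc(2) by (metis card_1_singletonE One_nat_def)
    have "perms X = {id}" unfolding z by (simp add: permutes_sing)
    then show ?thesis by (simp add: var_def avg_def sum_nonneg swap_energy_def)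
  next
    case False
    have "n * (card X * var (perms X) f) = (\<Sum>z\<in>X. n * var (perms X) f)" by simp
    also have "\<dots> \<le> (\<Sum>z\<in>X. (\<Sum>a\<in>X-{z}. \<Sum>b\<in>X-{z}. swap_energy X f a b) + e z / 2)"
      by (intro sum_mono step)
    also have "\<dots> = (\<Sum>z\<in>X. \<Sum>a\<in>X-{z}. \<Sum>b\<in>X-{z}. swap_energy X f a b) + E / 2"
      by (simp add: sum.distrib Ee sum_divide_distrib)
    also have "\<dots> \<le> (card X - 2) * E + E / 2"
      unfolding E_def using False Suc
      by (intro add_right_mono sum_remove_pairs_le swap_energy_nonneg swap_energy_same) auto
    also have "\<dots> \<le> n * E"
    proof -
      have "real (card X - 2) + 1/2 \<le> n" using False Suc(2) by (simp add: of_nat_diff)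
      then have "(real (card X - 2) + 1/2) * E \<le> n * E" using E0 by (intro mult_right_mono)
      then show ?thesis by (simp add: algebra_simps)
    qed
    finally show ?thesis using False unfolding E_def by simp
  qed
qed

section \<open>Occurrences of a vincular pattern\<close>

text \<open>\<open>K\<close> is an arbitrary set rather than \<open>{1..k}\<close> because the union
  of the supports of two occurrences, with the adjacencies forced by either of them, has to be
  covered as well.\<close>

definition incr_maps :: "nat set \<Rightarrow> nat set \<Rightarrow> nat \<Rightarrow> (nat \<Rightarrow> nat) set" where
  "incr_maps K B n = {i \<in> K \<rightarrow>\<^sub>E {1..n}. strict_mono_on K i \<and> (\<forall>a\<in>B. i (Suc a) = Suc (i a))}"

lemma finite_incr_maps: "finite K \<Longrightarrow> finite (incr_maps K B n)"
  unfolding incr_maps_def by (rule finite_subset[OF _ finite_PiE[of K "\<lambda>_. {1..n}"]]) auto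

text \<open>The top point is forced to follow its predecessor y and carries no information; dropping
  it also uses up one place of the range.\<close>

lemma incr_maps_insert_step:
  assumes K: "finite K" "\<forall>x\<in>K. x < Suc y" and y: "y \<in> B" "B \<subseteq> K"
  shows "card (incr_maps (insert (Suc y) K) B (Suc n)) = card (incr_maps K (B - {y}) n)"
proof (rule bij_betw_same_card[OF bij_betwI[where g = "\<lambda>\<kappa>. \<kappa>(Suc y := Suc (\<kappa> y))"]])
  have yK: "y \<in> K" using y by auto
  show "(\<lambda>\<kappa>. restrict \<kappa> K) \<in> incr_maps (insert (Suc y) K) B (Suc n) \<rightarrow> incr_maps K (B - {y}) n"
  proof
    fix \<kappa> assume "\<kappa> \<in> incr_maps (insert (Suc y) K) B (Suc n)"
    then have \<kappa>: "\<kappa> \<in> insert (Suc y) K \<rightarrow>\<^sub>E {1..Suc n}" "strict_mono_on (insert (Suc y) K) \<kappa>" "\<forall>a\<in>B. \<kappa> (Suc a) = Suc (\<kappa> a)"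
      by (auto simp: incr_maps_def)
    have "\<kappa> x < \<kappa> (Suc y)" if "x \<in> K" for x
      using \<kappa>(2) that K(2) by (auto simp: strict_mono_on_def)
    moreover have "\<kappa> (Suc y) \<le> Suc n" using \<kappa>(1) by (auto simp: PiE_iff)
    ultimately have "\<kappa> x \<le> n" if "x \<in> K" for x using that by fastforce
    then have "restrict \<kappa> K \<in> K \<rightarrow>\<^sub>E {1..n}" using \<kappa>(1) by (auto simp: PiE_iff)
    moreover have "strict_mono_on K (restrict \<kappa> K)" using \<kappa>(2) by (auto simp: strict_mono_on_def)
    moreover have "restrict \<kappa> K (Suc a) = Suc (restrict \<kappa> K a)" if a: "a \<in> B - {y}" for a
    proof -
      have "a \<in> K" "a < y" using a y K(2) by (auto simp: less_Suc_eq)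
      have "\<kappa> (Suc a) = Suc (\<kappa> a)" using \<kappa>(3) a by auto
      have "Suc a \<in> K \<or> Suc a \<notin> insert (Suc y) K" using a by auto
      then show ?thesis
        using \<open>\<kappa> (Suc a) = Suc (\<kappa> a)\<close> \<open>a \<in> K\<close> \<kappa>(1) \<open>a < y\<close>
        by (auto simp: PiE_iff extensional_def)
    qed
    ultimately show "restrict \<kappa> K \<in> incr_maps K (B - {y}) n" by (auto simp: incr_maps_def)
  qed
  show "(\<lambda>\<kappa>. \<kappa>(Suc y := Suc (\<kappa> y))) \<in> incr_maps K (B - {y}) n \<rightarrow> incr_maps (insert (Suc y) K) B (Suc n)"
  proof
    fix \<kappa> assume "\<kappa> \<in> incr_maps K (B - {y}) n"
    then have \<kappa>: "\<kappa> \<in> K \<rightarrow>\<^sub>E {1..n}" "strict_mono_on K \<kappa>" "\<forall>a\<in>B - {y}. \<kappa> (Suc a) = Suc (\<kappa> a)"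
      by (auto simp: incr_maps_def)
    have le: "\<kappa> x \<le> \<kappa> y" if "x \<in> K" for x
      using that \<kappa>(2) yK K(2) by (metis strict_mono_on_def less_Suc_eq order.strict_implies_order order_refl)
    have "\<kappa>(Suc y := Suc (\<kappa> y)) \<in> insert (Suc y) K \<rightarrow>\<^sub>E {1..Suc n}"
      using \<kappa>(1) yK by (auto simp: PiE_iff extensional_def le_Suc_eq)
    moreover have "strict_mono_on (insert (Suc y) K) (\<kappa>(Suc y := Suc (\<kappa> y)))"
      unfolding strict_mono_on_def using \<kappa>(2) le K(2)
      by (auto simp: strict_mono_on_def le_imp_less_Suc dest: less_asym)
    moreover have "\<forall>a\<in>B. (\<kappa>(Suc y := Suc (\<kappa> y))) (Suc a) = Suc ((\<kappa>(Suc y := Suc (\<kappa> y))) a)"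
      using \<kappa>(3) y K(2) by auto
    ultimately show "\<kappa>(Suc y := Suc (\<kappa> y)) \<in> incr_maps (insert (Suc y) K) B (Suc n)"
      by (auto simp: incr_maps_def)
  qed
next
  fix \<kappa> assume "\<kappa> \<in> incr_maps (insert (Suc y) K) B (Suc n)"
  then show "(restrict \<kappa> K)(Suc y := Suc (restrict \<kappa> K y)) = \<kappa>"
    using y by (auto simp: incr_maps_def PiE_iff extensional_def fun_eq_iff)
next
  fix \<kappa> assume "\<kappa> \<in> incr_maps K (B - {y}) n"
  then show "restrict (\<kappa>(Suc y := Suc (\<kappa> y))) K = \<kappa>"
    using K(2) by (auto simp: incr_maps_def PiE_iff extensional_def fun_eq_iff)
qed

text \<open>Pascal's rule: when the top point is not bound to a predecessor, either it takes the
  value \<open>Suc n\<close> and the other points are free in 1, ..., n, or all values are at most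
  n.\<close>

lemma incr_maps_insert_split:
  assumes K: "finite K" "\<forall>x\<in>K. x < z" and B: "B \<subseteq> K" "Suc ` B \<subseteq> K"
  shows "card (incr_maps (insert z K) B (Suc n)) = card (incr_maps (insert z K) B n) + card (incr_maps K B n)"
proof -
  have zB: "a \<in> B \<Longrightarrow> a \<noteq> z \<and> Suc a \<noteq> z \<and> a \<in> K \<and> Suc a \<in> K" for a using B K(2) by auto
  have 1: "incr_maps (insert z K) B (Suc n) =
    incr_maps (insert z K) B n \<union> (\<lambda>\<kappa>. \<kappa>(z := Suc n)) ` incr_maps K B n"
  proof (intro equalityI subsetI)
    fix \<kappa> assume "\<kappa> \<in> incr_maps (insert z K) B (Suc n)"
    then have \<kappa>: "\<kappa> \<in> insert z K \<rightarrow>\<^sub>E {1..Suc n}" "strict_mono_on (insert z K) \<kappa>" "\<forall>a\<in>B. \<kappa> (Suc a) = Suc (\<kappa> a)"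
      by (auto simp: incr_maps_def)
    have lt: "\<kappa> x < \<kappa> z" if "x \<in> K" for x using \<kappa>(2) that K(2) by (auto simp: strict_mono_on_def)
    have zn: "\<kappa> z \<le> Suc n" using \<kappa>(1) by (auto simp: PiE_iff)
    have le: "\<kappa> x \<le> n" if "x \<in> K" for x using lt[OF that] zn by simp
    show "\<kappa> \<in> incr_maps (insert z K) B n \<union> (\<lambda>\<kappa>. \<kappa>(z := Suc n)) ` incr_maps K B n"
    proof (cases "\<kappa> z = Suc n")
      case True
      have "restrict \<kappa> K \<in> incr_maps K B n"
        using \<kappa> le zB by (auto simp: incr_maps_def PiE_iff strict_mono_on_def)
      moreover have "\<kappa> = (restrict \<kappa> K)(z := Suc n)"
        using \<kappa>(1) True by (auto simp: PiE_iff extensional_def fun_eq_iff)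
      ultimately show ?thesis by blast
    next
      case False
      then have "\<kappa> \<in> incr_maps (insert z K) B n"
        using \<kappa> le zn by (auto simp: incr_maps_def PiE_iff)
      then show ?thesis by blast
    qed
  next
    fix \<kappa> assume "\<kappa> \<in> incr_maps (insert z K) B n \<union> (\<lambda>\<kappa>. \<kappa>(z := Suc n)) ` incr_maps K B n"
    then show "\<kappa> \<in> incr_maps (insert z K) B (Suc n)"
    proof
      assume "\<kappa> \<in> incr_maps (insert z K) B n"
      then show ?thesis by (auto simp: incr_maps_def PiE_iff le_Suc_eq)
    next
      assume "\<kappa> \<in> (\<lambda>\<kappa>. \<kappa>(z := Suc n)) ` incr_maps K B n"
      then obtain \<mu> where \<mu>: "\<mu> \<in> incr_maps K B n" "\<kappa> = \<mu>(z := Suc n)" by auto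
      have "strict_mono_on (insert z K) \<kappa>"
        unfolding strict_mono_on_def \<mu>(2) using \<mu>(1) K(2)
        by (auto simp: incr_maps_def strict_mono_on_def PiE_iff le_imp_less_Suc dest: less_asym)
      moreover have "\<kappa> \<in> insert z K \<rightarrow>\<^sub>E {1..Suc n}"
        using \<mu> by (auto simp: incr_maps_def PiE_iff extensional_def le_Suc_eq)
      moreover have "\<forall>a\<in>B. \<kappa> (Suc a) = Suc (\<kappa> a)"
        using \<mu> zB by (auto simp: incr_maps_def)
      ultimately show ?thesis by (auto simp: incr_maps_def)
    qed
  qed
  have 2: "inj_on (\<lambda>\<kappa>. \<kappa>(z := Suc n)) (incr_maps K B n)"
  proof (rule inj_onI)
    fix \<kappa> \<mu> assume *: "\<kappa> \<in> incr_maps K B n" "\<mu> \<in> incr_maps K B n" "\<kappa>(z := Suc n) = \<mu>(z := Suc n)"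
    have "z \<notin> K" using K(2) by auto
    then have "\<kappa> z = \<mu> z" using *(1,2) by (auto simp: incr_maps_def PiE_iff extensional_def)
    then show "\<kappa> = \<mu>" using *(3) by (metis fun_upd_triv fun_upd_upd)
  qed
  have 3: "incr_maps (insert z K) B n \<inter> (\<lambda>\<kappa>. \<kappa>(z := Suc n)) ` incr_maps K B n = {}"
    by (auto simp: incr_maps_def PiE_iff)
  show ?thesis
    unfolding 1 using K(1) 2 3 by (subst card_Un_disjoint) (auto simp: finite_incr_maps card_image)
qed

lemma incr_maps_0: "K \<noteq> {} \<Longrightarrow> incr_maps K B 0 = {}"
  by (auto simp: incr_maps_def PiE_iff)

text \<open>Contracting the forced adjacencies removes \<open>card B\<close> points and
  \<open>card B\<close> places and leaves unconstrained increasing maps. The induction adds the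
  largest point, which is either forced or governed by Pascal's rule.\<close>

lemma card_incr_maps:
  assumes "finite K" "B \<subseteq> K" "Suc ` B \<subseteq> K"
  shows "card (incr_maps K B n) = (n - card B) choose (card K - card B)"
  using assms
proof (induction K arbitrary: B n rule: finite_linorder_max_induct)
  case empty
  then have "incr_maps {} B n = {\<lambda>_. undefined}" by (auto simp: incr_maps_def strict_mono_on_def)
  then show ?case using empty by simp
next
  case (insert z K)
  have zB: "z \<notin> B"
  proof
    assume "z \<in> B"
    then have "Suc z \<in> insert z K" using insert.prems(2) by blast
    then show False using insert.hyps(2) by force
  qed
  then have BK: "B \<subseteq> K" using insert.prems by auto
  have finB: "finite B" using BK insert.hyps(1) finite_subset by auto
  have z: "z \<notin> K" using insert.hyps(2) by auto
  have cB: "card B \<le> card K" using BK insert.hyps(1) by (rule card_mono[rotated])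
  show ?case
  proof (cases "\<exists>y\<in>B. Suc y = z")
    case True
    then obtain y where y: "y \<in> B" "Suc y = z" by auto
    show ?thesis
    proof (cases n)
      case 0
      then show ?thesis using z insert.hyps(1) cB by (simp add: incr_maps_0 Suc_diff_le)
    next
      case (Suc n0)
      have "card (incr_maps (insert z K) B n) = card (incr_maps K (B - {y}) n0)"
        using incr_maps_insert_step[of K y B n0] insert.hyps y BK Suc by simp
      also have "\<dots> = (n0 - card (B - {y})) choose (card K - card (B - {y}))"
        using insert.prems y BK by (intro insert.IH) auto
      also have "card (B - {y}) = card B - 1" using y finB by simp
      also have "n0 - (card B - 1) = n - card B"
        using y finB Suc by (cases "card B") auto
      also have "card K - (card B - 1) = card (insert z K) - card B"
        using y finB z insert.hyps(1) by (cases "card B") auto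
      finally show ?thesis .
    qed
  next
    case False
    then have SB: "Suc ` B \<subseteq> K" using insert.prems by auto
    \<comment> \<open>This guards the truncated subtraction. If n < \<open>card B\<close> then B is
      nonempty, and the successor of its maximum lies in K but not in B, so the lower index
      \<open>card K - card B\<close> is positive and Pascal's rule reads 0 = 0.\<close>
    have cB': "B \<noteq> {} \<Longrightarrow> card B < card K"
    proof -
      assume "B \<noteq> {}"
      then have "Suc (Max B) \<in> K" "Suc (Max B) \<notin> B" using SB Max_in[OF finB] Max_ge[OF finB, of "Suc (Max B)"] by auto
      then have "B \<subset> K" using BK by auto
      then show ?thesis using insert.hyps(1) by (rule psubset_card_mono[rotated])
    qed
    show ?thesis
    proof (induction n)
      case 0
      then show ?case using z insert.hyps(1) cB by (simp add: incr_maps_0 Suc_diff_le)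
    next
      case (Suc n)
      have "card (incr_maps (insert z K) B (Suc n)) = ((n - card B) choose (card (insert z K) - card B)) + ((n - card B) choose (card K - card B))"
        using incr_maps_insert_split[OF insert.hyps(1,2) BK SB] Suc insert.IH[OF BK SB] by simp
      also have "\<dots> = (Suc n - card B) choose (card (insert z K) - card B)"
      proof (cases "card B \<le> n")
        case True
        then show ?thesis using z insert.hyps(1) cB by (simp add: Suc_diff_le)
      next
        case False
        then have "card B < card K" using cB' by (cases "B = {}") auto
        then show ?thesis using False z insert.hyps(1) by (simp add: Suc_diff_le binomial_eq_0)
      qed
      finally show ?case .
    qed
  qed
qed

text \<open>The value at x is the x-th smallest element of the image, so the image determines the
  map.\<close>

lemma strict_mono_on_image_inj:
  fixes i j :: "nat \<Rightarrow> nat"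
  assumes "strict_mono_on {1..k} i" "strict_mono_on {1..k} j" "i ` {1..k} = j ` {1..k}" "x \<in> {1..k}"
  shows "i x = j x"
proof -
  have c: "card {y \<in> f ` {1..k}. y \<le> f x} = x" if f: "strict_mono_on {1..k} f" for f :: "nat \<Rightarrow> nat"
  proof -
    have "{y \<in> f ` {1..k}. y \<le> f x} = f ` {1..x}"
      using assms(4) strict_mono_on_leD[OF f] strict_mono_onD[OF f]
      by (auto simp: image_iff) (metis atLeastAtMost_iff leD leI)+
    moreover have "inj_on f {1..x}"
      using strict_mono_on_imp_inj_on[OF f] by (rule inj_on_subset) (use assms(4) in auto)
    ultimately show ?thesis by (simp add: card_image)
  qed
  have nless: "\<not> f x < g x" if "strict_mono_on {1..k} f" "strict_mono_on {1..k} g" "f ` {1..k} = g ` {1..k}" for f g :: "nat \<Rightarrow> nat"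
  proof
    assume l: "f x < g x"
    have "g x \<in> {y \<in> g ` {1..k}. y \<le> g x}" "g x \<notin> {y \<in> g ` {1..k}. y \<le> f x}" using l assms(4) by auto
    moreover have "{y \<in> g ` {1..k}. y \<le> f x} \<subseteq> {y \<in> g ` {1..k}. y \<le> g x}" using l by auto
    ultimately have "card {y \<in> g ` {1..k}. y \<le> f x} < card {y \<in> g ` {1..k}. y \<le> g x}"
      by (intro psubset_card_mono) auto
    then show False using c[OF that(1)] c[OF that(2)] that(3) by simp
  qed
  show ?thesis using nless[OF assms(1-3)] nless[OF assms(2,1) assms(3)[symmetric]] by simp
qed

section \<open>Occurrences, their blocks of consecutive positions, and counting bounds\<close>

locale vincular_pattern =
  fixes k q :: nat and v :: "nat \<Rightarrow> nat" and A :: "nat set"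
  assumes v: "v permutes {1..k}" and A: "A \<subset> {1..k-1}" and cA: "card A = q"
begin

abbreviation "m \<equiv> k - q"

lemma finA: "finite A"
  using A finite_subset by auto

lemma k2: "2 \<le> k"
proof (rule ccontr)
  assume "\<not> 2 \<le> k"
  then have "{1..k-1} = {}" by auto
  then show False using A by auto
qed

text \<open>The pattern has at least two blocks of consecutive positions. The positivity of the
  variance rests on this, and it keeps \<open>m - 1\<close> and \<open>m - 2\<close> from being
  truncated.\<close>

lemma qk: "q + 2 \<le> k"
proof -
  have "q < card {1..k-1}" using psubset_card_mono[OF _ A] cA by auto
  then show ?thesis by simp
qed

lemma AK: "A \<subseteq> {1..k}" "Suc ` A \<subseteq> {1..k}"
proof -
  have "1 \<le> a \<and> a < k" if "a \<in> A" for a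
  proof -
    have "a \<in> {1..k-1}" using A that by blast
    then show ?thesis using k2 by auto
  qed
  then show "A \<subseteq> {1..k}" "Suc ` A \<subseteq> {1..k}" by force+
qed

definition occ :: "nat \<Rightarrow> (nat \<Rightarrow> nat) set" where
  "occ n = incr_maps {1..k} A n"

lemma finite_occ: "finite (occ n)"
  unfolding occ_def by (rule finite_incr_maps) simp

lemma card_occ: "card (occ n) = (n - q) choose m"
  unfolding occ_def using AK cA by (subst card_incr_maps) auto

lemma occ_mem: "i \<in> occ n \<Longrightarrow> j \<in> {1..k} \<Longrightarrow> i j \<in> {1..n}"
  by (auto simp: occ_def incr_maps_def PiE_iff)

lemma occ_mono: "i \<in> occ n \<Longrightarrow> strict_mono_on {1..k} i"
  by (simp add: occ_def incr_maps_def)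

lemma occ_inj: "i \<in> occ n \<Longrightarrow> inj_on i {1..k}"
  using occ_mono strict_mono_on_imp_inj_on by blast

lemma occ_adj: "i \<in> occ n \<Longrightarrow> a \<in> A \<Longrightarrow> i (Suc a) = Suc (i a)"
  by (simp add: occ_def incr_maps_def)

definition supp :: "(nat \<Rightarrow> nat) \<Rightarrow> nat set" where
  "supp i = i ` {1..k}"

lemma card_supp: "i \<in> occ n \<Longrightarrow> card (supp i) = k"
  unfolding supp_def using card_image[OF occ_inj] by simp

lemma finite_supp: "finite (supp i)"
  by (simp add: supp_def)

lemma supp_subset: "i \<in> occ n \<Longrightarrow> supp i \<subseteq> {1..n}"
  using occ_mem by (auto simp: supp_def)

text \<open>Evaluated on arbitrary words, not only on permutations. Since the condition is an
  equivalence and v is injective, a word with a repeated letter on the support of i never shows the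
  pattern there.\<close>

definition is_pat :: "(nat \<Rightarrow> nat) \<Rightarrow> (nat \<Rightarrow> nat) \<Rightarrow> bool" where
  "is_pat i w \<longleftrightarrow> (\<forall>a\<in>{1..k}. \<forall>b\<in>{1..k}. w (i a) < w (i b) \<longleftrightarrow> v a < v b)"

definition cnt :: "nat \<Rightarrow> (nat \<Rightarrow> nat) \<Rightarrow> real" where
  "cnt n w = (\<Sum>i\<in>occ n. of_bool (is_pat i w))"

lemma vincular_count_eq: "real (vincular_count k v A n w) = cnt n w"
proof -
  have "bij_betw (\<lambda>i. i ` {1..k}) {i\<in>occ n. is_pat i w} {i ` {1..k} | i.
     strict_mono_on {1..k} i \<and> i ` {1..k} \<subseteq> {1..n} \<and>
     (\<forall>a\<in>A. i (a + 1) = i a + 1) \<and>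
     (\<forall>a\<in>{1..k}. \<forall>b\<in>{1..k}. w (i a) < w (i b) \<longleftrightarrow> v a < v b)}" (is "bij_betw _ _ ?R")
    unfolding bij_betw_def
  proof (intro conjI equalityI subsetI inj_onI)
    fix i j assume "i \<in> {i\<in>occ n. is_pat i w}" "j \<in> {i\<in>occ n. is_pat i w}" "i ` {1..k} = j ` {1..k}"
    then have i: "i \<in> occ n" and j: "j \<in> occ n" and eq: "i ` {1..k} = j ` {1..k}" by auto
    show "i = j"
      by (rule PiE_ext[of i "{1..k}" "\<lambda>_. {1..n}", OF _ _ strict_mono_on_image_inj[OF occ_mono[OF i] occ_mono[OF j] eq]])
        (use i j in \<open>simp_all add: occ_def incr_maps_def\<close>)
  next
    fix X assume "X \<in> (\<lambda>i. i ` {1..k}) ` {i\<in>occ n. is_pat i w}"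
    then obtain i where "i \<in> occ n" "is_pat i w" "X = i ` {1..k}" by auto
    then show "X \<in> ?R"
      using occ_mono occ_adj occ_mem by (auto simp: is_pat_def intro!: exI[of _ i])
  next
    fix X assume "X \<in> ?R"
    then obtain i where i: "X = i ` {1..k}" "strict_mono_on {1..k} i" "i ` {1..k} \<subseteq> {1..n}"
      "\<forall>a\<in>A. i (a + 1) = i a + 1" "\<forall>a\<in>{1..k}. \<forall>b\<in>{1..k}. w (i a) < w (i b) \<longleftrightarrow> v a < v b" by auto
    define j where "j = restrict i {1..k}"
    have "Suc a \<in> {1..k}" "a \<in> {1..k}" if "a \<in> A" for a using AK that by auto
    then have "j \<in> occ n" using i by (auto simp: occ_def incr_maps_def j_def strict_mono_on_def)
    moreover have "is_pat j w" using i(5) by (simp add: is_pat_def j_def)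
    moreover have "X = j ` {1..k}" using i(1) by (simp add: j_def)
    ultimately show "X \<in> (\<lambda>i. i ` {1..k}) ` {i\<in>occ n. is_pat i w}" by auto
  qed
  from bij_betw_same_card[OF this] show ?thesis
    unfolding vincular_count_def cnt_def using finite_occ by (simp add: sum_of_bool_eq Int_def)
qed

text \<open>The first positions of the blocks that A glues together; these m coordinates are the
  degrees of freedom of an occurrence.\<close>

definition starts :: "nat set" where
  "starts = {1..k} - Suc ` A"

lemma finite_starts: "finite starts" by (simp add: starts_def)

lemma card_starts: "card starts = m"
  unfolding starts_def using AK(2) finA cA by (subst card_Diff_subset) (auto simp: card_image)

lemma one_starts: "1 \<in> starts"
  using k2 A by (auto simp: starts_def)

text \<open>Walking down from j through A reaches the first position s of its block, and an
  occurrence grows by one at each step. The same s serves all occurrences and all n.\<close>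

lemma start_exists:
  assumes "j \<in> {1..k}"
  shows "\<exists>s\<in>starts. s \<le> j \<and> (\<forall>n. \<forall>i\<in>occ n. i j = i s + (j - s))"
  using assms
proof (induction j)
  case (Suc a)
  show ?case
  proof (cases "a \<in> A")
    case True
    then have "a \<in> {1..k}" using AK by auto
    then obtain s where s: "s \<in> starts" "s \<le> a" "\<forall>n. \<forall>i\<in>occ n. i a = i s + (a - s)" using Suc.IH by auto
    have "i (Suc a) = i s + (Suc a - s)" if "i \<in> occ n" for i n
      using s(2,3) occ_adj[OF that True] that by (auto simp: Suc_diff_le)
    then show ?thesis using s by (intro bexI[of _ s]) auto
  next
    case False
    then have "Suc a \<in> starts" using Suc.prems by (auto simp: starts_def)
    then show ?thesis by (intro bexI[of _ "Suc a"]) auto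
  qed
qed simp

text \<open>An occurrence is determined by its values at the block starts, which embeds the set into
  a product. The bounds n^m, n^(m-1) and P^2 n^(m-2) below all come from here.\<close>

lemma card_occ_starts_le:
  assumes W: "\<And>s. s \<in> starts \<Longrightarrow> finite (W s)"
  shows "card {i\<in>occ n. \<forall>s\<in>starts. i s \<in> W s} \<le> (\<Prod>s\<in>starts. card (W s))"
proof -
  have "inj_on (\<lambda>i. restrict i starts) (occ n)"
  proof (rule inj_onI)
    fix i j assume i: "i \<in> occ n" and j: "j \<in> occ n" and eq: "restrict i starts = restrict j starts"
    have "i x = j x" if x: "x \<in> {1..k}" for x
    proof -
      obtain s where s: "s \<in> starts" "\<forall>n. \<forall>i\<in>occ n. i x = i s + (x - s)" using start_exists[OF x] by auto
      have "i s = j s" using eq s(1) by (metis restrict_apply')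
      then show ?thesis using s(2) i j by metis
    qed
    then show "i = j"
      by (rule PiE_ext[of i "{1..k}" "\<lambda>_. {1..n}", rotated 2])
        (use i j in \<open>simp_all add: occ_def incr_maps_def\<close>)
  qed
  then have inj: "inj_on (\<lambda>i. restrict i starts) {i\<in>occ n. \<forall>s\<in>starts. i s \<in> W s}"
    by (rule inj_on_subset) auto
  have "card {i\<in>occ n. \<forall>s\<in>starts. i s \<in> W s} \<le> card (PiE starts W)"
    using W finite_starts by (intro card_inj_on_le[OF inj]) (auto intro!: finite_PiE)
  then show ?thesis using finite_starts by (simp add: card_PiE)
qed

text \<open>Prescribing the value at one position fixes the start of its block and leaves m - 1
  starts free.\<close>

lemma card_occ_at_le:
  assumes "j \<in> {1..k}"
  shows "card {i\<in>occ n. i j = x} \<le> n ^ (m - 1)"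
proof -
  obtain s where s: "s \<in> starts" "\<forall>n. \<forall>i\<in>occ n. i j = i s + (j - s)" using start_exists[OF assms] by auto
  define W where "W = (\<lambda>t. if t = s then {x - (j - s)} else {1..n})"
  have "card {i\<in>occ n. i j = x} \<le> card {i\<in>occ n. \<forall>t\<in>starts. i t \<in> W t}"
  proof (rule card_mono)
    show "{i\<in>occ n. i j = x} \<subseteq> {i\<in>occ n. \<forall>t\<in>starts. i t \<in> W t}"
      using s occ_mem by (fastforce simp: W_def starts_def)
  qed (simp add: finite_occ)
  also have "\<dots> \<le> (\<Prod>t\<in>starts. card (W t))" by (rule card_occ_starts_le) (simp add: W_def)
  also have "\<dots> = card (W s) * (\<Prod>t\<in>starts - {s}. card (W t))" using s finite_starts by (simp add: prod.remove)
  also have "(\<Prod>t\<in>starts - {s}. card (W t)) = (\<Prod>t\<in>starts - {s}. n)" by (intro prod.cong) (auto simp: W_def)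
  also have "card (W s) * \<dots> = n ^ (m - 1)" using s finite_starts card_starts by (simp add: W_def)
  finally show ?thesis .
qed

lemma card_occ_containing_le: "card {i\<in>occ n. x \<in> supp i} \<le> k * n ^ (m - 1)"
proof -
  have "{i\<in>occ n. x \<in> supp i} = (\<Union>j\<in>{1..k}. {i\<in>occ n. i j = x})" by (auto simp: supp_def)
  also have "card \<dots> \<le> (\<Sum>j\<in>{1..k}. card {i\<in>occ n. i j = x})" by (rule card_UN_le) simp
  also have "\<dots> \<le> (\<Sum>j\<in>{1..k}. n ^ (m - 1))" by (intro sum_mono card_occ_at_le)
  finally show ?thesis by simp
qed

lemma card_occ_le: "card (occ n) \<le> n ^ m"
proof -
  have "card (occ n) \<le> card {i\<in>occ n. \<forall>s\<in>starts. i s \<in> {1..n}}"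
    using occ_mem by (intro card_mono) (auto simp: finite_occ starts_def)
  also have "\<dots> \<le> (\<Prod>s\<in>starts. card {1..n})" by (rule card_occ_starts_le) simp
  finally show ?thesis by (simp add: card_starts)
qed

text \<open>b is the start of the second block, which exists because m \<ge> 2. The positions before
  b move rigidly together; the lower bound on the variance tests this block alone.\<close>

lemma first_block_exists:
  "\<exists>b\<in>starts. 2 \<le> b \<and> (\<forall>n. \<forall>i\<in>occ n. \<forall>j\<in>{1..<b}. i j = i 1 + (j - 1))"
proof -
  have ne: "starts - {1} \<noteq> {}"
  proof
    assume "starts - {1} = {}"
    then have "card starts \<le> card {1::nat}" by (intro card_mono) auto
    then show False using card_starts qk by simp
  qed
  define b where "b = Min (starts - {1})"
  have b: "b \<in> starts" "b \<noteq> 1" using Min_in[OF _ ne] finite_starts by (auto simp: b_def)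
  have "i j = i 1 + (j - 1)" if "i \<in> occ n" "j \<in> {1..<b}" for i n j
  proof -
    have "j \<in> {1..k}" using that b by (auto simp: starts_def)
    then obtain s where s: "s \<in> starts" "s \<le> j" "\<forall>n. \<forall>i\<in>occ n. i j = i s + (j - s)" using start_exists by blast
    have "s = 1"
    proof (rule ccontr)
      assume "s \<noteq> 1"
      then have "b \<le> s" using s(1) finite_starts by (auto simp: b_def)
      then show False using s(2) that by auto
    qed
    then show ?thesis using s that by auto
  qed
  moreover have "2 \<le> b" using b by (auto simp: starts_def)
  ultimately show ?thesis using b(1) by blast
qed

lemma card_occ_two_le:
  assumes b: "b \<in> starts" "2 \<le> b"
  shows "card {i\<in>occ n. i 1 \<le> P \<and> i b \<le> P} \<le> P\<^sup>2 * n ^ (m - 2)"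
proof -
  define W where "W = (\<lambda>t. if t = 1 \<or> t = b then {1..P} else {1..n})"
  have "card {i\<in>occ n. i 1 \<le> P \<and> i b \<le> P} \<le> card {i\<in>occ n. \<forall>t\<in>starts. i t \<in> W t}"
  proof (rule card_mono)
    show "{i\<in>occ n. i 1 \<le> P \<and> i b \<le> P} \<subseteq> {i\<in>occ n. \<forall>t\<in>starts. i t \<in> W t}"
      using occ_mem by (fastforce simp: W_def starts_def)
  qed (simp add: finite_occ)
  also have "\<dots> \<le> (\<Prod>t\<in>starts. card (W t))" by (rule card_occ_starts_le) (simp add: W_def)
  also have "\<dots> = card (W 1) * card (W b) * (\<Prod>t\<in>starts - {1} - {b}. card (W t))"
    using b one_starts finite_starts by (simp add: prod.remove[of _ 1] prod.remove[of _ b])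
  also have "(\<Prod>t\<in>starts - {1} - {b}. card (W t)) = (\<Prod>t\<in>starts - {1} - {b}. n)" by (intro prod.cong) (auto simp: W_def)
  also have "\<dots> = n ^ (m - 2)" using b one_starts finite_starts card_starts
    by (simp add: card_Diff_singleton numeral_2_eq_2)
  finally show ?thesis by (simp add: W_def power2_eq_square)
qed

end

section \<open>Independent coordinates and random permutations\<close>

lemma avg_resample:
  fixes S :: "'b set" and n :: nat and f :: "(nat \<Rightarrow> 'b) \<Rightarrow> 'c::real_normed_field"
  assumes S: "finite S" "S \<noteq> {}" and a: "a \<in> {1..n}"
  shows "avg (PiE {1..n} (\<lambda>_. S)) f = avg (PiE {1..n} (\<lambda>_. S)) (\<lambda>V. avg S (\<lambda>y. f (V(a := y))))"
proof -
  define \<Omega> where "\<Omega> = PiE {1..n} (\<lambda>_. S)"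
  have bij: "bij_betw (\<lambda>z. ((fst z)(a := snd z), fst z a)) (\<Omega> \<times> S) (\<Omega> \<times> S)"
    by (rule bij_betwI[where g = "\<lambda>z. ((fst z)(a := snd z), fst z a)"])
      (use a in \<open>auto simp: \<Omega>_def PiE_iff extensional_def\<close>)
  have "avg \<Omega> f = avg (\<Omega> \<times> S) (\<lambda>z. f (fst z))" using S by (simp add: avg_fst)
  also have "\<dots> = avg (\<Omega> \<times> S) (\<lambda>z. f ((fst z)(a := snd z)))"
    using avg_bij[OF bij, of "\<lambda>z. f (fst z)"] by simp
  finally show ?thesis unfolding \<Omega>_def by (simp add: avg_Times)
qed

lemma avg_indep:
  fixes S :: "'b set" and n :: nat and f g :: "(nat \<Rightarrow> 'b) \<Rightarrow> real"
  assumes S: "finite S" "S \<noteq> {}"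
    and f: "\<And>V W. (\<And>i. i \<in> J \<Longrightarrow> V i = W i) \<Longrightarrow> f V = f W"
    and g: "\<And>V W. (\<And>i. i \<notin> J \<Longrightarrow> V i = W i) \<Longrightarrow> g V = g W"
  defines "\<Omega> \<equiv> PiE {1..n} (\<lambda>_. S)"
  shows "avg \<Omega> (\<lambda>V. f V * g V) = avg \<Omega> f * avg \<Omega> g"
proof -
  have fin: "finite \<Omega>" "\<Omega> \<noteq> {}" unfolding \<Omega>_def using S by (auto intro!: finite_PiE simp: PiE_eq_empty_iff)
  \<comment> \<open>\<psi> exchanges the coordinates outside J between two independent words;
    afterwards f and g read different words.\<close>
  define \<psi> where "\<psi> = (\<lambda>z. (\<lambda>i. if i \<in> J then fst z i else snd z i, \<lambda>i. if i \<in> J then snd z i else (fst z i :: 'b)))"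
  have bij: "bij_betw \<psi> (\<Omega> \<times> \<Omega>) (\<Omega> \<times> \<Omega>)"
  proof (rule bij_betwI[where g = \<psi>])
    have "(\<lambda>i. if i \<in> J then V i else W i) \<in> \<Omega>" if "V \<in> \<Omega>" "W \<in> \<Omega>" for V W
      using that by (simp add: \<Omega>_def PiE_iff extensional_def)
    then show "\<psi> \<in> \<Omega> \<times> \<Omega> \<rightarrow> \<Omega> \<times> \<Omega>" "\<psi> \<in> \<Omega> \<times> \<Omega> \<rightarrow> \<Omega> \<times> \<Omega>" by (simp_all add: \<psi>_def Pi_iff)
    have "\<psi> (\<psi> z) = z" for z by (cases z) (simp add: \<psi>_def fun_eq_iff)
    then show "\<psi> (\<psi> z) = z" "\<psi> (\<psi> z) = z" for z by blast+
  qed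
  have "avg \<Omega> (\<lambda>V. f V * g V) = avg (\<Omega> \<times> \<Omega>) (\<lambda>z. f (fst z) * g (fst z))"
    using avg_fst[OF fin, of \<Omega> "\<lambda>V. f V * g V"] by simp
  also have "\<dots> = avg (\<Omega> \<times> \<Omega>) (\<lambda>z. f (fst (\<psi> z)) * g (fst (\<psi> z)))"
    using avg_bij[OF bij, of "\<lambda>z. f (fst z) * g (fst z)"] by simp
  also have "\<dots> = avg (\<Omega> \<times> \<Omega>) (\<lambda>z. f (fst z) * g (snd z))"
  proof (intro avg_cong)
    fix z
    have "f (fst (\<psi> z)) = f (fst z)" by (rule f) (auto simp: \<psi>_def)
    moreover have "g (fst (\<psi> z)) = g (snd z)" by (rule g) (auto simp: \<psi>_def)
    ultimately show "f (fst (\<psi> z)) * g (fst (\<psi> z)) = f (fst z) * g (snd z)" by simp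
  qed
  also have "\<dots> = avg \<Omega> f * avg \<Omega> g" by (simp add: avg_Times avg_cmult avg_cmult2)
  finally show ?thesis .
qed

lemma avg_collision_le:
  fixes S :: "'b set" and n :: nat
  assumes S: "finite S" "S \<noteq> {}" and ab: "a \<in> {1..n}" "a \<noteq> b"
  shows "avg (PiE {1..n} (\<lambda>_. S)) (\<lambda>V. of_bool (V a = V b) :: real) \<le> 1 / card S"
proof (subst avg_resample[OF S ab(1)], rule avg_le_const)
  fix V :: "nat \<Rightarrow> 'b"
  have "avg S (\<lambda>y. of_bool ((V(a := y)) a = (V(a := y)) b) :: real) = avg S (\<lambda>y. of_bool (y = V b))"
    using ab by (intro avg_cong) auto
  also have "\<dots> \<le> 1 / card S"
    unfolding avg_def using S by (intro divide_right_mono) (simp_all add: sum_of_bool_eq card_le_Suc0_iff_eq)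
  finally show "avg S (\<lambda>y. of_bool ((V(a := y)) a = (V(a := y)) b) :: real) \<le> 1 / card S" .
qed simp

lemma avg_not_inj_le:
  fixes S :: "'b set" and n :: nat
  assumes S: "finite S" "S \<noteq> {}" and J: "J \<subseteq> {1..n}"
  shows "avg (PiE {1..n} (\<lambda>_. S)) (\<lambda>V. of_bool (\<not> inj_on V J) :: real) \<le> (card J)\<^sup>2 / card S"
proof -
  have fJ: "finite J" using J finite_subset by auto
  have "avg (PiE {1..n} (\<lambda>_. S)) (\<lambda>V. of_bool (\<not> inj_on V J) :: real) \<le>
    avg (PiE {1..n} (\<lambda>_. S)) (\<lambda>V. \<Sum>a\<in>J. \<Sum>b\<in>J. of_bool (a \<noteq> b \<and> V a = V b))"
  proof (rule avg_mono)
    fix V :: "nat \<Rightarrow> 'b"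
    show "of_bool (\<not> inj_on V J) \<le> (\<Sum>a\<in>J. \<Sum>b\<in>J. of_bool (a \<noteq> b \<and> V a = V b) :: real)"
    proof (cases "inj_on V J")
      case False
      then obtain a b where ab: "a \<in> J" "b \<in> J" "a \<noteq> b" "V a = V b" by (auto simp: inj_on_def)
      have "1 \<le> (\<Sum>b\<in>J. of_bool (a \<noteq> b \<and> V a = V b) :: real)"
        using ab fJ by (intro order_trans[OF _ member_le_sum[of b]]) auto
      also have "\<dots> \<le> (\<Sum>a\<in>J. \<Sum>b\<in>J. of_bool (a \<noteq> b \<and> V a = V b))"
        using ab fJ by (intro member_le_sum) (auto intro: sum_nonneg)
      finally show ?thesis using False by simp
    qed (simp add: sum_nonneg)
  qed
  also have "\<dots> = (\<Sum>a\<in>J. \<Sum>b\<in>J. avg (PiE {1..n} (\<lambda>_. S)) (\<lambda>V. of_bool (a \<noteq> b \<and> V a = V b)))"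
    by (simp only: avg_sum)
  also have "\<dots> \<le> (\<Sum>a\<in>J. \<Sum>b\<in>J. 1 / card S)"
  proof (intro sum_mono)
    fix a b assume "a \<in> J" "b \<in> J"
    then show "avg (PiE {1..n} (\<lambda>_. S)) (\<lambda>V. of_bool (a \<noteq> b \<and> V a = V b) :: real) \<le> 1 / card S"
      using avg_collision_le[OF S, of a n b] J by (cases "a = b") (auto simp: avg_def[of _ "\<lambda>_. 0"])
  qed
  also have "\<dots> = (card J)\<^sup>2 / card S" by (simp add: power2_eq_square)
  finally show ?thesis .
qed

section \<open>Relative order, and the passage from words to permutations\<close>

definition rank :: "'a set \<Rightarrow> ('a \<Rightarrow> nat) \<Rightarrow> 'a \<Rightarrow> nat" where
  "rank J V x = card {y \<in> J. V y \<le> V x}"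

lemma rank_less_iff:
  assumes "finite J" "x \<in> J" "y \<in> J"
  shows "rank J V x < rank J V y \<longleftrightarrow> V x < V y"
proof
  assume "V x < V y"
  then have "{z \<in> J. V z \<le> V x} \<subseteq> {z \<in> J. V z \<le> V y}" "y \<notin> {z \<in> J. V z \<le> V x}" "y \<in> {z \<in> J. V z \<le> V y}"
    using assms by auto
  then have "{z \<in> J. V z \<le> V x} \<subset> {z \<in> J. V z \<le> V y}" by blast
  then show "rank J V x < rank J V y" unfolding rank_def using assms by (intro psubset_card_mono) auto
next
  assume r: "rank J V x < rank J V y"
  show "V x < V y"
  proof (rule ccontr)
    assume "\<not> V x < V y"
    then have "rank J V y \<le> rank J V x" unfolding rank_def using assms by (intro card_mono) auto
    then show False using r by simp
  qed
qed

lemma rank_bij: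
  assumes J: "finite J" "inj_on V J"
  shows "bij_betw (rank J V) J {1..card J}"
proof -
  have inj: "inj_on (rank J V) J"
  proof (rule inj_onI)
    fix x y assume xy: "x \<in> J" "y \<in> J" "rank J V x = rank J V y"
    then have "V x = V y" using rank_less_iff[OF J(1) xy(1,2), of V] rank_less_iff[OF J(1) xy(2,1), of V] by simp
    then show "x = y" using J(2) xy by (simp add: inj_on_def)
  qed
  have "rank J V ` J \<subseteq> {1..card J}"
  proof
    fix r assume "r \<in> rank J V ` J"
    then obtain x where x: "x \<in> J" "r = rank J V x" by auto
    have "{y \<in> J. V y \<le> V x} \<noteq> {}" using x by auto
    then have "1 \<le> r" unfolding x(2) rank_def using J(1) by (simp add: Suc_le_eq card_gt_0_iff)
    moreover have "r \<le> card J" unfolding x(2) rank_def using J(1) by (intro card_mono) auto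
    ultimately show "r \<in> {1..card J}" by simp
  qed
  then have "rank J V ` J = {1..card J}" using J inj by (intro card_subset_eq) (auto simp: card_image)
  then show ?thesis using inj by (simp add: bij_betw_def)
qed

text \<open>V and W range over all functions, so one and the same G can be averaged over words and
  over \<open>perms {1..n}\<close>.\<close>

definition order_fun :: "nat \<Rightarrow> ((nat \<Rightarrow> nat) \<Rightarrow> 'b) \<Rightarrow> bool" where
  "order_fun n G \<longleftrightarrow> (\<forall>V W. (\<forall>a\<in>{1..n}. \<forall>b\<in>{1..n}. V a < V b \<longleftrightarrow> W a < W b) \<longrightarrow> G V = G W)"

lemma PiE_compose_perm_bij:
  fixes S :: "'b set" and n :: nat
  assumes \<pi>: "\<pi> permutes {1..n}"
  shows "bij_betw (\<lambda>V. V \<circ> \<pi>) (PiE {1..n} (\<lambda>_. S)) (PiE {1..n} (\<lambda>_. S))"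
proof (rule bij_betwI[where g = "\<lambda>V. V \<circ> inv \<pi>"])
  have *: "V \<circ> \<tau> \<in> PiE {1..n} (\<lambda>_. S)" if "V \<in> PiE {1..n} (\<lambda>_. S)" "\<tau> permutes {1..n}" for V and \<tau> :: "nat \<Rightarrow> nat"
    using that permutes_in_image[OF that(2)] permutes_not_in[OF that(2)]
    by (auto simp: PiE_iff extensional_def simp del: atLeastAtMost_iff)
  show "(\<lambda>V. V \<circ> \<pi>) \<in> (PiE {1..n} (\<lambda>_. S)) \<rightarrow> (PiE {1..n} (\<lambda>_. S))"
    "(\<lambda>V. V \<circ> inv \<pi>) \<in> (PiE {1..n} (\<lambda>_. S)) \<rightarrow> (PiE {1..n} (\<lambda>_. S))"
    using *[OF _ \<pi>] *[OF _ permutes_inv[OF \<pi>]] by auto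
qed (use permutes_inv_o[OF \<pi>] in \<open>auto simp: o_assoc[symmetric]\<close>)

text \<open>Averaging over rearrangements turns an injective word into a uniform permutation; words with a repeated
  letter are rare.\<close>

lemma avg_order_fun_transfer:
  fixes G :: "(nat \<Rightarrow> nat) \<Rightarrow> 'b::real_normed_field" and n M :: nat
  assumes G: "order_fun n G" and C: "\<And>V. norm (G V) \<le> C" and M: "1 \<le> M"
  shows "norm (avg (PiE {1..n} (\<lambda>_. {1..M})) G - avg (perms {1..n}) G) \<le> 2 * C * (real n)\<^sup>2 / M"
proof -
  define \<Omega> where "\<Omega> = PiE {1..n} (\<lambda>_. {1..M})"
  let ?P = "perms {1..n}"
  have fin: "finite \<Omega>" "\<Omega> \<noteq> {}" unfolding \<Omega>_def using M by (auto intro!: finite_PiE simp: PiE_eq_empty_iff)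
  have finP: "finite ?P" "?P \<noteq> {}" using finite_permutations perms_nonempty by auto
  have C0: "0 \<le> C" using C[of undefined] norm_ge_zero order_trans by blast
  have "avg \<Omega> G = avg ?P (\<lambda>\<pi>. avg \<Omega> (\<lambda>V. G (V \<circ> \<pi>)))"
  proof -
    have "avg ?P (\<lambda>\<pi>. avg \<Omega> (\<lambda>V. G (V \<circ> \<pi>))) = avg ?P (\<lambda>\<pi>. avg \<Omega> G)"
    proof (rule avg_cong)
      fix \<pi> :: "nat \<Rightarrow> nat" assume "\<pi> \<in> ?P"
      then have "\<pi> permutes {1..n}" by simp
      from avg_bij[OF PiE_compose_perm_bij[OF this], where f = G and S1 = "{1..M}"]
      show "avg \<Omega> (\<lambda>V. G (V \<circ> \<pi>)) = avg \<Omega> G" unfolding \<Omega>_def .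
    qed
    then show ?thesis using finP by (simp only: avg_const not_False_eq_True)
  qed
  also have "\<dots> = avg \<Omega> (\<lambda>V. avg ?P (\<lambda>\<pi>. G (V \<circ> \<pi>)))" by (rule avg_swap)
  finally have 1: "avg \<Omega> G - avg ?P G = avg \<Omega> (\<lambda>V. avg ?P (\<lambda>\<pi>. G (V \<circ> \<pi>)) - avg ?P G)"
    using fin by (simp add: avg_diff avg_const)
  have "norm (avg \<Omega> G - avg ?P G) \<le> avg \<Omega> (\<lambda>V. 2 * C * of_bool (\<not> inj_on V {1..n}))"
    unfolding 1
  proof (rule order_trans[OF norm_avg_le], rule avg_mono)
    fix V assume "V \<in> \<Omega>"
    show "norm (avg ?P (\<lambda>\<pi>. G (V \<circ> \<pi>)) - avg ?P G) \<le> 2 * C * of_bool (\<not> inj_on V {1..n})"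
    proof (cases "inj_on V {1..n}")
      case True
      \<comment> \<open>The standardization of V, a permutation with the same relative order as the
        injective word V.\<close>
      define \<rho> where "\<rho> = (\<lambda>x. if x \<in> {1..n} then rank {1..n} V x else x)"
      have "bij_betw \<rho> {1..n} {1..n}"
        using rank_bij[OF _ True] by (subst bij_betw_cong[of _ _ "rank {1..n} V"]) (auto simp: \<rho>_def)
      then have \<rho>: "\<rho> permutes {1..n}" by (rule bij_imp_permutes) (auto simp: \<rho>_def)
      have "avg ?P (\<lambda>\<pi>. G (V \<circ> \<pi>)) = avg ?P (\<lambda>\<pi>. G (\<rho> \<circ> \<pi>))"
      proof (rule avg_cong)
        fix \<pi> :: "nat \<Rightarrow> nat" assume "\<pi> \<in> ?P"
        then have \<pi>: "\<pi> permutes {1..n}" by simp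
        have "\<pi> a \<in> {1..n}" if "a \<in> {1..n}" for a using permutes_in_image[OF \<pi>] that by blast
        then have "(V \<circ> \<pi>) a < (V \<circ> \<pi>) b \<longleftrightarrow> (\<rho> \<circ> \<pi>) a < (\<rho> \<circ> \<pi>) b" if "a \<in> {1..n}" "b \<in> {1..n}" for a b
          using rank_less_iff[of "{1..n}" "\<pi> a" "\<pi> b" V] that by (simp add: \<rho>_def del: atLeastAtMost_iff)
        then show "G (V \<circ> \<pi>) = G (\<rho> \<circ> \<pi>)" using G unfolding order_fun_def by blast
      qed
      also have "\<dots> = avg ?P G" by (rule avg_bij[OF perms_left_bij[OF \<rho>]])
      finally show ?thesis using True by simp
    next
      case False
      have n1: "norm (avg ?P H) \<le> C" if "\<And>\<pi>. norm (H \<pi>) \<le> C" for H :: "(nat \<Rightarrow> nat) \<Rightarrow> 'b"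
        by (rule order_trans[OF norm_avg_le avg_le_const[OF that C0]])
      have "norm (avg ?P (\<lambda>\<pi>. G (V \<circ> \<pi>)) - avg ?P G) \<le> norm (avg ?P (\<lambda>\<pi>. G (V \<circ> \<pi>))) + norm (avg ?P G)"
        by (rule norm_triangle_ineq4)
      also have "\<dots> \<le> C + C" by (intro add_mono n1 C)
      finally show ?thesis using False by simp
    qed
  qed
  also have "\<dots> = 2 * C * avg \<Omega> (\<lambda>V. of_bool (\<not> inj_on V {1..n}))" by (rule avg_cmult)
  also have "\<dots> \<le> 2 * C * ((real n)\<^sup>2 / M)"
    using avg_not_inj_le[of "{1..M}" "{1..n}" n] M C0 unfolding \<Omega>_def by (intro mult_left_mono) auto
  finally show ?thesis unfolding \<Omega>_def by simp
qed

section \<open>The pattern count as a smooth function of independent letters\<close>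

context vincular_pattern
begin

lemma is_pat_cong: "(\<And>x. x \<in> supp i \<Longrightarrow> V x = W x) \<Longrightarrow> is_pat i V = is_pat i W"
  by (auto simp: is_pat_def supp_def)

text \<open>Double counting: each occurrence through x contains at most k of the points p. The row
  sums of the mixed differences are therefore of the order of a single first difference, although
  individual entries may be as large.\<close>

lemma sum_supp_occ_le: "(\<Sum>p\<in>I. card {i\<in>occ n. x \<in> supp i \<and> p \<in> supp i}) \<le> k * (k * n ^ (m - 1))" if "finite I"
proof -
  have "(\<Sum>p\<in>I. card {i\<in>occ n. x \<in> supp i \<and> p \<in> supp i}) = (\<Sum>p\<in>I. \<Sum>i\<in>{i\<in>occ n. x \<in> supp i}. of_bool (p \<in> supp i))"
    using finite_occ by (simp add: sum_of_bool_eq Int_def conj_assoc)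
  also have "\<dots> = (\<Sum>i\<in>{i\<in>occ n. x \<in> supp i}. card (I \<inter> supp i))"
    using \<open>finite I\<close> by (subst sum.swap) (simp add: sum_of_bool_eq Int_def)
  also have "\<dots> \<le> (\<Sum>i\<in>{i\<in>occ n. x \<in> supp i}. k)"
  proof (rule sum_mono)
    fix i assume "i \<in> {i\<in>occ n. x \<in> supp i}"
    then have "card (supp i) = k" using card_supp by auto
    then show "card (I \<inter> supp i) \<le> k" using card_mono[OF finite_supp, of "I \<inter> supp i" i] by auto
  qed
  also have "\<dots> = k * card {i\<in>occ n. x \<in> supp i}" by simp
  also have "\<dots> \<le> k * (k * n ^ (m - 1))" by (intro mult_left_mono card_occ_containing_le) simp
  finally show ?thesis .
qed

lemma cnt_bdd_diff: "bdd_diff n S (real (k * n ^ (m - 1))) (cnt n)"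
  unfolding bdd_diff_def
proof (intro ballI)
  fix V p y
  have "\<bar>cnt n V - cnt n (V(p := y))\<bar> = \<bar>\<Sum>i\<in>occ n. of_bool (is_pat i V) - of_bool (is_pat i (V(p := y)))\<bar>"
    by (simp add: cnt_def sum_subtractf)
  also have "\<dots> \<le> (\<Sum>i\<in>occ n. of_bool (p \<in> supp i))"
  proof (rule order_trans[OF sum_abs sum_mono])
    fix i
    show "\<bar>of_bool (is_pat i V) - of_bool (is_pat i (V(p := y)))\<bar> \<le> (of_bool (p \<in> supp i) :: real)"
    proof (cases "p \<in> supp i")
      case False
      then have "is_pat i V = is_pat i (V(p := y))" by (intro is_pat_cong) auto
      then show ?thesis by simp
    qed auto
  qed
  also have "\<dots> = card {i\<in>occ n. p \<in> supp i}" using finite_occ by (simp add: sum_of_bool_eq Int_def)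
  also have "\<dots> \<le> real (k * n ^ (m - 1))" using card_occ_containing_le of_nat_mono by blast
  finally show "\<bar>cnt n V - cnt n (V(p := y))\<bar> \<le> real (k * n ^ (m - 1))" .
qed

text \<open>The four indicators cancel in pairs unless the support contains both p and r, and an
  alternating sum of four indicators is at most 2 in absolute value.\<close>

lemma cnt_bdd_diff2: "bdd_diff2 n S (\<lambda>p r. 2 * card {i\<in>occ n. p \<in> supp i \<and> r \<in> supp i}) (cnt n)"
  unfolding bdd_diff2_def
proof (intro ballI impI)
  fix V p r x y assume pr: "p \<noteq> (r::nat)"
  let ?d = "\<lambda>i. of_bool (is_pat i V) - of_bool (is_pat i (V(p := x))) - of_bool (is_pat i (V(r := y))) + of_bool (is_pat i (V(p := x, r := y))) :: real"
  have "\<bar>cnt n V - cnt n (V(p := x)) - cnt n (V(r := y)) + cnt n (V(p := x, r := y))\<bar> = \<bar>\<Sum>i\<in>occ n. ?d i\<bar>"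
    by (simp add: cnt_def sum_subtractf sum.distrib)
  also have "\<dots> \<le> (\<Sum>i\<in>occ n. 2 * of_bool (p \<in> supp i \<and> r \<in> supp i))"
  proof (rule order_trans[OF sum_abs sum_mono])
    fix i
    show "\<bar>?d i\<bar> \<le> 2 * of_bool (p \<in> supp i \<and> r \<in> supp i)"
    proof (cases "p \<in> supp i")
      case False
      then have "is_pat i V = is_pat i (V(p := x))" "is_pat i (V(r := y)) = is_pat i (V(p := x, r := y))"
        by (auto intro!: is_pat_cong)
      then show ?thesis by simp
    next
      case True
      show ?thesis
      proof (cases "r \<in> supp i")
        case False
        then have "is_pat i V = is_pat i (V(r := y))" "is_pat i (V(p := x)) = is_pat i (V(p := x, r := y))"
          by (auto intro!: is_pat_cong)
        then show ?thesis by simp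
      qed (use True in auto)
    qed
  qed
  also have "\<dots> = 2 * card {i\<in>occ n. p \<in> supp i \<and> r \<in> supp i}"
    using finite_occ by (simp add: sum_of_bool_eq Int_def sum_distrib_left[symmetric])
  finally show "\<bar>cnt n V - cnt n (V(p := x)) - cnt n (V(r := y)) + cnt n (V(p := x, r := y))\<bar>
    \<le> real (2 * card {i\<in>occ n. p \<in> supp i \<and> r \<in> supp i})" by simp
qed

definition scaling :: "nat \<Rightarrow> real" where
  "scaling n = real n powr (real m - 1 / 2)"

lemma scaling_pos: "1 \<le> n \<Longrightarrow> 0 < scaling n"
  by (simp add: scaling_def)

lemma scaling_eq: "1 \<le> n \<Longrightarrow> real n ^ (m - 1) / scaling n = 1 / sqrt n"
proof -
  assume n: "1 \<le> n"
  have "real n ^ (m - 1) / scaling n = real n powr (real (m - 1)) / real n powr (real m - 1/2)"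
    using n by (simp add: scaling_def powr_realpow)
  also have "\<dots> = real n powr (real (m - 1) - (real m - 1/2))" by (simp add: powr_diff)
  also have "real (m - 1) - (real m - 1/2) = - (1/2)" using qk by (simp add: of_nat_diff)
  finally show ?thesis using n by (simp add: powr_minus powr_half_sqrt inverse_eq_divide)
qed

text \<open>First differences and row sums of mixed differences are both of order n^(m-1), which is
  n^(-1/2) in units of \<open>scaling n\<close>. The two error terms of the general bound then have
  orders sqrt n times n^(-1) and n times n^(-3/2).\<close>

lemma cnt_char_bound:
  assumes S: "finite S" "S \<noteq> {}" and n: "1 \<le> n"
  defines "\<Omega> \<equiv> PiE {1..n} (\<lambda>_. S)"
  shows "norm (avg \<Omega> (\<lambda>V. iexp (t * ((cnt n V - avg \<Omega> (cnt n)) / scaling n)))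
      - of_real (exp (- (var \<Omega> (cnt n) / (scaling n)\<^sup>2 * t\<^sup>2 / 2))))
    \<le> (t\<^sup>2 * (k\<^sup>2 * (1 + 2 * k)) + \<bar>t\<bar>^3 * k^3) / sqrt n"
proof -
  define B where "B = real (k * n ^ (m - 1))"
  define e where "e = 2 * k * B"
  \<comment> \<open>The scaling is absorbed into the argument of the characteristic function, so the
    count itself stays unscaled.\<close>
  define s where "s = t / scaling n"
  have e: "(\<Sum>r\<in>{1..n}-{p}. real (2 * card {i\<in>occ n. p \<in> supp i \<and> r \<in> supp i})) \<le> e" for p
  proof -
    have "(\<Sum>r\<in>{1..n}-{p}. real (2 * card {i\<in>occ n. p \<in> supp i \<and> r \<in> supp i})) =
      2 * real (\<Sum>r\<in>{1..n}-{p}. card {i\<in>occ n. p \<in> supp i \<and> r \<in> supp i})"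
      by (simp add: sum_distrib_left)
    also have "\<dots> \<le> 2 * real (k * (k * n ^ (m - 1)))"
      using sum_supp_occ_le[of "{1..n}-{p}" n p] by (simp only: of_nat_le_iff mult_le_cancel_left_pos zero_less_numeral finite_Diff finite_atLeastAtMost)
    finally show ?thesis by (simp add: e_def B_def)
  qed
  have B0: "0 \<le> B" "0 \<le> e" by (simp_all add: B_def e_def)
  have "norm (avg \<Omega> (\<lambda>V. iexp (s * (cnt n V - avg \<Omega> (cnt n)))) - of_real (exp (- (var \<Omega> (cnt n) * s\<^sup>2 / 2))))
    \<le> \<bar>s\<bar> * (\<bar>s\<bar> * (sqrt n * (B\<^sup>2 + B * e)) + n * s\<^sup>2 * B^3)"
    unfolding \<Omega>_def by (rule char_normal_bound[OF S cnt_bdd_diff[of n S, folded B_def] _ cnt_bdd_diff2 e]) (use B0 in auto)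
  also have "\<dots> = (t\<^sup>2 * (k\<^sup>2 * (1 + 2 * k)) + \<bar>t\<bar>^3 * k^3) / sqrt n"
  proof -
    have sB: "s * B = t * k / sqrt n"
    proof -
      have "s * B = t * k * (real n ^ (m - 1) / scaling n)" by (simp add: s_def B_def)
      then show ?thesis unfolding scaling_eq[OF n] by simp
    qed
    have sq: "sqrt n * sqrt n = n" "0 < sqrt n" using n by auto
    have "\<bar>s\<bar> * B = \<bar>s * B\<bar>" using B0 by (simp add: abs_mult)
    then have asB: "\<bar>s\<bar> * B = \<bar>t\<bar> * k / sqrt n" using sB sq by (simp add: abs_mult)
    have "\<bar>s\<bar> * (\<bar>s\<bar> * (sqrt n * (B\<^sup>2 + B * e)) + n * s\<^sup>2 * B^3) =
      sqrt n * (1 + 2 * k) * (\<bar>s\<bar> * B)\<^sup>2 + n * (\<bar>s\<bar> * B)^3"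
      by (simp add: e_def power2_eq_square power3_eq_cube algebra_simps abs_mult[symmetric])
    also have "\<dots> = sqrt n * (1 + 2 * k) * (\<bar>t\<bar> * k / sqrt n)\<^sup>2 + n * (\<bar>t\<bar> * k / sqrt n)^3" by (simp only: asB)
    also have "sqrt n * (1 + 2 * k) * (\<bar>t\<bar> * k / sqrt n)\<^sup>2 = (t\<^sup>2 * (k\<^sup>2 * (1 + 2 * k))) / sqrt n"
      using sq by (simp add: power_divide power_mult_distrib) (simp add: field_simps power2_eq_square)
    also have "n * (\<bar>t\<bar> * k / sqrt n)^3 = (\<bar>t\<bar>^3 * k^3) / sqrt n"
    proof -
      have "n * (\<bar>t\<bar> * k / sqrt n)^3 = (sqrt n * sqrt n) * ((\<bar>t\<bar> * k) ^ 3 / (sqrt n * sqrt n * sqrt n))"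
        unfolding sq(1) by (simp add: power_divide power3_eq_cube)
      also have "\<dots> = (\<bar>t\<bar> * k)^3 / sqrt n" using sq(2) by (simp del: real_sqrt_mult_self)
      finally show ?thesis by (simp add: power_mult_distrib)
    qed
    finally show ?thesis by (simp add: add_divide_distrib)
  qed
  finally show ?thesis by (simp add: s_def power_divide)
qed

section \<open>Rearranging the letters on the support of an occurrence\<close>

lemma is_pat_iff_rank:
  assumes i: "i \<in> occ n" and V: "inj_on V (supp i)" and \<theta>: "\<theta> permutes supp i"
  shows "is_pat i (V \<circ> \<theta>) \<longleftrightarrow> (\<forall>a\<in>{1..k}. rank (supp i) V (\<theta> (i a)) = v a)"
proof -
  have in_supp: "\<theta> (i a) \<in> supp i" if "a \<in> {1..k}" for a
    using permutes_in_image[OF \<theta>] that by (auto simp: supp_def)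
  have inj: "inj_on (\<lambda>a. \<theta> (i a)) {1..k}"
    using comp_inj_on[OF occ_inj[OF i] inj_on_subset[OF permutes_inj[OF \<theta>] subset_UNIV]] by (simp add: comp_def)
  have img: "(\<lambda>a. \<theta> (i a)) ` {1..k} = supp i"
  proof -
    have "(\<lambda>a. \<theta> (i a)) ` {1..k} = \<theta> ` supp i" by (simp add: supp_def image_image)
    then show ?thesis using permutes_image[OF \<theta>] by simp
  qed
  show ?thesis
  proof
    assume p: "is_pat i (V \<circ> \<theta>)"
    show "\<forall>a\<in>{1..k}. rank (supp i) V (\<theta> (i a)) = v a"
    proof
      fix a assume a: "a \<in> {1..k}"
      have "{y \<in> supp i. V y \<le> V (\<theta> (i a))} = (\<lambda>b. \<theta> (i b)) ` {b\<in>{1..k}. v b \<le> v a}"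
        using p a unfolding is_pat_def img[symmetric] by (force simp: not_less[symmetric])
      then have "rank (supp i) V (\<theta> (i a)) = card {b\<in>{1..k}. v b \<le> v a}"
        unfolding rank_def by (simp only: card_image[OF inj_on_subset[OF inj Collect_restrict]])
      also have "\<dots> = card (v ` {b\<in>{1..k}. v b \<le> v a})"
        by (rule card_image[symmetric]) (use permutes_inj[OF v] in \<open>auto simp: inj_on_def\<close>)
      also have "v ` {b\<in>{1..k}. v b \<le> v a} = {1..v a}"
      proof (intro equalityI subsetI)
        fix x assume x: "x \<in> {1..v a}"
        moreover have "v a \<in> {1..k}" using permutes_in_image[OF v] a by blast
        ultimately have "x \<in> {1..k}" by simp
        then obtain b where "b \<in> {1..k}" "x = v b" using permutes_image[OF v] by blast
        then show "x \<in> v ` {b\<in>{1..k}. v b \<le> v a}" using x by auto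
      next
        fix x assume "x \<in> v ` {b\<in>{1..k}. v b \<le> v a}"
        then obtain b where b: "b \<in> {1..k}" "v b \<le> v a" "x = v b" by blast
        moreover have "v b \<in> {1..k}" using permutes_in_image[OF v] b by blast
        ultimately show "x \<in> {1..v a}" by simp
      qed
      finally show "rank (supp i) V (\<theta> (i a)) = v a" by simp
    qed
  next
    assume "\<forall>a\<in>{1..k}. rank (supp i) V (\<theta> (i a)) = v a"
    then show "is_pat i (V \<circ> \<theta>)"
      unfolding is_pat_def using rank_less_iff[OF finite_supp in_supp in_supp, of _ _ V] by (metis comp_apply)
  qed
qed

lemma is_pat_inj: "is_pat i V \<Longrightarrow> inj_on V (supp i)"
proof (rule inj_onI)
  fix x y assume p: "is_pat i V" and "x \<in> supp i" "y \<in> supp i" and eq: "V x = V y"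
  then obtain a b where ab: "a \<in> {1..k}" "b \<in> {1..k}" "x = i a" "y = i b" by (auto simp: supp_def)
  have "v a = v b" using p ab eq unfolding is_pat_def by (metis linorder_neqE_nat less_irrefl)
  then show "x = y" using ab permutes_inj[OF v] by (auto simp: inj_on_def)
qed

text \<open>Of the k! rearrangements of distinct letters exactly one shows the pattern. The
  probability 1/k! comes from this identity, for words as well as for conjugates.\<close>

lemma sum_perms_is_pat:
  assumes i: "i \<in> occ n"
  shows "(\<Sum>\<theta>\<in>perms (supp i). of_bool (is_pat i (V \<circ> \<theta>))) = (of_bool (inj_on V (supp i)) :: real)"
proof (cases "inj_on V (supp i)")
  case False
  have "\<not> is_pat i (V \<circ> \<theta>)" if "\<theta> \<in> perms (supp i)" for \<theta>
  proof
    assume "is_pat i (V \<circ> \<theta>)"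
    then have "inj_on (V \<circ> \<theta>) (supp i)" by (rule is_pat_inj)
    moreover have "\<theta> permutes supp i" using that by simp
    ultimately have "inj_on V (supp i)" by (metis inj_on_imageI permutes_image)
    then show False using False by simp
  qed
  then show ?thesis using False by simp
next
  case True
  define r where "r = rank (supp i) V"
  have r: "bij_betw r (supp i) {1..k}"
    unfolding r_def using rank_bij[OF finite_supp True] card_supp[OF i] by simp
  have ib: "bij_betw i {1..k} (supp i)" using occ_inj[OF i] by (simp add: bij_betw_def supp_def)
  \<comment> \<open>Position \<open>i a\<close> has to receive the letter of rank
    \<open>v a\<close>, and this determines the rearrangement.\<close>
  define \<theta>0 where "\<theta>0 = (\<lambda>x. if x \<in> supp i then inv_into (supp i) r (v (inv_into {1..k} i x)) else x)"
  have "bij_betw (inv_into (supp i) r \<circ> (v \<circ> inv_into {1..k} i)) (supp i) (supp i)"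
    by (intro bij_betw_trans[OF bij_betw_trans[OF bij_betw_inv_into[OF ib] permutes_imp_bij[OF v]] bij_betw_inv_into[OF r]])
  then have "bij_betw \<theta>0 (supp i) (supp i)" by (subst bij_betw_cong[of _ _ "inv_into (supp i) r \<circ> (v \<circ> inv_into {1..k} i)"]) (auto simp: \<theta>0_def)
  then have \<theta>0: "\<theta>0 permutes supp i" by (rule bij_imp_permutes) (simp add: \<theta>0_def)
  have \<theta>0r: "r (\<theta>0 (i a)) = v a" if a: "a \<in> {1..k}" for a
  proof -
    have "i a \<in> supp i" using a by (auto simp: supp_def)
    moreover have "inv_into {1..k} i (i a) = a" using occ_inj[OF i] a by simp
    moreover have "v a \<in> r ` supp i" using permutes_in_image[OF v] a r by (simp add: bij_betw_def del: atLeastAtMost_iff)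
    ultimately show ?thesis by (simp add: \<theta>0_def f_inv_into_f)
  qed
  have "{\<theta>\<in>perms (supp i). is_pat i (V \<circ> \<theta>)} = {\<theta>0}"
  proof (intro equalityI subsetI)
    fix \<theta> assume "\<theta> \<in> {\<theta>\<in>perms (supp i). is_pat i (V \<circ> \<theta>)}"
    then have \<theta>: "\<theta> permutes supp i" and eq: "\<forall>a\<in>{1..k}. r (\<theta> (i a)) = v a"
      using is_pat_iff_rank[OF i True] by (auto simp: r_def)
    have "\<theta> x = \<theta>0 x" for x
    proof (cases "x \<in> supp i")
      case False
      then show ?thesis using permutes_not_in[OF \<theta>] permutes_not_in[OF \<theta>0] by simp
    next
      case xs: True
      then obtain a where a: "a \<in> {1..k}" "x = i a" by (auto simp: supp_def)
      have "r (\<theta> x) = r (\<theta>0 x)" using eq \<theta>0r a by simp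
      moreover have "\<theta> x \<in> supp i" "\<theta>0 x \<in> supp i" using xs permutes_in_image[OF \<theta>] permutes_in_image[OF \<theta>0] by auto
      ultimately show ?thesis using r by (meson bij_betw_def inj_onD)
    qed
    then show "\<theta> \<in> {\<theta>0}" by auto
  next
    fix \<theta> assume "\<theta> \<in> {\<theta>0}"
    then show "\<theta> \<in> {\<theta>\<in>perms (supp i). is_pat i (V \<circ> \<theta>)}"
      using \<theta>0 \<theta>0r is_pat_iff_rank[OF i True \<theta>0] by (auto simp: r_def)
  qed
  then show ?thesis using True finite_permutations[OF finite_supp[of i]]
    by (simp add: sum_of_bool_eq Int_def)
qed

end

section \<open>Random conjugates\<close>

text \<open>Right multiplication by a transposition shows that the probability does not depend on u,
  and over all u the events partition the sample space.\<close>

lemma avg_perms_one_point: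
  assumes X: "finite X" "u \<in> X" "x \<in> X"
  shows "avg (perms X) (\<lambda>p. of_bool (p u = x)) = (1 / card X :: real)"
proof -
  define e where "e = (\<lambda>u. avg (perms X) (\<lambda>p. of_bool (p u = x)) :: real)"
  have fin: "finite (perms X)" using X finite_permutations by auto
  have e: "e z = e u" if z: "z \<in> X" for z
  proof -
    have "tr u z permutes X" using X z by (intro permutes_swap_id) auto
    from avg_bij[OF perms_right_bij[OF this], of "\<lambda>p. of_bool (p u = x) :: real"] show ?thesis
      by (simp add: e_def)
  qed
  have "(\<Sum>z\<in>X. e z) = avg (perms X) (\<lambda>p. \<Sum>z\<in>X. of_bool (p z = x))" by (simp add: e_def avg_sum)
  also have "\<dots> = avg (perms X) (\<lambda>p. 1)"
  proof (rule avg_cong)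
    fix p assume "p \<in> perms X"
    then have p: "p permutes X" by simp
    have "(\<Sum>z\<in>X. of_bool (p z = x)) = (\<Sum>z\<in>X. of_bool (z = x) :: real)"
      using sum.reindex_bij_betw[OF permutes_imp_bij[OF p], of "\<lambda>z. of_bool (z = x) :: real"] .
    also have "\<dots> = (\<Sum>z\<in>X. if z = x then 1 else 0)" by (intro sum.cong) auto
    also have "\<dots> = 1" using X by simp
    finally show "(\<Sum>z\<in>X. of_bool (p z = x)) = (1::real)" .
  qed
  also have "\<dots> = 1" by (rule avg_const[OF fin perms_nonempty])
  finally have "card X * e u = 1" using e by simp
  moreover have "real (card X) \<noteq> 0" using X by auto
  ultimately show ?thesis unfolding e_def by (simp add: eq_divide_eq mult.commute)
qed

lemma avg_perms_two_points:
  assumes X: "finite X" "u \<in> X" "u' \<in> X" "x \<in> X" "y \<in> X" and ne: "u \<noteq> u'" "x \<noteq> y"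
  shows "avg (perms X) (\<lambda>p. of_bool (p u = x \<and> p u' = y)) = 1 / (real (card X) * (real (card X) - 1))"
proof -
  define e where "e = (\<lambda>u. avg (perms X) (\<lambda>p. of_bool (p u = x \<and> p u' = y)) :: real)"
  have fin: "finite (perms X)" using X finite_permutations by auto
  have e: "e z = e u" if z: "z \<in> X - {u'}" for z
  proof -
    have "tr u z permutes X" using X z by (intro permutes_swap_id) auto
    from avg_bij[OF perms_right_bij[OF this], of "\<lambda>p. of_bool (p u = x \<and> p u' = y) :: real"] show ?thesis
      using ne not_sym[OF ne(1)] z by (auto simp: e_def Transposition.transpose_def)
  qed
  have "(\<Sum>z\<in>X-{u'}. e z) = avg (perms X) (\<lambda>p. \<Sum>z\<in>X-{u'}. of_bool (p z = x \<and> p u' = y))" by (simp add: e_def avg_sum)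
  also have "\<dots> = avg (perms X) (\<lambda>p. of_bool (p u' = y))"
  proof (rule avg_cong)
    fix p assume "p \<in> perms X"
    then have p: "p permutes X" by simp
    have "(\<Sum>z\<in>X-{u'}. of_bool (p z = x \<and> p u' = y)) = (\<Sum>z\<in>X. of_bool (p z = x \<and> p u' = y) :: real)"
      using X ne by (intro sum.mono_neutral_left) auto
    also have "\<dots> = (\<Sum>z\<in>X. of_bool (z = x \<and> p u' = y) :: real)"
      using sum.reindex_bij_betw[OF permutes_imp_bij[OF p], of "\<lambda>z. of_bool (z = x \<and> p u' = y) :: real"] .
    also have "\<dots> = (\<Sum>z\<in>X. if z = x then of_bool (p u' = y) else 0)" by (intro sum.cong) auto
    also have "\<dots> = of_bool (p u' = y)" using X by simp
    finally show "(\<Sum>z\<in>X-{u'}. of_bool (p z = x \<and> p u' = y)) = (of_bool (p u' = y) :: real)" .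
  qed
  also have "\<dots> = 1 / card X" using X by (intro avg_perms_one_point)
  finally have 1: "real (card (X - {u'})) * e u = 1 / card X" using e by simp
  have c: "real (card (X - {u'})) = real (card X) - 1"
  proof -
    have "0 < card X" using X by (auto simp: card_gt_0_iff)
    then show ?thesis using X by (simp add: of_nat_diff)
  qed
  have "card {u, u'} \<le> card X" using X by (intro card_mono) auto
  then have "2 \<le> card X" using ne by simp
  then have "real (card X) - 1 \<noteq> 0" by simp
  then have "e u = ((real (card X) - 1) * e u) / (real (card X) - 1)" by simp
  then have "e u = 1 / card X / (real (card X) - 1)" unfolding 1[unfolded c] .
  then show ?thesis by (simp add: e_def)
qed

definition conj_by :: "('a \<Rightarrow> 'a) \<Rightarrow> ('a \<Rightarrow> 'a) \<Rightarrow> 'a \<Rightarrow> 'a" where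
  "conj_by p s = p \<circ> s \<circ> inv p"

lemma conj_by_permutes: "p permutes X \<Longrightarrow> s permutes X \<Longrightarrow> conj_by p s permutes X"
  unfolding conj_by_def by (intro permutes_compose permutes_inv)

lemma conj_by_conj_by:
  assumes "bij p" "bij r"
  shows "conj_by (p \<circ> r) s = conj_by p (conj_by r s)"
  using assms by (simp add: conj_by_def o_inv_distrib o_assoc)

lemma conj_by_id: "conj_by id s = s"
  by (simp add: conj_by_def)

text \<open>With u the preimage of x under p, the event says p u = x and p (s u) = y. For x = y this
  asks for a fixed point of s; for x \<noteq> y it prescribes the images of two distinct
  points.\<close>

lemma avg_conj_at_le:
  assumes X: "finite X" "2 \<le> card X" and s: "s permutes X" and xy: "x \<in> X" "y \<in> X"
  shows "avg (perms X) (\<lambda>p. of_bool (conj_by p s x = y)) \<le>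
    (if x = y then card {u\<in>X. s u = u} / card X else 1 / (real (card X) - 1))"
proof -
  have "avg (perms X) (\<lambda>p. of_bool (conj_by p s x = y) :: real) = avg (perms X) (\<lambda>p. \<Sum>u\<in>X. of_bool (p u = x \<and> p (s u) = y))"
  proof (rule avg_cong)
    fix p assume "p \<in> perms X"
    then have p: "p permutes X" by simp
    have "(\<Sum>u\<in>X. of_bool (p u = x \<and> p (s u) = y)) = (\<Sum>u\<in>X. of_bool (p u = x \<and> conj_by p s (p u) = y) :: real)"
      using permutes_inverses[OF p] by (simp add: conj_by_def)
    also have "\<dots> = (\<Sum>z\<in>X. of_bool (z = x \<and> conj_by p s z = y))"
      using sum.reindex_bij_betw[OF permutes_imp_bij[OF p], of "\<lambda>z. of_bool (z = x \<and> conj_by p s z = y) :: real"] .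
    also have "\<dots> = (\<Sum>z\<in>X. if z = x then of_bool (conj_by p s x = y) else 0)" by (intro sum.cong) auto
    also have "\<dots> = of_bool (conj_by p s x = y)" using X xy by simp
    finally show "of_bool (conj_by p s x = y) = (\<Sum>u\<in>X. of_bool (p u = x \<and> p (s u) = y) :: real)" by simp
  qed
  also have "\<dots> = (\<Sum>u\<in>X. avg (perms X) (\<lambda>p. of_bool (p u = x \<and> p (s u) = y)))" by (rule avg_sum)
  also have "\<dots> \<le> (if x = y then card {u\<in>X. s u = u} / card X else 1 / (real (card X) - 1))"
  proof (cases "x = y")
    case True
    have "(\<Sum>u\<in>X. avg (perms X) (\<lambda>p. of_bool (p u = x \<and> p (s u) = y))) = (\<Sum>u\<in>X. of_bool (s u = u) * (1 / card X :: real))"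
    proof (rule sum.cong)
      fix u assume u: "u \<in> X"
      show "avg (perms X) (\<lambda>p. of_bool (p u = x \<and> p (s u) = y)) = of_bool (s u = u) * (1 / card X :: real)"
      proof (cases "s u = u")
        case eq: True
        then show ?thesis using avg_perms_one_point[OF X(1) u xy(1)] True by simp
      next
        case False
        have "avg (perms X) (\<lambda>p. of_bool (p u = x \<and> p (s u) = y) :: real) = avg (perms X) (\<lambda>p. 0)"
        proof (rule avg_cong)
          fix p assume "p \<in> perms X"
          then have "inj p" using permutes_inj by auto
          then show "of_bool (p u = x \<and> p (s u) = y) = (0::real)" using False True by (auto dest: injD)
        qed
        then show ?thesis using False by (simp add: avg_def)
      qed
    qed simp
    also have "\<dots> = card {u\<in>X. s u = u} / card X" using X by (simp add: sum_of_bool_eq Int_def sum_divide_distrib[symmetric])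
    finally show ?thesis using True by simp
  next
    case False
    have "(\<Sum>u\<in>X. avg (perms X) (\<lambda>p. of_bool (p u = x \<and> p (s u) = y))) \<le> (\<Sum>u\<in>X. 1 / (real (card X) * (real (card X) - 1)))"
    proof (rule sum_mono)
      fix u assume u: "u \<in> X"
      then have su: "s u \<in> X" using permutes_in_image[OF s] by simp
      show "avg (perms X) (\<lambda>p. of_bool (p u = x \<and> p (s u) = y)) \<le> 1 / (real (card X) * (real (card X) - 1))"
      proof (cases "s u = u")
        case True
        have "avg (perms X) (\<lambda>p. of_bool (p u = x \<and> p (s u) = y) :: real) = 0"
          using True False by (auto simp: avg_def intro!: sum.neutral)
        then show ?thesis using X by simp
      next
        case ne: False
        then show ?thesis using avg_perms_two_points[OF X(1) u su xy ne[symmetric] False] by simp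
      qed
    qed
    also have "\<dots> = 1 / (real (card X) - 1)"
    proof -
      have "real (card X) \<noteq> 0" using X by linarith
      then show ?thesis by simp
    qed
    finally show ?thesis using False by simp
  qed
  finally show ?thesis .
qed

text \<open>Since $w$ moves $I$ off itself, \<open>\<rho>\<close> and \<open>\<theta>\<close> have disjoint supports and commute, so that conjugation by \<open>\<rho>\<close>
  rearranges the values of $w$ on $I$ and can be undone from the result alone.\<close>

lemma conj_shift:
  assumes w: "w permutes X" and \<theta>: "\<theta> permutes I" and IX: "I \<subseteq> X" and disj: "w ` I \<inter> I = {}"
  defines "\<rho> \<equiv> w \<circ> \<theta> \<circ> inv w"
  shows "\<rho> permutes X"
    and "x \<in> I \<Longrightarrow> conj_by \<rho> w x = w (\<theta> x)"
    and "conj_by \<rho> w \<circ> \<theta> \<circ> inv (conj_by \<rho> w) = \<rho>"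
proof -
  have \<theta>X: "\<theta> permutes X" using permutes_subset[OF \<theta> IX] .
  show \<rho>: "\<rho> permutes X" unfolding \<rho>_def by (intro permutes_compose permutes_inv w \<theta>X)
  have bw: "bij w" "bij \<theta>" "bij \<rho>" using permutes_bij[OF w] permutes_bij[OF \<theta>] permutes_bij[OF \<rho>] .
  have \<rho>w: "\<rho> (w x) = w (\<theta> x)" for x unfolding \<rho>_def using permutes_inverses[OF w] by simp
  have \<rho>fix: "\<rho> x = x" if "x \<notin> w ` I" for x
  proof -
    have "inv w x \<notin> I" using that permutes_inverses[OF w] by (metis imageI)
    then show ?thesis unfolding \<rho>_def using permutes_not_in[OF \<theta>] permutes_inverses[OF w] by simp
  qed
  have comm: "\<theta> (\<rho> x) = \<rho> (\<theta> x)" for x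
  proof (cases "x \<in> w ` I")
    case True
    then obtain z where z: "z \<in> I" "x = w z" by auto
    then have "\<rho> x = w (\<theta> z)" "\<theta> z \<in> I" using \<rho>w permutes_in_image[OF \<theta>] by auto
    then have "\<rho> x \<notin> I" "x \<notin> I" using disj True by auto
    then show ?thesis using permutes_not_in[OF \<theta>] by simp
  next
    case False
    have "\<theta> x \<notin> w ` I"
    proof (cases "x \<in> I")
      case True
      then have "\<theta> x \<in> I" using permutes_in_image[OF \<theta>] by simp
      then show ?thesis using disj by auto
    qed (use False permutes_not_in[OF \<theta>] in simp)
    then show ?thesis using False \<rho>fix by simp
  qed
  show "conj_by \<rho> w x = w (\<theta> x)" if "x \<in> I"
  proof -
    have "x \<notin> w ` I" using disj that by auto
    then have "\<rho> x = x" by (rule \<rho>fix)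
    then have "inv \<rho> x = x" using bw(3) by (metis bij_inv_eq_iff)
    then show ?thesis unfolding conj_by_def using \<rho>w by simp
  qed
  show "conj_by \<rho> w \<circ> \<theta> \<circ> inv (conj_by \<rho> w) = \<rho>"
  proof
    fix x
    have "inv (conj_by \<rho> w) = \<rho> \<circ> inv w \<circ> inv \<rho>"
      unfolding conj_by_def using bw by (simp add: o_inv_distrib bij_imp_bij_inv bij_comp inv_inv_eq o_assoc)
    then have "(conj_by \<rho> w \<circ> \<theta> \<circ> inv (conj_by \<rho> w)) x = \<rho> (w (inv \<rho> (\<theta> (\<rho> (inv w (inv \<rho> x))))))"
      by (simp add: conj_by_def)
    also have "\<dots> = \<rho> (w (\<theta> (inv w (inv \<rho> x))))" using comm permutes_inverses[OF \<rho>] by simp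
    also have "\<dots> = \<rho> (\<rho> (inv \<rho> x))" by (simp add: \<rho>_def)
    also have "\<dots> = \<rho> x" using permutes_inverses[OF \<rho>] by simp
    finally show "(conj_by \<rho> w \<circ> \<theta> \<circ> inv (conj_by \<rho> w)) x = \<rho> x" .
  qed
qed

context vincular_pattern
begin

text \<open>On H the conjugate moves the support off itself, so a further conjugation can rearrange
  its values on the support by any \<theta>. For each \<theta> this is a bijection of H, hence all
  k! rearrangements are equally likely and the pattern has conditional probability exactly 1/k!,
  whatever the cycle type of s.\<close>

lemma sum_disjoint_is_pat:
  assumes i: "i \<in> occ n" and s: "s permutes {1..n}"
  defines "H \<equiv> {p. p permutes {1..n} \<and> conj_by p s ` supp i \<inter> supp i = {}}"
  shows "fact k * (\<Sum>p\<in>H. of_bool (is_pat i (conj_by p s))) = (real (card H))"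
proof -
  have finH: "finite H" unfolding H_def by (rule finite_subset[OF _ finite_permutations[of "{1..n}"]]) auto
  \<comment> \<open>The left factor depends on p through its conjugate. The inverse of that factor
    can be written with the new conjugate and \<open>inv \<theta>\<close> alone, which makes
    \<open>\<Phi> (inv \<theta>)\<close> the inverse map.\<close>
  define \<Phi> where "\<Phi> = (\<lambda>\<theta> p. (conj_by p s \<circ> \<theta> \<circ> inv (conj_by p s)) \<circ> p)"
  have key: "\<Phi> \<theta> p \<in> H \<and> (\<forall>x\<in>supp i. conj_by (\<Phi> \<theta> p) s x = conj_by p s (\<theta> x)) \<and> \<Phi> (inv \<theta>) (\<Phi> \<theta> p) = p"
    if p: "p \<in> H" and \<theta>: "\<theta> permutes supp i" for p \<theta>
  proof -
    have pp: "p permutes {1..n}" and disj: "conj_by p s ` supp i \<inter> supp i = {}" using p by (auto simp: H_def)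
    define w where "w = conj_by p s"
    define \<rho> where "\<rho> = w \<circ> \<theta> \<circ> inv w"
    have w: "w permutes {1..n}" unfolding w_def by (rule conj_by_permutes[OF pp s])
    note sh = conj_shift[OF w \<theta> supp_subset[OF i] disj[folded w_def], folded \<rho>_def]
    have \<Phi>: "\<Phi> \<theta> p = \<rho> \<circ> p" by (simp add: \<Phi>_def \<rho>_def w_def)
    have cw: "conj_by (\<Phi> \<theta> p) s = conj_by \<rho> w"
      unfolding \<Phi> w_def by (rule conj_by_conj_by[OF permutes_bij[OF sh(1)] permutes_bij[OF pp]])
    have "conj_by \<rho> w ` supp i = w ` supp i"
    proof -
      have "conj_by \<rho> w ` supp i = w ` (\<theta> ` supp i)" using sh(2) by (auto simp: image_image)
      then show ?thesis using permutes_image[OF \<theta>] by simp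
    qed
    then have 1: "\<Phi> \<theta> p \<in> H"
      using disj cw permutes_compose[OF pp sh(1)] by (simp add: H_def \<Phi> w_def)
    have bw: "bij (conj_by \<rho> w)" using permutes_bij[OF conj_by_permutes[OF sh(1) w]] .
    have "inv \<rho> = conj_by \<rho> w \<circ> inv \<theta> \<circ> inv (conj_by \<rho> w)"
    proof -
      have "inv (conj_by \<rho> w \<circ> \<theta> \<circ> inv (conj_by \<rho> w)) = conj_by \<rho> w \<circ> inv \<theta> \<circ> inv (conj_by \<rho> w)"
        using bw permutes_bij[OF \<theta>] by (simp add: o_inv_distrib bij_imp_bij_inv bij_comp inv_inv_eq o_assoc)
      then show ?thesis unfolding sh(3) .
    qed
    moreover have "\<Phi> (inv \<theta>) (\<Phi> \<theta> p) = conj_by (\<Phi> \<theta> p) s \<circ> inv \<theta> \<circ> inv (conj_by (\<Phi> \<theta> p) s) \<circ> \<Phi> \<theta> p"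
      by (simp only: \<Phi>_def)
    ultimately have "\<Phi> (inv \<theta>) (\<Phi> \<theta> p) = inv \<rho> \<circ> (\<rho> \<circ> p)"
      unfolding cw by (simp add: \<Phi>)
    also have "\<dots> = p" using permutes_inv_o(2)[OF sh(1)] by (simp add: o_assoc)
    finally show ?thesis using 1 cw sh(2) by (simp add: w_def)
  qed
  have bij: "bij_betw (\<Phi> \<theta>) H H" if \<theta>: "\<theta> permutes supp i" for \<theta>
  proof (rule bij_betwI[where g = "\<Phi> (inv \<theta>)"])
    show "\<Phi> \<theta> \<in> H \<rightarrow> H" "\<Phi> (inv \<theta>) \<in> H \<rightarrow> H" using key \<theta> permutes_inv[OF \<theta>] by auto
    show "\<Phi> (inv \<theta>) (\<Phi> \<theta> p) = p" if "p \<in> H" for p using key[OF that \<theta>] by simp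
    show "\<Phi> \<theta> (\<Phi> (inv \<theta>) p) = p" if "p \<in> H" for p
      using key[OF that permutes_inv[OF \<theta>]] permutes_inv_inv[OF \<theta>] by simp
  qed
  have "(\<Sum>p\<in>H. of_bool (is_pat i (conj_by p s))) = (\<Sum>p\<in>H. of_bool (is_pat i (conj_by p s \<circ> \<theta>)) :: real)"
    if \<theta>: "\<theta> \<in> perms (supp i)" for \<theta>
  proof -
    have "(\<Sum>p\<in>H. of_bool (is_pat i (conj_by p s))) = (\<Sum>p\<in>H. of_bool (is_pat i (conj_by (\<Phi> \<theta> p) s)) :: real)"
      using sum.reindex_bij_betw[OF bij, of \<theta> "\<lambda>p. of_bool (is_pat i (conj_by p s)) :: real"] \<theta> by simp
    also have "\<dots> = (\<Sum>p\<in>H. of_bool (is_pat i (conj_by p s \<circ> \<theta>)))"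
    proof (intro sum.cong refl)
      fix p assume "p \<in> H"
      then have "is_pat i (conj_by (\<Phi> \<theta> p) s) = is_pat i (conj_by p s \<circ> \<theta>)" using key \<theta> by (intro is_pat_cong) auto
      then show "of_bool (is_pat i (conj_by (\<Phi> \<theta> p) s)) = (of_bool (is_pat i (conj_by p s \<circ> \<theta>)) :: real)" by simp
    qed
    finally show ?thesis .
  qed
  then have "(\<Sum>\<theta>\<in>perms (supp i). \<Sum>p\<in>H. of_bool (is_pat i (conj_by p s))) = (\<Sum>\<theta>\<in>perms (supp i). \<Sum>p\<in>H. of_bool (is_pat i (conj_by p s \<circ> \<theta>)) :: real)"
    by (rule sum.cong[OF refl])
  also have "\<dots> = (\<Sum>p\<in>H. \<Sum>\<theta>\<in>perms (supp i). of_bool (is_pat i (conj_by p s \<circ> \<theta>)))" by (rule sum.swap)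
  also have "\<dots> = (\<Sum>p\<in>H. 1)"
  proof (rule sum.cong)
    fix p assume "p \<in> H"
    then have "conj_by p s permutes {1..n}" using conj_by_permutes s by (auto simp: H_def)
    then have "inj_on (conj_by p s) (supp i)" using permutes_inj inj_on_subset by blast
    then show "(\<Sum>\<theta>\<in>perms (supp i). of_bool (is_pat i (conj_by p s \<circ> \<theta>))) = (1::real)"
      using sum_perms_is_pat[OF i] by simp
  qed simp
  finally show ?thesis
    by (simp add: card_permutations[OF card_supp[OF i] finite_supp])
qed

text \<open>The error is at most the probability that the conjugate sends a point of the support
  into the support. In the union bound the k^2 pairs of points give the first term, and the k
  diagonal pairs, which see the fixed points of s, give the second.\<close>

lemma mean_is_pat:
  assumes i: "i \<in> occ n" and s: "s permutes {1..n}" and n: "2 \<le> n"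
  shows "\<bar>avg (perms {1..n}) (\<lambda>p. of_bool (is_pat i (conj_by p s))) - 1 / fact k\<bar>
    \<le> real k ^ 2 / (real n - 1) + real k * card {u\<in>{1..n}. s u = u} / n"
proof -
  let ?P = "perms {1..n}"
  have finP: "finite ?P" "?P \<noteq> {}" using finite_permutations perms_nonempty by auto
  define H where "H = {p. p permutes {1..n} \<and> conj_by p s ` supp i \<inter> supp i = {}}"
  have HP: "H \<subseteq> ?P" by (auto simp: H_def)
  define h where "h = avg ?P (\<lambda>p. of_bool (p \<notin> H) :: real)"
  have h0: "0 \<le> h" unfolding h_def by (rule avg_nonneg) simp
  have dis: "avg ?P (\<lambda>p. of_bool (p \<in> H \<and> is_pat i (conj_by p s))) = (1 - h) / fact k"
  proof -
    have "avg ?P (\<lambda>p. of_bool (p \<in> H \<and> is_pat i (conj_by p s)) :: real) = (\<Sum>p\<in>H. of_bool (is_pat i (conj_by p s))) / card ?P"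
      unfolding avg_def using HP finP by (intro arg_cong2[of _ _ _ _ "(/)"] sum.mono_neutral_cong_right) auto
    also have "\<dots> = (real (card H) / card ?P) / fact k"
    proof -
      have "(\<Sum>p\<in>H. of_bool (is_pat i (conj_by p s))) = real (card H) / fact k"
        using sum_disjoint_is_pat[OF i s, folded H_def] by (simp add: eq_divide_eq mult.commute)
      then show ?thesis by simp
    qed
    also have "real (card H) / card ?P = 1 - h"
    proof -
      have "1 - h = avg ?P (\<lambda>p. 1 - of_bool (p \<notin> H))" unfolding h_def by (simp only: avg_diff avg_const[OF finP])
      also have "\<dots> = avg ?P (\<lambda>p. of_bool (p \<in> H))" by (rule avg_cong) simp
      also have "\<dots> = card H / card ?P" using HP finP by (simp add: avg_def sum_of_bool_eq Int_commute Int_absorb2)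
      finally show ?thesis by simp
    qed
    finally show ?thesis .
  qed
  define r where "r = avg ?P (\<lambda>p. of_bool (p \<notin> H \<and> is_pat i (conj_by p s)) :: real)"
  have "avg ?P (\<lambda>p. of_bool (is_pat i (conj_by p s))) = avg ?P (\<lambda>p. of_bool (p \<in> H \<and> is_pat i (conj_by p s)) + of_bool (p \<notin> H \<and> is_pat i (conj_by p s)) :: real)"
    by (rule avg_cong) auto
  then have eq: "avg ?P (\<lambda>p. of_bool (is_pat i (conj_by p s))) - 1 / fact k = r - h / fact k"
    by (simp only: avg_add dis r_def[symmetric]) (simp add: diff_divide_distrib)
  have r: "0 \<le> r" "r \<le> h" unfolding r_def h_def by (auto intro!: avg_nonneg avg_mono)
  have "h / fact k \<le> h / 1" using h0 fact_ge_1[of k, where 'a=real] by (intro divide_left_mono) auto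
  moreover have "0 \<le> h / fact k" using h0 by simp
  ultimately have 1: "\<bar>avg ?P (\<lambda>p. of_bool (is_pat i (conj_by p s))) - 1 / fact k\<bar> \<le> h"
    unfolding eq abs_le_iff using r by linarith
  let ?fx = "card {u\<in>{1..n}. s u = u}"
  have "h \<le> avg ?P (\<lambda>p. \<Sum>x\<in>supp i. \<Sum>y\<in>supp i. of_bool (conj_by p s x = y))"
    unfolding h_def
  proof (rule avg_mono)
    fix p assume p: "p \<in> ?P"
    show "of_bool (p \<notin> H) \<le> (\<Sum>x\<in>supp i. \<Sum>y\<in>supp i. of_bool (conj_by p s x = y) :: real)"
    proof (cases "p \<in> H")
      case False
      then obtain x where x: "x \<in> supp i" "conj_by p s x \<in> supp i" using p by (auto simp: H_def)
      have "1 \<le> (\<Sum>y\<in>supp i. of_bool (conj_by p s x = y) :: real)"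
        using x finite_supp by (intro order_trans[OF _ member_le_sum[of "conj_by p s x"]]) auto
      also have "\<dots> \<le> (\<Sum>x\<in>supp i. \<Sum>y\<in>supp i. of_bool (conj_by p s x = y))"
        using x finite_supp by (intro member_le_sum) (auto intro: sum_nonneg)
      finally show ?thesis using False by simp
    qed (simp add: sum_nonneg)
  qed
  also have "\<dots> = (\<Sum>x\<in>supp i. \<Sum>y\<in>supp i. avg ?P (\<lambda>p. of_bool (conj_by p s x = y)))" by (simp only: avg_sum)
  also have "\<dots> \<le> (\<Sum>x\<in>supp i. \<Sum>y\<in>supp i. 1 / (real n - 1) + (if y = x then ?fx / n else 0))"
  proof (intro sum_mono)
    fix x y assume "x \<in> supp i" "y \<in> supp i"
    then have xy: "x \<in> {1..n}" "y \<in> {1..n}" using supp_subset[OF i] by auto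
    show "avg ?P (\<lambda>p. of_bool (conj_by p s x = y)) \<le> 1 / (real n - 1) + (if y = x then ?fx / n else 0)"
      using avg_conj_at_le[OF _ _ s xy] n by (cases "x = y") (auto intro: order_trans)
  qed
  also have "\<dots> = (\<Sum>x\<in>supp i. real k / (real n - 1) + ?fx / n)"
    using finite_supp card_supp[OF i] by (intro sum.cong refl) (simp add: sum.distrib)
  also have "\<dots> = real k ^ 2 / (real n - 1) + real k * ?fx / n"
    using card_supp[OF i] by (simp add: power2_eq_square distrib_left)
  finally show ?thesis using 1 by linarith
qed

lemma mean_cnt:
  assumes s: "s permutes {1..n}" and n: "2 \<le> n"
  shows "\<bar>avg (perms {1..n}) (\<lambda>p. cnt n (conj_by p s)) - card (occ n) / fact k\<bar>
    \<le> real n ^ m * (real k ^ 2 / (real n - 1) + real k * card {u\<in>{1..n}. s u = u} / n)"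
proof -
  let ?e = "real k ^ 2 / (real n - 1) + real k * card {u\<in>{1..n}. s u = u} / n"
  have eq: "avg (perms {1..n}) (\<lambda>p. cnt n (conj_by p s)) - card (occ n) / fact k =
    (\<Sum>i\<in>occ n. avg (perms {1..n}) (\<lambda>p. of_bool (is_pat i (conj_by p s))) - 1 / fact k)"
    unfolding cnt_def avg_sum by (simp add: sum_subtractf)
  have "\<bar>avg (perms {1..n}) (\<lambda>p. cnt n (conj_by p s)) - card (occ n) / fact k\<bar> \<le> (\<Sum>i\<in>occ n. ?e)"
    unfolding eq by (rule order_trans[OF sum_abs sum_mono]) (rule mean_is_pat[OF _ s n])
  also have "\<dots> = real (card (occ n)) * ?e" by simp
  also have "\<dots> \<le> real n ^ m * ?e"
    using card_occ_le[of n] n by (intro mult_right_mono) (auto simp: of_nat_power[symmetric] simp del: of_nat_power)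
  finally show ?thesis .
qed

end

section \<open>Coupling of conjugates\<close>

context vincular_pattern
begin

definition cnt_diff :: "nat \<Rightarrow> (nat \<Rightarrow> nat) \<Rightarrow> (nat \<Rightarrow> nat) \<Rightarrow> (nat \<Rightarrow> nat) \<Rightarrow> real" where
  "cnt_diff n s s' p = cnt n (conj_by p s) - cnt n (conj_by p s')"

lemma card_occ_meets_le:
  assumes "finite Y"
  shows "card {i\<in>occ n. supp i \<inter> Y \<noteq> {}} \<le> card Y * (k * n ^ (m - 1))"
proof -
  have "{i\<in>occ n. supp i \<inter> Y \<noteq> {}} = (\<Union>x\<in>Y. {i\<in>occ n. x \<in> supp i})" by auto
  also have "card \<dots> \<le> (\<Sum>x\<in>Y. card {i\<in>occ n. x \<in> supp i})" by (rule card_UN_le[OF assms])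
  also have "\<dots> \<le> (\<Sum>x\<in>Y. k * n ^ (m - 1))" by (intro sum_mono card_occ_containing_le)
  finally show ?thesis by simp
qed

text \<open>The conjugates by p and by \<open>p \<circ> tr a b\<close> can differ only on the image
  of Q under p. If a and b lie outside D, the conjugates of s and s' agree off the image of D both
  before and after the swap. A surviving summand must therefore meet both images.\<close>

lemma cnt_diff_swap_term:
  assumes p: "p permutes {1..n}" and s: "s permutes {1..n}" "s' permutes {1..n}"
  defines "Q a b \<equiv> {a, b, inv s a, inv s b, inv s' a, inv s' b}"
  defines "D \<equiv> {x\<in>{1..n}. s x \<noteq> s' x}"
  defines "d a b i \<equiv> (of_bool (is_pat i (conj_by p s)) - of_bool (is_pat i (conj_by p s'))
     - (of_bool (is_pat i (conj_by (p \<circ> tr a b) s)) - of_bool (is_pat i (conj_by (p \<circ> tr a b) s'))) :: real)"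
  shows "d a b i \<noteq> 0 \<Longrightarrow> supp i \<inter> p ` Q a b \<noteq> {}"
    and "d a b i \<noteq> 0 \<Longrightarrow> a \<notin> D \<Longrightarrow> b \<notin> D \<Longrightarrow> supp i \<inter> p ` D \<noteq> {}"
proof -
  have bp: "bij p" and bt: "bij (tr a b)" using permutes_bij[OF p] by auto
  have cp: "conj_by p u x = p (u (inv p x))" for u x by (simp add: conj_by_def)
  have cpt: "conj_by (p \<circ> tr a b) u x = p (tr a b (u (tr a b (inv p x))))" for u x
    using conj_by_conj_by[OF bp bt, of u] by (simp add: conj_by_def)
  have inQ: "x \<in> p ` Y" if "inv p x \<in> Y" for x Y
    using that permutes_inverses(1)[OF p, of x] by (metis imageI)
  have same: "conj_by p u x = conj_by (p \<circ> tr a b) u x" if u: "u permutes {1..n}" and x: "inv p x \<notin> {a, b, inv u a, inv u b}" for u x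
  proof -
    have "u (inv p x) \<noteq> a" "u (inv p x) \<noteq> b" using x permutes_inverses(2)[OF u] by (metis insertCI)+
    then show ?thesis unfolding cp cpt using x by (simp add: Transposition.transpose_def)
  qed
  show "supp i \<inter> p ` Q a b \<noteq> {}" if "d a b i \<noteq> 0"
  proof
    assume e: "supp i \<inter> p ` Q a b = {}"
    have nQ: "inv p x \<notin> Q a b" if "x \<in> supp i" for x using e inQ[of x "Q a b"] that by blast
    have "is_pat i (conj_by p s) = is_pat i (conj_by (p \<circ> tr a b) s)"
      by (rule is_pat_cong, rule same[OF s(1)]) (use nQ in \<open>simp add: Q_def\<close>)
    moreover have "is_pat i (conj_by p s') = is_pat i (conj_by (p \<circ> tr a b) s')"
      by (rule is_pat_cong, rule same[OF s(2)]) (use nQ in \<open>simp add: Q_def\<close>)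
    ultimately show False using that unfolding d_def by simp
  qed
  show "supp i \<inter> p ` D \<noteq> {}" if "d a b i \<noteq> 0" "a \<notin> D" "b \<notin> D"
  proof
    assume e: "supp i \<inter> p ` D = {}"
    have eqs: "s x = s' x" if "x \<notin> D" for x
      using that permutes_not_in[OF s(1), of x] permutes_not_in[OF s(2), of x] unfolding D_def by (cases "x \<in> {1..n}") auto
    have nD: "inv p x \<notin> D" if "x \<in> supp i" for x using e inQ[of x D] that by auto
    have "is_pat i (conj_by p s) = is_pat i (conj_by p s')"
      by (rule is_pat_cong) (simp add: cp eqs nD)
    moreover have "is_pat i (conj_by (p \<circ> tr a b) s) = is_pat i (conj_by (p \<circ> tr a b) s')"
    proof (rule is_pat_cong)
      fix x assume "x \<in> supp i"
      then have "tr a b (inv p x) \<notin> D" using nD that(2,3) by (simp add: Transposition.transpose_def)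
      then show "conj_by (p \<circ> tr a b) s x = conj_by (p \<circ> tr a b) s' x" unfolding cpt using eqs by simp
    qed
    ultimately show False using that(1) unfolding d_def by simp
  qed
qed

lemma avg_two_hits_le:
  assumes i: "i \<in> occ n" and ud: "u \<in> {1..n}" "d \<in> {1..n}" "u \<noteq> d"
  shows "avg (perms {1..n}) (\<lambda>p. of_bool (p u \<in> supp i \<and> p d \<in> supp i)) \<le> real k ^ 2 / (real n * (real n - 1))"
proof -
  let ?P = "perms {1..n}"
  let ?e = "1 / (real n * (real n - 1))"
  have n1: "1 \<le> n" using ud by auto
  have "avg ?P (\<lambda>p. of_bool (p u \<in> supp i \<and> p d \<in> supp i) :: real) \<le>
    avg ?P (\<lambda>p. \<Sum>x\<in>supp i. \<Sum>y\<in>supp i. of_bool (p u = x \<and> p d = y))"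
  proof (rule avg_mono)
    fix p :: "nat \<Rightarrow> nat"
    show "of_bool (p u \<in> supp i \<and> p d \<in> supp i) \<le> (\<Sum>x\<in>supp i. \<Sum>y\<in>supp i. of_bool (p u = x \<and> p d = y) :: real)"
    proof (cases "p u \<in> supp i \<and> p d \<in> supp i")
      case True
      have "1 \<le> (\<Sum>y\<in>supp i. of_bool (p u = p u \<and> p d = y) :: real)"
        using True finite_supp by (intro order_trans[OF _ member_le_sum[of "p d"]]) auto
      also have "\<dots> \<le> (\<Sum>x\<in>supp i. \<Sum>y\<in>supp i. of_bool (p u = x \<and> p d = y))"
        using True finite_supp by (intro member_le_sum[of "p u" _ "\<lambda>x. \<Sum>y\<in>supp i. of_bool (p u = x \<and> p d = y)"]) (auto intro: sum_nonneg)
      finally show ?thesis using True by simp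
    qed (auto simp: sum_nonneg)
  qed
  also have "\<dots> = (\<Sum>x\<in>supp i. \<Sum>y\<in>supp i. avg ?P (\<lambda>p. of_bool (p u = x \<and> p d = y)))" by (simp only: avg_sum)
  also have "\<dots> \<le> (\<Sum>x\<in>supp i. \<Sum>y\<in>supp i. ?e)"
  proof (intro sum_mono)
    fix x y assume xy: "x \<in> supp i" "y \<in> supp i"
    show "avg ?P (\<lambda>p. of_bool (p u = x \<and> p d = y)) \<le> ?e"
    proof (cases "x = y")
      case True
      have "avg ?P (\<lambda>p. of_bool (p u = x \<and> p d = y) :: real) = avg ?P (\<lambda>p. 0)"
      proof (rule avg_cong)
        fix p assume "p \<in> ?P"
        then have "inj p" using permutes_inj by auto
        then show "of_bool (p u = x \<and> p d = y) = (0::real)" using True ud by (auto dest: injD)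
      qed
      also have "\<dots> = 0" by (simp add: avg_def)
      finally show ?thesis using n1 by simp
    next
      case False
      have "x \<in> {1..n}" "y \<in> {1..n}" using xy supp_subset[OF i] by auto
      then show ?thesis using avg_perms_two_points[of "{1..n}" u d x y] ud False by simp
    qed
  qed
  also have "\<dots> = real k ^ 2 / (real n * (real n - 1))"
    by (simp add: card_supp[OF i] power2_eq_square)
  finally show ?thesis .
qed

text \<open>For $a$, $b$ away from the disagreement set the squared difference is bounded by its maximum times its
  mean; the mean is small because an index set rarely meets two prescribed random points.\<close>

lemma swap_energy_cnt_diff:
  assumes s: "s permutes {1..n}" "s' permutes {1..n}" and n: "2 \<le> n" and ab: "a \<in> {1..n}" "b \<in> {1..n}"
  defines "Q \<equiv> {a, b, inv s a, inv s b, inv s' a, inv s' b}"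
  defines "D \<equiv> {x\<in>{1..n}. s x \<noteq> s' x}"
  defines "B \<equiv> 12 * real k * real n ^ (m - 1)"
  shows "swap_energy {1..n} (cnt_diff n s s') a b \<le> B\<^sup>2"
    and "Q \<inter> D = {} \<Longrightarrow> swap_energy {1..n} (cnt_diff n s s') a b \<le> B * (12 * real (card D) * real n ^ m * real k ^ 2 / (real n * (real n - 1)))"
proof -
  let ?P = "perms {1..n}"
  define d where "d = (\<lambda>p i. of_bool (is_pat i (conj_by p s)) - of_bool (is_pat i (conj_by p s'))
     - (of_bool (is_pat i (conj_by (p \<circ> tr a b) s)) - of_bool (is_pat i (conj_by (p \<circ> tr a b) s'))) :: real)"
  have d2: "\<bar>d p i\<bar> \<le> 2" for p i unfolding d_def by auto
  have deq: "cnt_diff n s s' p - cnt_diff n s s' (p \<circ> tr a b) = (\<Sum>i\<in>occ n. d p i)" for p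
    by (simp add: cnt_diff_def cnt_def d_def sum_subtractf)
  have finQ: "finite Q" and cQ: "card Q \<le> 6" and QX: "Q \<subseteq> {1..n}"
  proof -
    show "finite Q" by (simp add: Q_def)
    show "card Q \<le> 6" using card_length[of "[a, b, inv s a, inv s b, inv s' a, inv s' b]"] by (simp add: Q_def)
    show "Q \<subseteq> {1..n}" unfolding Q_def using ab permutes_in_image[OF permutes_inv[OF s(1)]] permutes_in_image[OF permutes_inv[OF s(2)]] by auto
  qed
  have finD: "finite D" by (simp add: D_def)
  have n1: "0 < real n - 1" using n by simp
  have bdB: "\<bar>\<Sum>i\<in>occ n. d p i\<bar> \<le> B" if p: "p \<in> ?P" for p
  proof -
    have pp: "p permutes {1..n}" using p by simp
    have "\<bar>\<Sum>i\<in>occ n. d p i\<bar> \<le> (\<Sum>i\<in>occ n. 2 * of_bool (supp i \<inter> p ` Q \<noteq> {}))"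
    proof (rule order_trans[OF sum_abs sum_mono])
      fix i
      have "d p i \<noteq> 0 \<Longrightarrow> supp i \<inter> p ` Q \<noteq> {}"
        unfolding d_def Q_def by (rule cnt_diff_swap_term(1)[OF pp s])
      then show "\<bar>d p i\<bar> \<le> 2 * of_bool (supp i \<inter> p ` Q \<noteq> {})"
        using d2[of p i] by (cases "d p i = 0") simp_all
    qed
    also have "\<dots> = 2 * real (card {i\<in>occ n. supp i \<inter> p ` Q \<noteq> {}})"
      using finite_occ by (simp add: sum_distrib_left[symmetric] sum_of_bool_eq Int_def)
    \<comment> \<open>At most six points, each on at most \<open>k * n ^ (m - 1)\<close> index sets,
      with summands of size at most 2: this is the 12 in \<open>B\<close>.\<close>
    also have "\<dots> \<le> 2 * real (card (p ` Q) * (k * n ^ (m - 1)))"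
      using card_occ_meets_le[of "p ` Q" n] finQ by (intro mult_left_mono) (auto simp del: of_nat_mult)
    also have "\<dots> \<le> 2 * real (6 * (k * n ^ (m - 1)))"
      using card_image_le[OF finQ, of p] cQ by (intro mult_left_mono of_nat_mono mult_right_mono) auto
    also have "\<dots> = B" by (simp add: B_def)
    finally show ?thesis .
  qed
  have B0: "0 \<le> B" by (simp add: B_def)
  show "swap_energy {1..n} (cnt_diff n s s') a b \<le> B\<^sup>2"
    unfolding swap_energy_def deq
  proof (rule avg_le_const)
    fix p assume "p \<in> ?P"
    then have "\<bar>\<Sum>i\<in>occ n. d p i\<bar> \<le> \<bar>B\<bar>" using bdB B0 by auto
    then show "(\<Sum>i\<in>occ n. d p i)\<^sup>2 \<le> B\<^sup>2" by (simp add: abs_le_square_iff)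
  qed simp
  assume QD: "Q \<inter> D = {}"
  then have abD: "a \<notin> D" "b \<notin> D" by (auto simp: Q_def)
  let ?h = "\<lambda>p i u x. of_bool (p u \<in> supp i \<and> p x \<in> supp i) :: real"
  have "swap_energy {1..n} (cnt_diff n s s') a b \<le> avg ?P (\<lambda>p. B * (\<Sum>i\<in>occ n. \<Sum>u\<in>Q. \<Sum>x\<in>D. 2 * ?h p i u x))"
    unfolding swap_energy_def deq
  proof (rule avg_mono)
    fix p assume p: "p \<in> ?P"
    then have pp: "p permutes {1..n}" by simp
    have "(\<Sum>i\<in>occ n. d p i)\<^sup>2 = \<bar>\<Sum>i\<in>occ n. d p i\<bar> * \<bar>\<Sum>i\<in>occ n. d p i\<bar>" by (simp add: power2_eq_square)
    also have "\<dots> \<le> B * \<bar>\<Sum>i\<in>occ n. d p i\<bar>" using bdB[OF p] by (intro mult_right_mono) auto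
    also have "\<dots> \<le> B * (\<Sum>i\<in>occ n. \<Sum>u\<in>Q. \<Sum>x\<in>D. 2 * ?h p i u x)"
    proof (intro mult_left_mono B0 order_trans[OF sum_abs sum_mono])
      fix i
      show "\<bar>d p i\<bar> \<le> (\<Sum>u\<in>Q. \<Sum>x\<in>D. 2 * ?h p i u x)"
      proof (cases "d p i = 0")
        case False
        have "supp i \<inter> p ` Q \<noteq> {}"
          using False unfolding d_def Q_def by (rule cnt_diff_swap_term(1)[OF pp s])
        moreover have "supp i \<inter> p ` D \<noteq> {}"
          using False abD unfolding d_def D_def by (rule cnt_diff_swap_term(2)[OF pp s])
        ultimately obtain u x where ux: "u \<in> Q" "x \<in> D" "p u \<in> supp i" "p x \<in> supp i" by auto
        have "\<bar>d p i\<bar> \<le> 2 * ?h p i u x" using d2 ux by simp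
        also have "\<dots> \<le> (\<Sum>x\<in>D. 2 * ?h p i u x)"
          using ux finD by (intro member_le_sum) auto
        also have "\<dots> \<le> (\<Sum>u\<in>Q. \<Sum>x\<in>D. 2 * ?h p i u x)"
          using ux finQ by (intro member_le_sum[of u _ "\<lambda>u. \<Sum>x\<in>D. 2 * ?h p i u x"]) (auto intro: sum_nonneg)
        finally show ?thesis .
      qed (auto intro!: sum_nonneg)
    qed
    finally show "(\<Sum>i\<in>occ n. d p i)\<^sup>2 \<le> B * (\<Sum>i\<in>occ n. \<Sum>u\<in>Q. \<Sum>x\<in>D. 2 * ?h p i u x)" .
  qed
  also have "\<dots> = B * (\<Sum>i\<in>occ n. \<Sum>u\<in>Q. \<Sum>x\<in>D. 2 * avg ?P (\<lambda>p. ?h p i u x))"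
    by (simp only: avg_cmult avg_sum)
  also have "\<dots> \<le> B * (\<Sum>i\<in>occ n. \<Sum>u\<in>Q. \<Sum>x\<in>D. 2 * (real k ^ 2 / (real n * (real n - 1))))"
  proof (intro mult_left_mono B0 sum_mono)
    fix i u x assume i: "i \<in> occ n" and "u \<in> Q" "x \<in> D"
    then have "u \<in> {1..n}" "x \<in> {1..n}" "u \<noteq> x" using QX QD by (auto simp: D_def)
    then show "avg ?P (\<lambda>p. ?h p i u x) \<le> real k ^ 2 / (real n * (real n - 1))" by (rule avg_two_hits_le[OF i])
  qed auto
  also have "\<dots> = B * (real (card (occ n)) * real (card Q) * real (card D) * (2 * (real k ^ 2 / (real n * (real n - 1)))))"
    by simp
  also have "\<dots> \<le> B * (real n ^ m * 6 * real (card D) * (2 * (real k ^ 2 / (real n * (real n - 1)))))"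
    using card_occ_le[of n] cQ n1 B0
    by (intro mult_left_mono mult_right_mono mult_mono) (auto simp: of_nat_power[symmetric] simp del: of_nat_power)
  also have "\<dots> = B * (12 * real (card D) * real n ^ m * real k ^ 2 / (real n * (real n - 1)))" by simp
  finally show "swap_energy {1..n} (cnt_diff n s s') a b \<le> B * (12 * real (card D) * real n ^ m * real k ^ 2 / (real n * (real n - 1)))" .
qed

text \<open>If Q meets D, then a or b lies in a set of at most 3|D| points, so only O(n|D|) pairs
  need the crude bound B^2. The remaining pairs, up to n^2 in number, have energy of order |D|
  n^(2m-3). After the division by n in the Poincare inequality both kinds contribute order |D|
  n^(2m-2); the constant is 288 + 864.\<close>

lemma var_cnt_diff:
  assumes s: "s permutes {1..n}" "s' permutes {1..n}" and n: "2 \<le> n"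
  shows "var (perms {1..n}) (cnt_diff n s s') \<le> 1152 * real k ^ 3 * real (card {x\<in>{1..n}. s x \<noteq> s' x}) * real n ^ (2 * m - 2)"
proof -
  define D where "D = {x\<in>{1..n}. s x \<noteq> s' x}"
  define Q where "Q = (\<lambda>a b. {a, b, inv s a, inv s b, inv s' a, inv s' b})"
  define B where "B = 12 * real k * real n ^ (m - 1)"
  define G where "G = B * (12 * real (card D) * real n ^ m * real k ^ 2 / (real n * (real n - 1)))"
  have finD: "finite D" by (simp add: D_def)
  have n1: "0 < real n - 1" using n by simp
  have G0: "0 \<le> G" using n1 by (auto simp: G_def B_def)
  let ?U = "D \<union> s ` D \<union> s' ` D"
  have cU: "card ?U \<le> 3 * card D"
  proof -
    have "card ?U \<le> card D + card (s ` D) + card (s' ` D)" using card_Un_le[of D "s ` D"] card_Un_le[of "D \<union> s ` D" "s' ` D"] by linarith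
    then show ?thesis using card_image_le[OF finD, of s] card_image_le[OF finD, of s'] by linarith
  qed
  have badU: "a \<in> ?U \<or> b \<in> ?U" if bad: "Q a b \<inter> D \<noteq> {}" for a b
  proof -
    have 1: "inv s x \<in> D \<Longrightarrow> x \<in> s ` D" "inv s' x \<in> D \<Longrightarrow> x \<in> s' ` D" for x
      using permutes_inverses(1)[OF s(1)] permutes_inverses(1)[OF s(2)] by (metis imageI)+
    show ?thesis using bad 1 unfolding Q_def by blast
  qed
  have "real (card {1..n}) * var (perms {1..n}) (cnt_diff n s s') \<le> (\<Sum>a\<in>{1..n}. \<Sum>b\<in>{1..n}. swap_energy {1..n} (cnt_diff n s s') a b)"
    by (rule var_perms_le) simp
  also have "\<dots> \<le> (\<Sum>a\<in>{1..n}. \<Sum>b\<in>{1..n}. G + B\<^sup>2 * (of_bool (a \<in> ?U) + of_bool (b \<in> ?U)))"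
  proof (intro sum_mono)
    fix a b assume ab: "a \<in> {1..n}" "b \<in> {1..n}"
    show "swap_energy {1..n} (cnt_diff n s s') a b \<le> G + B\<^sup>2 * (of_bool (a \<in> ?U) + of_bool (b \<in> ?U))"
    proof (cases "Q a b \<inter> D = {}")
      case True
      then have "swap_energy {1..n} (cnt_diff n s s') a b \<le> G"
        using swap_energy_cnt_diff(2)[OF s n ab] unfolding G_def B_def Q_def D_def by auto
      moreover have "0 \<le> B\<^sup>2 * (of_bool (a \<in> ?U) + of_bool (b \<in> ?U))" by simp
      ultimately show ?thesis by linarith
    next
      case False
      have "swap_energy {1..n} (cnt_diff n s s') a b \<le> B\<^sup>2 * 1"
        using swap_energy_cnt_diff(1)[OF s n ab] unfolding B_def by simp
      also have "\<dots> \<le> B\<^sup>2 * (of_bool (a \<in> ?U) + of_bool (b \<in> ?U))"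
        using badU[OF False] by (intro mult_left_mono) (auto simp del: Un_iff)
      finally show ?thesis using G0 by linarith
    qed
  qed
  also have "\<dots> = n * (n * G) + B\<^sup>2 * (2 * (n * real (card ({1..n} \<inter> ?U))))"
    by (simp add: sum.distrib sum_distrib_left[symmetric] sum_of_bool_eq Int_def del: Un_iff)
  also have "\<dots> \<le> n * (n * G) + B\<^sup>2 * (2 * (n * real (3 * card D)))"
  proof -
    have "card ({1..n} \<inter> ?U) \<le> card ?U" by (rule card_mono) (use finD in auto)
    then have "card ({1..n} \<inter> ?U) \<le> 3 * card D" using cU by linarith
    then show ?thesis by (intro add_left_mono mult_left_mono of_nat_mono) auto
  qed
  finally have 1: "var (perms {1..n}) (cnt_diff n s s') \<le> n * G + 6 * B\<^sup>2 * real (card D)"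
  proof -
    assume a: "real (card {1..n}) * var (perms {1..n}) (cnt_diff n s s') \<le> n * (n * G) + B\<^sup>2 * (2 * (n * real (3 * card D)))"
    have "real n * var (perms {1..n}) (cnt_diff n s s') \<le> n * (n * G + 6 * B\<^sup>2 * real (card D))"
      using a by (simp add: algebra_simps)
    then show ?thesis using n by simp
  qed
  have "m \<noteq> 0" using qk by auto
  then obtain m' where m': "m = Suc m'" using not0_implies_Suc by blast
  have nn: "real n / (real n - 1) \<le> 2" using n n1 by (simp add: divide_le_eq)
  have "n * G = 144 * real k ^ 3 * real (card D) * real n ^ (2 * m') * (real n / (real n - 1))"
    using n by (simp add: G_def B_def m' power_add mult_2 power3_eq_cube power2_eq_square)
  also have "\<dots> \<le> 144 * real k ^ 3 * real (card D) * real n ^ (2 * m') * 2"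
    by (intro mult_left_mono nn) simp
  finally have 2: "n * G \<le> 288 * (real k ^ 3 * real (card D) * real n ^ (2 * m'))" by simp
  have "6 * B\<^sup>2 * real (card D) = 864 * (real k ^ 2 * real (card D) * real n ^ (2 * m'))"
    by (simp add: B_def m' power_mult_distrib power_mult[symmetric] mult.commute)
  also have "\<dots> \<le> 864 * (real k ^ 3 * real (card D) * real n ^ (2 * m'))"
    using k2 by (intro mult_left_mono mult_right_mono power_increasing) auto
  finally have "n * G + 6 * B\<^sup>2 * real (card D) \<le> 1152 * (real k ^ 3 * real (card D) * real n ^ (2 * m'))"
    using 2 by linarith
  with 1 have "var (perms {1..n}) (cnt_diff n s s') \<le> 1152 * (real k ^ 3 * real (card D) * real n ^ (2 * m'))"
    by (rule order_trans)
  moreover have "2 * m - 2 = 2 * m'" unfolding m' by simp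
  ultimately show ?thesis unfolding D_def[symmetric] by (simp add: mult.assoc)
qed

text \<open>The mean absolute difference is at most the standard deviation plus the gap between the
  two means, each of which is close to the number of occurrences divided by k!.\<close>

lemma avg_abs_cnt_diff:
  assumes s: "s permutes {1..n}" "s' permutes {1..n}" and n: "2 \<le> n"
  defines "r \<equiv> card {x\<in>{1..n}. s x \<noteq> s' x}"
  defines "fx u \<equiv> real (card {x\<in>{1..n}. u x = x})"
  shows "avg (perms {1..n}) (\<lambda>p. \<bar>cnt_diff n s s' p\<bar>) \<le>
    sqrt (1152 * real k ^ 3 * r) * real n ^ (m - 1) + real n ^ (m - 1) * (4 * real k ^ 2 + real k * (fx s + fx s'))"
proof -
  let ?P = "perms {1..n}"
  have finP: "finite ?P" "?P \<noteq> {}" using finite_permutations perms_nonempty by auto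
  have "m \<noteq> 0" using qk by auto
  then obtain m' where m': "m = Suc m'" using not0_implies_Suc by blast
  have "avg ?P (\<lambda>p. \<bar>cnt_diff n s s' p\<bar>) \<le> avg ?P (\<lambda>p. \<bar>cnt_diff n s s' p - avg ?P (cnt_diff n s s')\<bar> + \<bar>avg ?P (cnt_diff n s s')\<bar>)"
    by (rule avg_mono) auto
  also have "\<dots> = avg ?P (\<lambda>p. \<bar>cnt_diff n s s' p - avg ?P (cnt_diff n s s')\<bar>) + \<bar>avg ?P (cnt_diff n s s')\<bar>"
    by (simp only: avg_add avg_const[OF finP])
  also have "avg ?P (\<lambda>p. \<bar>cnt_diff n s s' p - avg ?P (cnt_diff n s s')\<bar>) \<le> sqrt (var ?P (cnt_diff n s s'))" by (rule avg_abs_dev_le)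
  also have "sqrt (var ?P (cnt_diff n s s')) \<le> sqrt (1152 * real k ^ 3 * r * real n ^ (2 * m - 2))"
    using var_cnt_diff[OF s n] unfolding r_def by (rule real_sqrt_le_mono)
  also have "\<dots> = sqrt (1152 * real k ^ 3 * r) * real n ^ (m - 1)"
    by (simp add: m' power_even_eq real_sqrt_mult)
  also have "\<bar>avg ?P (cnt_diff n s s')\<bar> \<le> real n ^ (m - 1) * (4 * real k ^ 2 + real k * (fx s + fx s'))"
  proof -
    have e: "real n ^ m * (real k ^ 2 / (real n - 1) + real k * fx u / n) \<le> real n ^ (m - 1) * (2 * real k ^ 2 + real k * fx u)" for u
    proof -
      have nn: "real n / (real n - 1) \<le> 2" using n by (simp add: divide_le_eq)
      have "real n ^ m * (real k ^ 2 / (real n - 1) + real k * fx u / n) =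
        real n ^ (m - 1) * (real k ^ 2 * (real n / (real n - 1)) + real k * fx u)"
        using n by (simp add: m' field_simps)
      also have "\<dots> \<le> real n ^ (m - 1) * (real k ^ 2 * 2 + real k * fx u)"
        by (intro mult_left_mono add_right_mono nn) auto
      finally show ?thesis by (simp add: mult.commute)
    qed
    have "avg ?P (cnt_diff n s s') = (avg ?P (\<lambda>p. cnt n (conj_by p s)) - card (occ n) / fact k) - (avg ?P (\<lambda>p. cnt n (conj_by p s')) - card (occ n) / fact k)"
      unfolding cnt_diff_def by (simp add: avg_diff)
    then have "\<bar>avg ?P (cnt_diff n s s')\<bar> \<le> \<bar>avg ?P (\<lambda>p. cnt n (conj_by p s)) - card (occ n) / fact k\<bar> + \<bar>avg ?P (\<lambda>p. cnt n (conj_by p s')) - card (occ n) / fact k\<bar>"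
      by linarith
    also have "\<dots> \<le> real n ^ (m - 1) * (2 * real k ^ 2 + real k * fx s) + real n ^ (m - 1) * (2 * real k ^ 2 + real k * fx s')"
      using mean_cnt[OF s(1) n] mean_cnt[OF s(2) n] e[of s] e[of s'] unfolding fx_def by linarith
    finally show ?thesis by (simp add: algebra_simps)
  qed
  finally show ?thesis by simp
qed

end

section \<open>Cycle structure\<close>

text \<open>The last position always counts as a break. The list of one orbit then has a single
  break, and breaks are subadditive under concatenation with no condition at the junction.\<close>

definition breaks :: "('a \<Rightarrow> 'a) \<Rightarrow> 'a list \<Rightarrow> nat set" where
  "breaks w xs = {j. j < length xs \<and> (Suc j = length xs \<or> w (xs ! j) \<noteq> xs ! Suc j)}"

lemma finite_breaks: "finite (breaks w xs)"
  by (simp add: breaks_def)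

lemma card_breaks_append: "card (breaks w (xs @ ys)) \<le> card (breaks w xs) + card (breaks w ys)"
proof -
  have "breaks w (xs @ ys) \<subseteq> breaks w xs \<union> (\<lambda>j. j + length xs) ` breaks w ys"
  proof
    fix j assume j: "j \<in> breaks w (xs @ ys)"
    show "j \<in> breaks w xs \<union> (\<lambda>j. j + length xs) ` breaks w ys"
    proof (cases "j < length xs")
      case True
      then have "j \<in> breaks w xs" using j by (auto simp: breaks_def nth_append)
      then show ?thesis by simp
    next
      case False
      then have "j - length xs \<in> breaks w ys" using j by (auto simp: breaks_def nth_append Suc_diff_le)
      moreover have "j = (j - length xs) + length xs" using False by simp
      ultimately show ?thesis by blast
    qed
  qed
  then have "card (breaks w (xs @ ys)) \<le> card (breaks w xs \<union> (\<lambda>j. j + length xs) ` breaks w ys)"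
    by (rule card_mono[rotated]) (simp add: finite_breaks)
  also have "\<dots> \<le> card (breaks w xs) + card ((\<lambda>j. j + length xs) ` breaks w ys)" by (rule card_Un_le)
  also have "\<dots> \<le> card (breaks w xs) + card (breaks w ys)" by (simp add: card_image_le finite_breaks)
  finally show ?thesis .
qed

lemma orbit_list:
  assumes "permutation w"
  obtains xs where "distinct xs" "set xs = orbit w x" "card (breaks w xs) \<le> 1"
proof -
  have self: "x \<in> orbit w x" by (rule permutation_self_in_orbit[OF assms])
  define N where "N = funpow_dist1 w x x"
  have N0: "0 < N" by (simp add: N_def)
  have Nx: "(w ^^ N) x = x" unfolding N_def by (rule funpow_dist1_prop[OF self])
  define xs where "xs = map (\<lambda>j. (w ^^ j) x) [0..<N]"
  have ne: "a = b" if "a < N" "b < N" "(w ^^ a) x = (w ^^ b) x" for a b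
    using funpow_neq_less_funpow_dist1[OF self, of a b] that unfolding N_def by blast
  have "distinct xs" unfolding xs_def distinct_map
    using ne by (auto intro: inj_onI)
  moreover have "set xs = orbit w x"
    unfolding orbit_altdef_bounded[OF Nx N0] by (auto simp: xs_def)
  moreover have "breaks w xs \<subseteq> {N - 1}"
  proof
    fix j assume j: "j \<in> breaks w xs"
    show "j \<in> {N - 1}"
    proof (rule ccontr)
      assume "j \<notin> {N - 1}"
      then have "Suc j < N" using j by (auto simp: breaks_def xs_def)
      then show False using j by (simp add: breaks_def xs_def)
    qed
  qed
  then have "card (breaks w xs) \<le> 1" using card_mono[of "{N-1}"] by fastforce
  ultimately show ?thesis using that by blast
qed

lemma orbits_list:
  assumes w: "permutation w" and T: "finite T" "T \<subseteq> range (orbit w)"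
  shows "\<exists>xs. distinct xs \<and> set xs = \<Union>T \<and> card (breaks w xs) \<le> card T"
  using T
proof (induction T)
  case empty
  show ?case by (intro exI[of _ "[]"]) (simp add: breaks_def)
next
  case (insert O' T)
  then obtain ys where ys: "distinct ys" "set ys = \<Union>T" "card (breaks w ys) \<le> card T" by auto
  obtain x where x: "O' = orbit w x" using insert.prems by auto
  obtain xs where xs: "distinct xs" "set xs = O'" "card (breaks w xs) \<le> 1" using orbit_list[OF w, of x] x by metis
  have "O' \<inter> \<Union>T = {}"
  proof (rule ccontr)
    assume "O' \<inter> \<Union>T \<noteq> {}"
    then obtain y P where y: "y \<in> O'" "y \<in> P" "P \<in> T" by auto
    then obtain z where z: "P = orbit w z" using insert.prems by auto
    have "orbit w y = O'" unfolding x using orbit_cyclic_eq3[OF cyclic_on_orbit'[OF w]] y(1) x by metis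
    moreover have "orbit w y = P" unfolding z using orbit_cyclic_eq3[OF cyclic_on_orbit'[OF w]] y(2) z by metis
    ultimately show False using y insert.hyps by simp
  qed
  then have "distinct (xs @ ys)" using xs ys by auto
  moreover have "set (xs @ ys) = \<Union>(insert O' T)" using xs ys by auto
  moreover have "card (breaks w (xs @ ys)) \<le> card (insert O' T)"
    using card_breaks_append[of w xs ys] xs ys insert.hyps by simp
  ultimately show ?case by blast
qed

text \<open>Listing the points orbit after orbit, the permutation is the shift except at the last point of each orbit.\<close>

lemma near_shift:
  assumes w: "w permutes {1..n}"
  shows "\<exists>\<rho>. \<rho> permutes {1..n} \<and> card {x\<in>{1..n}. conj_by (inv \<rho>) w x \<noteq> Suc x} \<le> card (orbit w ` {1..n})"
proof -
  have pw: "permutation w" using w by (auto simp: permutation_permutes)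
  obtain xs where xs: "distinct xs" "set xs = \<Union>(orbit w ` {1..n})" "card (breaks w xs) \<le> card (orbit w ` {1..n})"
    using orbits_list[OF pw, of "orbit w ` {1..n}"] by auto
  have sx: "set xs = {1..n}"
    unfolding xs(2) using permutes_orbit_subset[OF w] permutation_self_in_orbit[OF pw] by blast
  then have len: "length xs = n" using distinct_card[OF xs(1)] by simp
  \<comment> \<open>List positions start at 0, points at 1. In this numbering w sends x to x + 1
    wherever the list does not break, and x = n always belongs to a break.\<close>
  define \<rho> where "\<rho> = (\<lambda>x. if x \<in> {1..n} then xs ! (x - 1) else x)"
  have "bij_betw (\<lambda>x. xs ! (x - 1)) {1..n} {1..n}"
  proof -
    have "bij_betw ((!) xs) {..<n} {1..n}" using bij_betw_nth[OF xs(1)] len sx by metis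
    moreover have "bij_betw (\<lambda>x. x - 1) {1..n} {..<n}" by (rule bij_betwI[where g = Suc]) auto
    ultimately have "bij_betw ((!) xs \<circ> (\<lambda>x. x - 1)) {1..n} {1..n}" by (rule bij_betw_trans[rotated])
    then show ?thesis by (simp add: comp_def)
  qed
  then have "bij_betw \<rho> {1..n} {1..n}" by (subst bij_betw_cong[of _ _ "\<lambda>x. xs ! (x - 1)"]) (auto simp: \<rho>_def)
  then have \<rho>: "\<rho> permutes {1..n}" by (rule bij_imp_permutes) (auto simp: \<rho>_def)
  have cjx: "conj_by (inv \<rho>) w x = inv \<rho> (w (\<rho> x))" for x
    using permutes_inv_inv[OF \<rho>] by (simp add: conj_by_def)
  have "{x\<in>{1..n}. conj_by (inv \<rho>) w x \<noteq> Suc x} \<subseteq> Suc ` breaks w xs"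
  proof
    fix x assume "x \<in> {x\<in>{1..n}. conj_by (inv \<rho>) w x \<noteq> Suc x}"
    then have x: "x \<in> {1..n}" "inv \<rho> (w (\<rho> x)) \<noteq> Suc x" by (auto simp: cjx)
    have "x - 1 \<in> breaks w xs"
    proof (cases "x = n")
      case False
      have "w (\<rho> x) \<noteq> \<rho> (Suc x)" using x(2) permutes_inverses(2)[OF \<rho>] by metis
      then have "w (xs ! (x - 1)) \<noteq> xs ! x" using x(1) False by (auto simp: \<rho>_def)
      then show ?thesis using x(1) len by (auto simp: breaks_def)
    qed (use x len in \<open>auto simp: breaks_def\<close>)
    moreover have "x = Suc (x - 1)" using x by auto
    ultimately show "x \<in> Suc ` breaks w xs" by blast
  qed
  then have "card {x\<in>{1..n}. conj_by (inv \<rho>) w x \<noteq> Suc x} \<le> card (Suc ` breaks w xs)"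
    by (rule card_mono[rotated]) (simp add: finite_breaks)
  also have "\<dots> \<le> card (breaks w xs)" by (rule card_image_le[OF finite_breaks])
  finally show ?thesis using \<rho> xs(3) by (intro exI[of _ \<rho>]) simp
qed

section \<open>The number of cycles of a uniform permutation\<close>

lemma card_image_le_factor:
  assumes "finite S" "\<And>x y. x \<in> S \<Longrightarrow> y \<in> S \<Longrightarrow> h x = h y \<Longrightarrow> f x = f y"
  shows "card (f ` S) \<le> card (h ` S)"
proof -
  have "f ` S = (\<lambda>z. f (inv_into S h z)) ` (h ` S)"
    unfolding image_image using assms(2) inv_into_into[of _ h S] f_inv_into_f[of _ h S]
    by (intro image_cong refl) (metis imageI)
  then show ?thesis using assms(1) by (metis card_image_le finite_imageI)
qed

text \<open>For b \<noteq> z the permutation \<open>tr z b \<circ> p\<close> inserts z just before b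
  in the cycle of b, and each orbit of p stays inside an orbit of the new permutation. Only b = z
  opens a new cycle.\<close>

lemma card_orbits_insert:
  assumes p: "p permutes S" and S: "finite S" "z \<notin> S" and b: "b \<in> insert z S"
  shows "card (orbit (tr z b \<circ> p) ` insert z S) \<le> card (orbit p ` S) + of_bool (b = z)"
proof (cases "b = z")
  case True
  then have "card (orbit (tr z b \<circ> p) ` insert z S) = card (insert (orbit p z) (orbit p ` S))" by simp
  also have "\<dots> \<le> Suc (card (orbit p ` S))" using S by (simp add: card_insert_if)
  finally show ?thesis using True by simp
next
  case False
  then have bS: "b \<in> S" using b by simp
  define r where "r = tr z b \<circ> p"
  have pz: "p z = z" using permutes_not_in[OF p S(2)] .
  have "r permutes insert z S" unfolding r_def
    by (rule permutes_compose[OF permutes_subset[OF p] permutes_swap_id]) (use b in auto)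
  then have pr: "permutation r" using S by (auto simp: permutation_permutes)
  have rz: "r z = b" by (simp add: r_def pz)
  have pS: "p x \<in> S" if "x \<in> S" for x using permutes_in_image[OF p] that by simp
  have in1: "p x \<in> orbit r x" if "x \<in> S" for x
  proof (cases "p x = b")
    case True
    then have "r x = z" by (simp add: r_def)
    then have "r (r x) = p x" using rz True by simp
    then show ?thesis by (metis orbit.base orbit.step)
  next
    case False
    then have "r x = p x" using pS[OF that] S(2) by (auto simp: r_def Transposition.transpose_def)
    then show ?thesis by (metis orbit.base)
  qed
  have sub: "orbit p x \<subseteq> orbit r x" if x: "x \<in> S" for x
  proof
    fix y assume "y \<in> orbit p x"
    then have "y \<in> orbit r x \<and> y \<in> S"
    proof induction
      case base
      then show ?case using in1[OF x] pS[OF x] by simp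
    next
      case (step y)
      then show ?case using in1[of y] pS[of y] orbit_trans by fast
    qed
    then show "y \<in> orbit r x" by simp
  qed
  have req: "orbit r y = orbit r x" if "y \<in> orbit r x" for x y
    using orbit_cyclic_eq3[OF cyclic_on_orbit'[OF pr] that] .
  have "orbit r z = orbit r b" using req[of b z] rz orbit.base[of r z] by simp
  then have "orbit r ` insert z S = orbit r ` S" using bS by auto
  moreover have "card (orbit r ` S) \<le> card (orbit p ` S)"
  proof (rule card_image_le_factor[OF S(1)])
    fix x y assume xy: "x \<in> S" "y \<in> S" "orbit p x = orbit p y"
    have "permutation p" using p S by (auto simp: permutation_permutes)
    then have "y \<in> orbit p x" using xy(3) permutation_self_in_orbit by metis
    then show "orbit r x = orbit r y" using req sub[OF xy(1)] by blast
  qed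
  ultimately show ?thesis using False unfolding r_def by simp
qed

text \<open>The image b of the added point z is uniform, so a new cycle opens with probability 1 /
  (\<open>card S\<close> + 1); these probabilities sum to a harmonic number.\<close>

lemma avg_card_orbits_le:
  assumes "finite S"
  shows "avg (perms S) (\<lambda>p. real (card (orbit p ` S))) \<le> harm (card S)"
  using assms
proof (induction S)
  case empty
  then show ?case by (simp add: avg_def harm_nonneg)
next
  case (insert z S)
  let ?X = "insert z S"
  have fin: "finite ?X" "?X \<noteq> {}" "finite (perms S)" "perms S \<noteq> {}"
    using insert.hyps finite_permutations perms_nonempty by auto
  have "avg (perms ?X) (\<lambda>p. real (card (orbit p ` ?X))) =
    avg ?X (\<lambda>b. avg (perms S) (\<lambda>p. real (card (orbit (tr z b \<circ> p) ` ?X))))"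
    by (rule avg_perms_insert[OF insert.hyps])
  also have "\<dots> \<le> avg ?X (\<lambda>b. avg (perms S) (\<lambda>p. real (card (orbit p ` S)) + of_bool (b = z)))"
  proof (intro avg_mono)
    fix b p assume "b \<in> ?X" "p \<in> perms S"
    then have "card (orbit (tr z b \<circ> p) ` ?X) \<le> card (orbit p ` S) + of_bool (b = z)"
      using card_orbits_insert[OF _ insert.hyps] by auto
    then have "real (card (orbit (tr z b \<circ> p) ` ?X)) \<le> real (card (orbit p ` S) + of_bool (b = z))"
      by (rule of_nat_mono)
    then show "real (card (orbit (tr z b \<circ> p) ` ?X)) \<le> real (card (orbit p ` S)) + of_bool (b = z)" by simp
  qed
  also have "\<dots> = avg (perms S) (\<lambda>p. real (card (orbit p ` S))) + avg ?X (\<lambda>b. of_bool (b = z))"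
    by (simp only: avg_add avg_const[OF fin(3,4)] avg_const[OF fin(1,2)])
  also have "avg ?X (\<lambda>b. of_bool (b = z) :: real) = 1 / Suc (card S)"
  proof -
    have "(\<Sum>b\<in>?X. of_bool (b = z) :: real) = (\<Sum>b\<in>?X. if b = z then 1 else 0)" by (intro sum.cong) auto
    also have "\<dots> = 1" using fin by (simp del: sum.insert)
    finally show ?thesis using insert.hyps by (simp add: avg_def)
  qed
  also have "avg (perms S) (\<lambda>p. real (card (orbit p ` S))) + 1 / Suc (card S) \<le> harm (card S) + 1 / Suc (card S)"
    using insert.IH by simp
  also have "\<dots> = harm (card ?X)" using insert.hyps by (simp add: harm_Suc inverse_eq_divide)
  finally show ?case .
qed

lemma harm_le_1_ln: "1 \<le> n \<Longrightarrow> harm n \<le> 1 + ln (real n)"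
proof (induction n rule: dec_induct)
  case base
  show ?case by (simp add: harm_def)
next
  case (step n)
  have n: "0 < real n" using step by simp
  have "ln (real n / (real n + 1)) \<le> real n / (real n + 1) - 1" using n by (intro ln_le_minus_one) auto
  also have "\<dots> = - (1 / (real n + 1))" using n by (simp add: field_simps)
  finally have "1 / (real n + 1) \<le> ln (real n + 1) - ln (real n)" using n by (simp add: ln_div)
  moreover have "harm (Suc n) = (harm n + 1 / (real n + 1) :: real)" by (simp add: harm_Suc inverse_eq_divide)
  ultimately show ?case using step by (simp add: add.commute)
qed

section \<open>Cycle types under conjugation, and the classes they define\<close>

lemma orbit_conj_by:
  assumes "bij p" "permutation s"
  shows "orbit (conj_by p s) (p x) = p ` orbit s x"
  using orbit_inverse[OF permutation_self_in_orbit[OF assms(2)], where g' = "conj_by p s" and f = p and a = x] bij_is_inj[OF assms(1)]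
  by (simp add: conj_by_def)

lemma cycle_type_conj_by:
  assumes p: "p permutes {1..n}" and s: "s permutes {1..n}"
  shows "cycle_type n (conj_by p s) = cycle_type n s"
proof -
  have ps: "permutation s" using s by (auto simp: permutation_permutes)
  have ip: "inj p" using permutes_inj[OF p] .
  have "orbit (conj_by p s) ` {1..n} = orbit (conj_by p s) ` (p ` {1..n})" using permutes_image[OF p] by simp
  also have "\<dots> = (`) p ` (orbit s ` {1..n})" using orbit_conj_by[OF permutes_bij[OF p] ps] by (simp add: image_image)
  finally have eq: "orbit (conj_by p s) ` {1..n} = (`) p ` (orbit s ` {1..n})" .
  have inj: "inj_on ((`) p) Y" for Y using ip by (simp add: inj_image_eq_iff inj_on_def)
  have "mset_set ((`) p ` (orbit s ` {1..n})) = image_mset ((`) p) (mset_set (orbit s ` {1..n}))"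
    by (rule image_mset_mset_set[OF inj, symmetric])
  then show ?thesis unfolding cycle_type_def eq
    using card_image[OF inj_on_subset[OF ip subset_UNIV]] by (simp add: multiset.map_comp comp_def)
qed

lemma finite_class: "finite (perms_of_cycle_type n lam)"
  unfolding perms_of_cycle_type_def by (rule finite_subset[OF _ finite_permutations[of "{1..n}"]]) auto

text \<open>Conjugation by a fixed p permutes the class, so an additional average over p changes
  nothing. This brings the random conjugates of a fixed s into play.\<close>

lemma avg_class_conj_by:
  "avg (perms_of_cycle_type n lam) g = avg (perms_of_cycle_type n lam) (\<lambda>s. avg (perms {1..n}) (\<lambda>p. g (conj_by p s)))"
proof -
  let ?C = "perms_of_cycle_type n lam"
  have fin: "finite (perms {1..n})" "perms {1..n} \<noteq> {}" using finite_permutations perms_nonempty by auto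
  have "avg ?C (\<lambda>s. g (conj_by p s)) = avg ?C g" if "p \<in> perms {1..n}" for p
  proof (rule avg_bij)
    have p: "p permutes {1..n}" using that by simp
    have bp: "bij p" using permutes_bij[OF p] .
    have 1: "conj_by r s \<in> ?C" if "s \<in> ?C" "r permutes {1..n}" for r s
      using that cycle_type_conj_by conj_by_permutes by (auto simp: perms_of_cycle_type_def)
    show "bij_betw (conj_by p) ?C ?C"
    proof (rule bij_betwI[where g = "conj_by (inv p)"])
      show "conj_by p \<in> ?C \<rightarrow> ?C" "conj_by (inv p) \<in> ?C \<rightarrow> ?C" using 1 p permutes_inv[OF p] by auto
      show "conj_by (inv p) (conj_by p s) = s" for s
        using conj_by_conj_by[of "inv p" p s] bp by (simp add: bij_imp_bij_inv conj_by_id permutes_inv_o[OF p])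
      show "conj_by p (conj_by (inv p) s) = s" for s
        using conj_by_conj_by[of p "inv p" s] bp by (simp add: bij_imp_bij_inv conj_by_id permutes_inv_o[OF p])
    qed
  qed
  then have "avg (perms {1..n}) (\<lambda>p. avg ?C (\<lambda>s. g (conj_by p s))) = avg (perms {1..n}) (\<lambda>p. avg ?C g)"
    by (rule avg_cong)
  then show ?thesis unfolding avg_const[OF fin] by (subst avg_swap) simp
qed

lemma avg_perms_conj_by:
  assumes "r permutes {1..n}"
  shows "avg (perms {1..n}) (\<lambda>p. g (conj_by p (conj_by r s))) = avg (perms {1..n}) (\<lambda>p. g (conj_by p s))"
proof -
  have "avg (perms {1..n}) (\<lambda>p. g (conj_by p (conj_by r s))) = avg (perms {1..n}) (\<lambda>p. g (conj_by (p \<circ> r) s))"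
  proof (rule avg_cong)
    fix p assume "p \<in> perms {1..n}"
    then have "bij p" using permutes_bij by blast
    then show "g (conj_by p (conj_by r s)) = g (conj_by (p \<circ> r) s)" by (simp add: conj_by_conj_by permutes_bij[OF assms])
  qed
  also have "\<dots> = avg (perms {1..n}) (\<lambda>p. g (conj_by p s))"
    using avg_bij[OF perms_right_bij[OF assms], of "\<lambda>p. g (conj_by p s)"] .
  finally show ?thesis .
qed

text \<open>Parts are realized one at a time, each by a cycle on fresh points beyond the existing
  ones. Nonemptiness is what gives the uniform distribution on the class a meaning.\<close>

lemma class_nonempty:
  assumes "0 \<notin># lam"
  shows "perms_of_cycle_type (sum_mset lam) lam \<noteq> {}"
  using assms
proof (induction lam)
  case empty
  have "id \<in> perms_of_cycle_type 0 {#}" by (simp add: perms_of_cycle_type_def cycle_type_def permutes_id)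
  then show ?case by auto
next
  case (add l lam)
  define N where "N = sum_mset lam"
  have l: "1 \<le> l" using add.prems by (simp add: Suc_le_eq)
  obtain w where w: "w permutes {1..N}" "cycle_type N w = lam"
    using add by (auto simp: perms_of_cycle_type_def N_def)
  define B where "B = {N+1..N+l}"
  define c where "c = (\<lambda>x. if x \<in> B then (if x = N + l then N + 1 else Suc x) else x)"
  define w' where "w' = (\<lambda>x. if x \<in> B then c x else w x)"
  have "bij_betw c B B"
    by (rule bij_betwI[where g = "\<lambda>x. if x = N + 1 then N + l else x - 1"]) (use l in \<open>auto simp: c_def B_def\<close>)
  then have c: "c permutes B" by (rule bij_imp_permutes) (simp add: c_def)
  have w'c: "w' = c \<circ> w"
  proof
    fix x
    show "w' x = (c \<circ> w) x"
    proof (cases "x \<in> B")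
      case True
      then have "x \<notin> {1..N}" by (auto simp: B_def)
      then show ?thesis using True permutes_not_in[OF w(1)] by (simp add: w'_def)
    next
      case False
      have "w x \<notin> B"
      proof (cases "x \<in> {1..N}")
        case True
        then have "w x \<in> {1..N}" using permutes_in_image[OF w(1)] by blast
        then show ?thesis by (auto simp: B_def)
      qed (use False permutes_not_in[OF w(1)] in auto)
      then show ?thesis using False by (simp add: w'_def c_def)
    qed
  qed
  have un: "{1..N} \<union> B = {1..N+l}" by (auto simp: B_def)
  have w': "w' permutes {1..N+l}" unfolding w'c
    by (rule permutes_compose[OF permutes_subset[OF w(1)] permutes_subset[OF c]]) (auto simp: B_def)
  have pw: "permutation w'" using w' by (auto simp: permutation_permutes)
  have o1: "orbit w' x = orbit w x" if "x \<in> {1..N}" for x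
  proof (rule orbit_cong0[OF that])
    show "w' \<in> {1..N} \<rightarrow> {1..N}" using permutes_in_image[OF w(1)] by (auto simp: w'_def B_def)
    show "w' y = w y" if "y \<in> {1..N}" for y using that by (auto simp: w'_def B_def)
  qed
  have pow: "(w' ^^ j) (N + 1) = N + 1 + j" if "j < l" for j
    using that by (induction j) (auto simp: w'_def c_def B_def)
  have o2: "orbit w' (N + 1) = B"
  proof
    show "B \<subseteq> orbit w' (N + 1)"
    proof
      fix x assume "x \<in> B"
      then have "x = (w' ^^ (x - N - 1)) (N + 1)" using pow[of "x - N - 1"] by (auto simp: B_def)
      then show "x \<in> orbit w' (N + 1)"
        using funpow_in_orbit[OF permutation_self_in_orbit[OF pw], of "x - N - 1" "N + 1"] by simp
    qed
    show "orbit w' (N + 1) \<subseteq> B"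
    proof
      fix y assume "y \<in> orbit w' (N + 1)"
      then show "y \<in> B" by induction (use l in \<open>auto simp: w'_def c_def B_def\<close>)
    qed
  qed
  have o3: "orbit w' x = B" if "x \<in> B" for x
    using orbit_cyclic_eq3[OF cyclic_on_orbit'[OF pw, of "N+1"]] that o2 by simp
  have img: "orbit w' ` {1..N+l} = insert B (orbit w ` {1..N})"
  proof -
    have "N + 1 \<in> B" using l by (simp add: B_def)
    then have "orbit w' ` B = {B}" using o3 by auto
    then show ?thesis unfolding un[symmetric] image_Un using o1 by auto
  qed
  have "B \<notin> orbit w ` {1..N}"
  proof
    assume "B \<in> orbit w ` {1..N}"
    then obtain x where "x \<in> {1..N}" "B = orbit w x" by blast
    then have "B \<subseteq> {1..N}" using permutes_orbit_subset[OF w(1)] by metis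
    then show False using l by (auto simp: B_def)
  qed
  then have "cycle_type (N + l) w' = add_mset l lam"
    unfolding cycle_type_def img using w(2) by (simp add: cycle_type_def B_def)
  then have "w' \<in> perms_of_cycle_type (N + l) (add_mset l lam)" using w' by (simp add: perms_of_cycle_type_def)
  then show ?case by (auto simp: N_def add.commute)
qed

lemma class_mem_orbits:
  assumes "s \<in> perms_of_cycle_type n lam"
  shows "s permutes {1..n}" "card (orbit s ` {1..n}) = size lam"
proof -
  show "s permutes {1..n}" using assms by (simp add: perms_of_cycle_type_def)
  have "size (cycle_type n s) = card (orbit s ` {1..n})" by (simp add: cycle_type_def)
  then show "card (orbit s ` {1..n}) = size lam" using assms by (simp add: perms_of_cycle_type_def)
qed

lemma class_mem_no_fixed:
  assumes "s \<in> perms_of_cycle_type n lam" "count lam 1 = 0"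
  shows "card {x\<in>{1..n}. s x = x} = 0"
proof -
  have "s x \<noteq> x" if x: "x \<in> {1..n}" for x
  proof
    assume "s x = x"
    then have "orbit s x = {x}" by (simp add: orbit_eq_singleton_iff)
    then have "1 = card (orbit s x)" by simp
    moreover have "card (orbit s x) \<in># cycle_type n s" using x unfolding cycle_type_def by auto
    ultimately have "1 \<in># lam" using assms(1) by (simp add: perms_of_cycle_type_def)
    then show False using assms(2) by (simp add: count_eq_zero_iff)
  qed
  then show ?thesis by auto
qed

lemma fixed_le_orbits:
  fixes s :: "nat \<Rightarrow> nat"
  assumes "s permutes {1..n}"
  shows "card {x\<in>{1..n}. s x = x} \<le> card (orbit s ` {1..n})"
proof (rule card_inj_on_le[where f = "orbit s"])
  have o: "orbit s x = {x}" if "s x = x" for x using that by (simp add: orbit_eq_singleton_iff)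
  show "inj_on (orbit s) {x\<in>{1..n}. s x = x}" by (rule inj_onI) (use o in auto)
qed auto

lemma size_mult_le_sum_mset:
  "(\<And>l. l \<in># M \<Longrightarrow> L \<le> l) \<Longrightarrow> L * size M \<le> sum_mset (M :: nat multiset)"
  by (induction M) (auto intro: add_mono)

text \<open>Multiplicities are integers, so tending to 0 means being eventually 0. Once every part
  is at least L there are at most n/L parts.\<close>

lemma all_long_size:
  assumes part: "\<And>n. lam n partition_of n" and long: "all_long_cycles lam"
  shows "(\<lambda>n. real (size (lam n)) / real n) \<longlonglongrightarrow> 0"
    and "eventually (\<lambda>n. count (lam n) 1 = 0) sequentially"
proof -
  have z: "eventually (\<lambda>n. count (lam n) i = 0) sequentially" if "1 \<le> i" for i
  proof -
    have "(\<lambda>n. real (count (lam n) i)) \<longlonglongrightarrow> 0" using long that by (simp add: all_long_cycles_def)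
    then have "eventually (\<lambda>n. real (count (lam n) i) < 1) sequentially" by (rule order_tendstoD) simp
    then show ?thesis by eventually_elim simp
  qed
  then show "eventually (\<lambda>n. count (lam n) 1 = 0) sequentially" by simp
  show "(\<lambda>n. real (size (lam n)) / real n) \<longlonglongrightarrow> 0"
  proof (rule LIMSEQ_I)
    fix e :: real assume e: "0 < e"
    obtain L where L: "1 / e < real L" using reals_Archimedean2 by blast
    then have L0: "0 < L" using e by (metis divide_pos_pos of_nat_0_less_iff order.strict_trans zero_less_one)
    have "eventually (\<lambda>n. \<forall>i\<in>{1..L}. count (lam n) i = 0) sequentially"
      by (rule eventually_ball_finite) (use z in auto)
    then obtain n0 where n0: "\<And>n. n \<ge> n0 \<Longrightarrow> \<forall>i\<in>{1..L}. count (lam n) i = 0"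
      by (auto simp: eventually_sequentially)
    have "norm (real (size (lam n)) / real n - 0) < e" if n: "n \<ge> max 1 n0" for n
    proof -
      have big: "L \<le> l" if "l \<in># lam n" for l
      proof (rule ccontr)
        assume "\<not> L \<le> l"
        moreover have "l \<noteq> 0" using part[of n] that by (metis partition_of_def)
        ultimately have "l \<in> {1..L}" by auto
        then show False using n0[of n] n that by (auto simp: count_eq_zero_iff)
      qed
      have "L * size (lam n) \<le> sum_mset (lam n)" by (rule size_mult_le_sum_mset[OF big])
      then have "L * size (lam n) \<le> n" using part[of n] by (simp add: partition_of_def)
      then have "real L * real (size (lam n)) \<le> real n" by (metis of_nat_le_iff of_nat_mult)
      then have "real (size (lam n)) / real n \<le> 1 / L" using n L0 by (simp add: field_simps)
      also have "\<dots> < e" using L L0 e by (simp add: field_simps)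
      finally show ?thesis by simp
    qed
    then show "\<exists>no. \<forall>n\<ge>no. norm (real (size (lam n)) / real n - 0) < e" by blast
  qed
qed

section \<open>Convergence of the variance\<close>

lemma tendsto_falling_ratio:
  fixes c :: "nat \<Rightarrow> real" and d :: nat
  shows "(\<lambda>n. \<Prod>i<d. (real n - c i) / real n) \<longlonglongrightarrow> 1"
proof -
  have "(\<lambda>n. (real n - c i) / real n) \<longlonglongrightarrow> 1" for i by real_asymp
  then have "(\<lambda>n. \<Prod>i<d. (real n - c i) / real n) \<longlonglongrightarrow> (\<Prod>i<d. 1)" by (intro tendsto_prod)
  then show ?thesis by simp
qed

text \<open>The deviation from 1 is of order 1/n and still vanishes after multiplication by sqrt n.
  This rate permits centring at n^m / (k! m!) in place of the exact mean.\<close>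

lemma tendsto_falling_ratio_rate:
  fixes c :: "nat \<Rightarrow> real" and d :: nat
  shows "(\<lambda>n. sqrt (real n) * ((\<Prod>i<d. (real n - c i) / real n) - 1)) \<longlonglongrightarrow> 0"
proof (induction d)
  case 0
  then show ?case by simp
next
  case (Suc d)
  have "(\<lambda>n. (real n - c d) / real n) \<longlonglongrightarrow> 1" by real_asymp
  with Suc have 1: "(\<lambda>n. sqrt (real n) * ((\<Prod>i<d. (real n - c i) / real n) - 1) * ((real n - c d) / real n)) \<longlonglongrightarrow> 0 * 1"
    by (rule tendsto_mult)
  have 2: "(\<lambda>n. sqrt (real n) * ((real n - c d) / real n - 1)) \<longlonglongrightarrow> 0" by real_asymp
  have "(\<lambda>n. sqrt (real n) * ((\<Prod>i<d. (real n - c i) / real n) - 1) * ((real n - c d) / real n)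
     + sqrt (real n) * ((real n - c d) / real n - 1)) \<longlonglongrightarrow> 0 * 1 + 0"
    by (rule tendsto_add[OF 1 2])
  then show ?case by (simp add: algebra_simps)
qed

lemma binomial_falling:
  assumes "b \<le> n" "1 \<le> n"
  shows "real ((n - b) choose d) / real n ^ d = (\<Prod>i<d. (real n - (real b + real i)) / real n) / fact d"
proof -
  have "real ((n - b) choose d) = (\<Prod>i<d. real n - (real b + real i)) / fact d"
    using assms by (simp add: binomial_gbinomial gbinomial_prod_rev of_nat_diff lessThan_atLeast0 diff_diff_eq)
  then show ?thesis by (simp add: prod_dividef)
qed

lemma tendsto_binomial_ratio: "(\<lambda>n. real ((n - b) choose d) / real n ^ d) \<longlonglongrightarrow> 1 / fact d"
proof (rule Lim_transform_eventually)
  show "(\<lambda>n. (\<Prod>i<d. (real n - (real b + real i)) / real n) / fact d) \<longlonglongrightarrow> 1 / fact d"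
    by (intro tendsto_divide tendsto_falling_ratio tendsto_const) simp
  show "eventually (\<lambda>n. (\<Prod>i<d. (real n - (real b + real i)) / real n) / fact d = real ((n - b) choose d) / real n ^ d) sequentially"
    using eventually_ge_at_top[of "max b 1"] by eventually_elim (simp add: binomial_falling)
qed

lemma tendsto_binomial_rate: "(\<lambda>n. sqrt (real n) * (real ((n - b) choose d) / real n ^ d - 1 / fact d)) \<longlonglongrightarrow> 0"
proof (rule Lim_transform_eventually)
  have "(\<lambda>n. sqrt (real n) * ((\<Prod>i<d. (real n - (real b + real i)) / real n) - 1) / fact d) \<longlonglongrightarrow> 0 / fact d"
    by (intro tendsto_divide tendsto_falling_ratio_rate tendsto_const) simp
  then show "(\<lambda>n. sqrt (real n) * ((\<Prod>i<d. (real n - (real b + real i)) / real n) - 1) / fact d) \<longlonglongrightarrow> 0" by simp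
  show "eventually (\<lambda>n. sqrt (real n) * ((\<Prod>i<d. (real n - (real b + real i)) / real n) - 1) / fact d =
    sqrt (real n) * (real ((n - b) choose d) / real n ^ d - 1 / fact d)) sequentially"
    using eventually_ge_at_top[of "max b 1"]
    by eventually_elim (simp add: binomial_falling diff_divide_distrib right_diff_distrib)
qed

text \<open>The bound by n^e forces d \<le> e, and then the limit is 1/d! for d = e and 0 otherwise.
  The exponent for an order type is thus controlled by counting rather than by an analysis of how
  two occurrences overlap.\<close>

lemma convergent_binomial_ratio:
  assumes "\<And>n. real ((n - b) choose d) \<le> C * real n ^ e"
  shows "convergent (\<lambda>n. real ((n - b) choose d) / real n ^ e)"
proof -
  have de: "d \<le> e"
  proof (rule ccontr)
    assume "\<not> d \<le> e"
    then have e: "Suc e \<le> d" by simp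
    have "(\<lambda>n. C / real n) \<longlonglongrightarrow> 0" by (rule lim_const_over_n)
    moreover have "eventually (\<lambda>n. real ((n - b) choose d) / real n ^ d \<le> C / real n) sequentially"
      using eventually_ge_at_top[of 1]
    proof eventually_elim
      case (elim n)
      have C: "0 \<le> C"
      proof -
        have "0 \<le> C * real n ^ e" using assms[of n] by (rule order_trans[rotated]) simp
        moreover have "0 < real n ^ e" using elim by simp
        ultimately show ?thesis using mult_neg_pos[of C "real n ^ e"] by (cases "C < 0") auto
      qed
      have "real ((n - b) choose d) / real n ^ d \<le> C * real n ^ e / real n ^ d"
        using assms by (intro divide_right_mono) auto
      also have "\<dots> \<le> C * real n ^ e / real n ^ Suc e"
        using elim e C by (intro divide_left_mono power_increasing mult_nonneg_nonneg) auto
      also have "\<dots> = C / real n" using elim by simp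
      finally show ?case .
    qed
    ultimately have "1 / fact d \<le> (0::real)"
      using tendsto_le[OF _ _ tendsto_binomial_ratio[of b d]] by fastforce
    moreover have "0 < 1 / (fact d :: real)" by simp
    ultimately show False by linarith
  qed
  have "(\<lambda>n. (real ((n - b) choose d) / real n ^ d) * (if d = e then 1 else 1 / real n ^ (e - d))) \<longlonglongrightarrow> 1 / fact d * (if d = e then 1 else 0)"
  proof (rule tendsto_mult[OF tendsto_binomial_ratio])
    show "(\<lambda>n. if d = e then 1 else 1 / real n ^ (e - d)) \<longlonglongrightarrow> (if d = e then 1 else 0)"
    proof (cases "d = e")
      case False
      then have "0 < e - d" using de by simp
      then have "(\<lambda>n. 1 / real n ^ (e - d)) \<longlonglongrightarrow> 0"
        using tendsto_power[OF lim_1_over_n, of "e - d"] by (simp add: power_divide power_0_left)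
      then show ?thesis using False by simp
    qed simp
  qed
  moreover have "(real ((n - b) choose d) / real n ^ d) * (if d = e then 1 else 1 / real n ^ (e - d)) = real ((n - b) choose d) / real n ^ e" for n
    using de by (simp add: power_add[symmetric])
  ultimately show ?thesis unfolding convergent_def by auto
qed

lemma avg_PiE_extend:
  fixes f :: "(nat \<Rightarrow> 'b) \<Rightarrow> 'c::real_normed_field"
  assumes S: "finite S" "S \<noteq> {}" and f: "\<And>V W. (\<And>x. x \<in> {1..n0} \<Longrightarrow> V x = W x) \<Longrightarrow> f V = f W" and n: "n0 \<le> n"
  shows "avg (PiE {1..n} (\<lambda>_. S)) f = avg (PiE {1..n0} (\<lambda>_. S)) f"
  using n
proof (induction n rule: dec_induct)
  case (step n)
  have bij: "bij_betw (\<lambda>z. (fst z)(Suc n := snd z)) ((PiE {1..n} (\<lambda>_. S)) \<times> S) (PiE {1..Suc n} (\<lambda>_. S))"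
  proof (rule bij_betwI[where g = "\<lambda>V. (restrict V {1..n}, V (Suc n))"])
    show "(\<lambda>z. (fst z)(Suc n := snd z)) \<in> (PiE {1..n} (\<lambda>_. S)) \<times> S \<rightarrow> PiE {1..Suc n} (\<lambda>_. S)"
      by (auto simp: PiE_iff extensional_def le_Suc_eq)
    show "(\<lambda>V. (restrict V {1..n}, V (Suc n))) \<in> PiE {1..Suc n} (\<lambda>_. S) \<rightarrow> (PiE {1..n} (\<lambda>_. S)) \<times> S"
      by (auto simp: PiE_iff)
  qed (auto simp: PiE_iff extensional_def fun_eq_iff le_Suc_eq)
  have "avg (PiE {1..Suc n} (\<lambda>_. S)) f = avg ((PiE {1..n} (\<lambda>_. S)) \<times> S) (\<lambda>z. f ((fst z)(Suc n := snd z)))"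
    using avg_bij[OF bij, of f] by simp
  also have "\<dots> = avg ((PiE {1..n} (\<lambda>_. S)) \<times> S) (\<lambda>z. f (fst z))"
    using step by (intro avg_cong f) auto
  also have "\<dots> = avg (PiE {1..n} (\<lambda>_. S)) f" by (rule avg_fst[OF S])
  finally show ?case using step.IH by simp
qed simp

lemma extend_inj_to_permutation:
  assumes X: "finite X" "K \<subseteq> X" "f ` K \<subseteq> X" "inj_on f K"
  obtains p where "p permutes X" "\<And>x. x \<in> K \<Longrightarrow> p x = f x"
proof -
  have fK: "finite K" using X finite_subset by auto
  have "card (X - K) = card (X - f ` K)"
    using X fK by (simp add: card_Diff_subset card_image)
  then obtain h where h: "bij_betw h (X - K) (X - f ` K)"
    using finite_same_card_bij[of "X - K" "X - f ` K"] X by auto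
  define p where "p = (\<lambda>x. if x \<in> K then f x else if x \<in> X then h x else x)"
  have "bij_betw p (K \<union> (X - K)) (f ` K \<union> (X - f ` K))"
  proof (rule bij_betw_combine)
    show "bij_betw p K (f ` K)" using X(4) by (subst bij_betw_cong[of _ _ f]) (auto simp: p_def bij_betw_def)
    show "bij_betw p (X - K) (X - f ` K)" using h by (subst bij_betw_cong[of _ _ h]) (auto simp: p_def)
  qed auto
  moreover have "K \<union> (X - K) = X" "f ` K \<union> (X - f ` K) = X" using X by auto
  ultimately have "bij_betw p X X" by simp
  then have "p permutes X" by (rule bij_imp_permutes) (use X in \<open>auto simp: p_def\<close>)
  then show ?thesis using that by (auto simp: p_def)
qed

section \<open>Covariances of pairs of occurrences, grouped by order type\<close>

context vincular_pattern
begin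

definition word_space :: "nat \<Rightarrow> nat \<Rightarrow> (nat \<Rightarrow> nat) set" where
  "word_space n M = PiE {1..n} (\<lambda>_. {1..M})"

lemma word_space_fin: "1 \<le> M \<Longrightarrow> finite (word_space n M)" "1 \<le> M \<Longrightarrow> word_space n M \<noteq> {}"
  unfolding word_space_def by (auto intro!: finite_PiE simp: PiE_eq_empty_iff)

definition pat_cov :: "nat \<Rightarrow> nat \<Rightarrow> (nat \<Rightarrow> nat) \<Rightarrow> (nat \<Rightarrow> nat) \<Rightarrow> real" where
  "pat_cov n M i j = avg (word_space n M) (\<lambda>V. of_bool (is_pat i V \<and> is_pat j V))
     - avg (word_space n M) (\<lambda>V. of_bool (is_pat i V)) * avg (word_space n M) (\<lambda>V. of_bool (is_pat j V))"

lemma var_cnt_eq: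
  assumes "1 \<le> M"
  shows "var (word_space n M) (cnt n) = (\<Sum>i\<in>occ n. \<Sum>j\<in>occ n. pat_cov n M i j)"
proof -
  have "avg (word_space n M) (\<lambda>V. (cnt n V)\<^sup>2) = (\<Sum>i\<in>occ n. \<Sum>j\<in>occ n. avg (word_space n M) (\<lambda>V. of_bool (is_pat i V \<and> is_pat j V)))"
    unfolding avg_sum[symmetric] by (intro avg_cong) (simp add: cnt_def power2_eq_square sum_product of_bool_conj)
  moreover have "(avg (word_space n M) (cnt n))\<^sup>2 = (\<Sum>i\<in>occ n. \<Sum>j\<in>occ n. avg (word_space n M) (\<lambda>V. of_bool (is_pat i V)) * avg (word_space n M) (\<lambda>V. of_bool (is_pat j V)))"
    unfolding cnt_def avg_sum by (simp add: power2_eq_square sum_product)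
  ultimately show ?thesis unfolding var_eq[OF word_space_fin[OF assms]] pat_cov_def by (simp add: sum_subtractf)
qed

lemma pat_cov_disjoint:
  assumes M: "1 \<le> M" and disj: "supp i \<inter> supp j = {}"
  shows "pat_cov n M i j = 0"
proof -
  have S: "finite {1..M}" "{1..M} \<noteq> {}" using M by auto
  have "avg (PiE {1..n} (\<lambda>_. {1..M})) (\<lambda>V. of_bool (is_pat i V) * of_bool (is_pat j V)) =
    avg (PiE {1..n} (\<lambda>_. {1..M})) (\<lambda>V. of_bool (is_pat i V)) * avg (PiE {1..n} (\<lambda>_. {1..M})) (\<lambda>V. of_bool (is_pat j V) :: real)"
  proof (rule avg_indep[OF S, where J = "supp i"])
    fix V W :: "nat \<Rightarrow> nat"
    show "of_bool (is_pat i V) = (of_bool (is_pat i W) :: real)" if "\<And>x. x \<in> supp i \<Longrightarrow> V x = W x"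
      using is_pat_cong[of i V W] that by simp
    show "of_bool (is_pat j V) = (of_bool (is_pat j W) :: real)" if "\<And>x. x \<notin> supp i \<Longrightarrow> V x = W x"
      using is_pat_cong[of j V W] that disj by auto
  qed
  then show ?thesis by (simp add: pat_cov_def word_space_def of_bool_conj)
qed

text \<open>Only comparisons between the two occurrences are recorded, since the order within each
  one is fixed. The possible types form a finite set that does not depend on n.\<close>

definition otype :: "(nat \<Rightarrow> nat) \<times> (nat \<Rightarrow> nat) \<Rightarrow> (nat \<times> nat) set \<times> (nat \<times> nat) set" where
  "otype z = ({(a,b) \<in> {1..k} \<times> {1..k}. fst z a = snd z b}, {(a,b) \<in> {1..k} \<times> {1..k}. fst z a < snd z b})"

definition of_otype :: "nat \<Rightarrow> (nat \<times> nat) set \<times> (nat \<times> nat) set \<Rightarrow> ((nat \<Rightarrow> nat) \<times> (nat \<Rightarrow> nat)) set" where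
  "of_otype n \<tau> = {z \<in> occ n \<times> occ n. otype z = \<tau>}"

lemma otypeD:
  assumes "otype (i, j) = otype (i0, j0)" "a \<in> {1..k}" "b \<in> {1..k}"
  shows "i a = j b \<longleftrightarrow> i0 a = j0 b" "i a < j b \<longleftrightarrow> i0 a < j0 b" "j b < i a \<longleftrightarrow> j0 b < i0 a"
proof -
  have "(a, b) \<in> fst (otype (i, j)) \<longleftrightarrow> (a, b) \<in> fst (otype (i0, j0))"
    "(a, b) \<in> snd (otype (i, j)) \<longleftrightarrow> (a, b) \<in> snd (otype (i0, j0))" using assms(1) by simp_all
  then have 1: "i a = j b \<longleftrightarrow> i0 a = j0 b" and 2: "i a < j b \<longleftrightarrow> i0 a < j0 b"
    using assms(2,3) by (simp_all add: otype_def)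
  show "i a = j b \<longleftrightarrow> i0 a = j0 b" by (rule 1)
  show "i a < j b \<longleftrightarrow> i0 a < j0 b" by (rule 2)
  show "j b < i a \<longleftrightarrow> j0 b < i0 a" using 1 2 by linarith
qed

lemma occ_pull_back:
  assumes i0: "i0 \<in> occ n0" and \<kappa>: "\<kappa> \<in> incr_maps K B n" and K: "supp i0 \<subseteq> K" "i0 ` A \<subseteq> B"
  shows "restrict (\<kappa> \<circ> i0) {1..k} \<in> occ n"
proof -
  have \<kappa>': "\<kappa> \<in> K \<rightarrow>\<^sub>E {1..n}" "strict_mono_on K \<kappa>" "\<forall>a\<in>B. \<kappa> (Suc a) = Suc (\<kappa> a)"
    using \<kappa> by (auto simp: incr_maps_def)
  have iK: "i0 a \<in> K" if "a \<in> {1..k}" for a using K(1) that by (auto simp: supp_def)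
  have "strict_mono_on {1..k} (restrict (\<kappa> \<circ> i0) {1..k})"
  proof (rule strict_mono_onI)
    fix a b assume ab: "a \<in> {1..k}" "b \<in> {1..k}" "a < b"
    then have "i0 a < i0 b" using strict_mono_onD[OF occ_mono[OF i0]] by blast
    then have "\<kappa> (i0 a) < \<kappa> (i0 b)" using strict_mono_onD[OF \<kappa>'(2)] iK ab by blast
    then show "restrict (\<kappa> \<circ> i0) {1..k} a < restrict (\<kappa> \<circ> i0) {1..k} b" using ab by simp
  qed
  moreover have "restrict (\<kappa> \<circ> i0) {1..k} \<in> {1..k} \<rightarrow>\<^sub>E {1..n}"
    using \<kappa>'(1) iK by (auto simp: PiE_iff)
  moreover have "restrict (\<kappa> \<circ> i0) {1..k} (Suc a) = Suc (restrict (\<kappa> \<circ> i0) {1..k} a)" if a: "a \<in> A" for a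
  proof -
    have "a \<in> {1..k}" "Suc a \<in> {1..k}" using a AK by auto
    moreover have "i0 (Suc a) = Suc (i0 a)" "i0 a \<in> B" using occ_adj[OF i0 a] K(2) a by auto
    ultimately show ?thesis using \<kappa>'(3) by simp
  qed
  ultimately show ?thesis by (simp add: occ_def incr_maps_def)
qed

text \<open>Pairs of occurrences with the order type of $(i_0, j_0)$ are the images of $(i_0, j_0)$ under increasing
  maps of the union of the supports that preserve its forced adjacencies.\<close>

lemma of_otype_param:
  assumes ij0: "i0 \<in> occ n0" "j0 \<in> occ n0"
  defines "K \<equiv> supp i0 \<union> supp j0" and "B \<equiv> i0 ` A \<union> j0 ` A"
  shows "bij_betw (\<lambda>\<kappa>. (restrict (\<kappa> \<circ> i0) {1..k}, restrict (\<kappa> \<circ> j0) {1..k})) (incr_maps K B n) (of_otype n (otype (i0, j0)))"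
    (is "bij_betw ?\<Psi> _ _")
  unfolding bij_betw_def
proof (intro conjI equalityI subsetI)
  have Kcases: "(\<exists>a\<in>{1..k}. x = i0 a) \<or> (\<exists>a\<in>{1..k}. x = j0 a)" if "x \<in> K" for x
    using that by (auto simp: K_def supp_def)
  have iK: "i0 a \<in> K" "j0 a \<in> K" if "a \<in> {1..k}" for a using that by (auto simp: K_def supp_def)
  show "inj_on ?\<Psi> (incr_maps K B n)"
  proof (rule inj_onI)
    fix \<kappa> \<mu> assume \<kappa>: "\<kappa> \<in> incr_maps K B n" and \<mu>: "\<mu> \<in> incr_maps K B n" and eq: "?\<Psi> \<kappa> = ?\<Psi> \<mu>"
    have e: "\<kappa> (i0 a) = \<mu> (i0 a)" "\<kappa> (j0 a) = \<mu> (j0 a)" if "a \<in> {1..k}" for a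
      using eq that by (auto simp: restrict_def fun_eq_iff split: if_splits)
    show "\<kappa> = \<mu>"
    proof (rule PiE_ext[of \<kappa> K "\<lambda>_. {1..n}"])
      fix x assume "x \<in> K"
      then show "\<kappa> x = \<mu> x" using Kcases e by blast
    qed (use \<kappa> \<mu> in \<open>auto simp: incr_maps_def\<close>)
  qed
  fix z assume "z \<in> ?\<Psi> ` incr_maps K B n"
  then obtain \<kappa> where \<kappa>: "\<kappa> \<in> incr_maps K B n" "z = ?\<Psi> \<kappa>" by auto
  have occ: "fst z \<in> occ n" "snd z \<in> occ n"
    unfolding \<kappa>(2) using occ_pull_back[OF _ \<kappa>(1)] ij0 by (auto simp: K_def B_def)
  have mono: "strict_mono_on K \<kappa>" using \<kappa>(1) by (simp add: incr_maps_def)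
  have "(\<kappa> (i0 a) = \<kappa> (j0 b)) = (i0 a = j0 b)" "(\<kappa> (i0 a) < \<kappa> (j0 b)) = (i0 a < j0 b)" if "a \<in> {1..k}" "b \<in> {1..k}" for a b
  proof -
    show l: "(\<kappa> (i0 a) < \<kappa> (j0 b)) = (i0 a < j0 b)"
      by (rule strict_mono_on_less[OF mono iK(1)[OF that(1)] iK(2)[OF that(2)]])
    have "(\<kappa> (j0 b) < \<kappa> (i0 a)) = (j0 b < i0 a)"
      by (rule strict_mono_on_less[OF mono iK(2)[OF that(2)] iK(1)[OF that(1)]])
    then show "(\<kappa> (i0 a) = \<kappa> (j0 b)) = (i0 a = j0 b)" using l by linarith
  qed
  then have "otype z = otype (i0, j0)" unfolding \<kappa>(2) otype_def by auto
  then show "z \<in> of_otype n (otype (i0, j0))" using occ by (auto simp: of_otype_def mem_Times_iff)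
next
  have Kcases: "(\<exists>a\<in>{1..k}. x = i0 a) \<or> (\<exists>a\<in>{1..k}. x = j0 a)" if "x \<in> K" for x
    using that by (auto simp: K_def supp_def)
  fix z assume z: "z \<in> of_otype n (otype (i0, j0))"
  obtain i j where zij: "z = (i, j)" by (cases z)
  have i: "i \<in> occ n" and j: "j \<in> occ n" and ty: "otype (i, j) = otype (i0, j0)"
    using z by (auto simp: of_otype_def zij)
  define \<kappa> where "\<kappa> = (\<lambda>x. if x \<in> supp i0 then i (inv_into {1..k} i0 x) else if x \<in> supp j0 then j (inv_into {1..k} j0 x) else undefined)"
  have \<kappa>i: "\<kappa> (i0 a) = i a" if "a \<in> {1..k}" for a
    using that occ_inj[OF ij0(1)] by (simp add: \<kappa>_def supp_def)
  have \<kappa>j: "\<kappa> (j0 b) = j b" if b: "b \<in> {1..k}" for b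
  proof (cases "j0 b \<in> supp i0")
    case True
    then obtain a where a: "a \<in> {1..k}" "i0 a = j0 b" by (auto simp: supp_def)
    then show ?thesis using \<kappa>i[OF a(1)] otypeD(1)[OF ty a(1) b] by simp
  next
    case False
    then show ?thesis using b occ_inj[OF ij0(2)] by (auto simp: \<kappa>_def supp_def)
  qed
  have mono: "strict_mono_on K \<kappa>"
  proof (rule strict_mono_onI)
    fix x y assume xy: "x \<in> K" "y \<in> K" "x < y"
    have lt: "a < b" if "h \<in> occ n0" "a \<in> {1..k}" "b \<in> {1..k}" "h a < h b" for h a b
      using that strict_mono_on_less[OF occ_mono[OF that(1)] that(2,3)] by simp
    have lt': "h a < h b" if "h \<in> occ n" "a \<in> {1..k}" "b \<in> {1..k}" "a < b" for h a b
      using that strict_mono_onD[OF occ_mono[OF that(1)] that(2,3)] by simp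
    consider a b where "a \<in> {1..k}" "b \<in> {1..k}" "x = i0 a" "y = i0 b"
      | a b where "a \<in> {1..k}" "b \<in> {1..k}" "x = j0 a" "y = j0 b"
      | a b where "a \<in> {1..k}" "b \<in> {1..k}" "x = i0 a" "y = j0 b"
      | a b where "a \<in> {1..k}" "b \<in> {1..k}" "x = j0 b" "y = i0 a"
      using Kcases[OF xy(1)] Kcases[OF xy(2)] by blast
    then show "\<kappa> x < \<kappa> y"
    proof cases
      case 1
      then show ?thesis using \<kappa>i lt[OF ij0(1) 1(1,2)] lt'[OF i 1(1,2)] xy(3) by simp
    next
      case 2
      then show ?thesis using \<kappa>j lt[OF ij0(2) 2(1,2)] lt'[OF j 2(1,2)] xy(3) by simp
    next
      case 3
      then show ?thesis using \<kappa>i \<kappa>j otypeD(2)[OF ty 3(1,2)] xy(3) by simp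
    next
      case 4
      then show ?thesis using \<kappa>i \<kappa>j otypeD(3)[OF ty 4(1,2)] xy(3) by simp
    qed
  qed
  have PiE: "\<kappa> \<in> K \<rightarrow>\<^sub>E {1..n}"
  proof (rule PiE_I)
    fix x assume "x \<in> K"
    then show "\<kappa> x \<in> {1..n}" using Kcases[of x] \<kappa>i \<kappa>j occ_mem[OF i] occ_mem[OF j] by metis
  qed (auto simp: \<kappa>_def K_def)
  have adj: "\<kappa> (Suc c) = Suc (\<kappa> c)" if "c \<in> B" for c
  proof -
    from that consider a where "a \<in> A" "c = i0 a" | a where "a \<in> A" "c = j0 a" by (auto simp: B_def)
    then show ?thesis
    proof cases
      case 1
      then have "a \<in> {1..k}" "Suc a \<in> {1..k}" using AK by auto
      then show ?thesis using occ_adj[OF ij0(1) 1(1)] occ_adj[OF i 1(1)] \<kappa>i 1 by metis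
    next
      case 2
      then have "a \<in> {1..k}" "Suc a \<in> {1..k}" using AK by auto
      then show ?thesis using occ_adj[OF ij0(2) 2(1)] occ_adj[OF j 2(1)] \<kappa>j 2 by metis
    qed
  qed
  have "\<kappa> \<in> incr_maps K B n" using mono PiE adj by (simp add: incr_maps_def)
  moreover have "?\<Psi> \<kappa> = z"
  proof -
    have "restrict (\<kappa> \<circ> i0) {1..k} = i"
      by (rule PiE_ext[of _ "{1..k}" "\<lambda>_. {1..n}"]) (use i occ_mem[OF i] \<kappa>i in \<open>auto simp: occ_def incr_maps_def\<close>)
    moreover have "restrict (\<kappa> \<circ> j0) {1..k} = j"
      by (rule PiE_ext[of _ "{1..k}" "\<lambda>_. {1..n}"]) (use j occ_mem[OF j] \<kappa>j in \<open>auto simp: occ_def incr_maps_def\<close>)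
    ultimately show ?thesis unfolding zij by simp
  qed
  ultimately show "z \<in> ?\<Psi> ` incr_maps K B n" by blast
qed

lemma card_of_otype:
  assumes ij0: "i0 \<in> occ n0" "j0 \<in> occ n0"
  shows "card (of_otype n (otype (i0, j0))) =
    (n - card (i0 ` A \<union> j0 ` A)) choose (card (supp i0 \<union> supp j0) - card (i0 ` A \<union> j0 ` A))"
proof -
  have "card (of_otype n (otype (i0, j0))) = card (incr_maps (supp i0 \<union> supp j0) (i0 ` A \<union> j0 ` A) n)"
    using bij_betw_same_card[OF of_otype_param[OF ij0]] by simp
  also have "\<dots> = (n - card (i0 ` A \<union> j0 ` A)) choose (card (supp i0 \<union> supp j0) - card (i0 ` A \<union> j0 ` A))"
  proof (rule card_incr_maps)
    show "i0 ` A \<union> j0 ` A \<subseteq> supp i0 \<union> supp j0" using AK by (auto simp: supp_def)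
    have "Suc (i0 a) \<in> supp i0" "Suc (j0 a) \<in> supp j0" if "a \<in> A" for a
      using occ_adj[OF ij0(1) that] occ_adj[OF ij0(2) that] AK that unfolding supp_def by (metis imageI subsetD)+
    then show "Suc ` (i0 ` A \<union> j0 ` A) \<subseteq> supp i0 \<union> supp j0" by auto
  qed (simp add: finite_supp)
  finally show ?thesis .
qed

text \<open>The increasing map carrying one pair to the other extends to a permutation of the
  positions, under which the uniform law on words is invariant; the letters beyond n0 are then
  averaged out. So for a given type the covariance depends on n only through the alphabet.\<close>

lemma pat_cov_of_otype:
  assumes ij0: "i0 \<in> occ n0" "j0 \<in> occ n0" and n: "n0 \<le> n" and z: "(i, j) \<in> of_otype n (otype (i0, j0))" and M: "1 \<le> M"
  shows "pat_cov n M i j = pat_cov n0 M i0 j0"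
proof -
  let ?K = "supp i0 \<union> supp j0"
  obtain \<kappa> where \<kappa>: "\<kappa> \<in> incr_maps ?K (i0 ` A \<union> j0 ` A) n" and ij: "i = restrict (\<kappa> \<circ> i0) {1..k}" "j = restrict (\<kappa> \<circ> j0) {1..k}"
  proof -
    have "(i, j) \<in> (\<lambda>\<kappa>. (restrict (\<kappa> \<circ> i0) {1..k}, restrict (\<kappa> \<circ> j0) {1..k})) ` incr_maps ?K (i0 ` A \<union> j0 ` A) n"
      unfolding bij_betw_imp_surj_on[OF of_otype_param[OF ij0]] by (rule z)
    then show ?thesis using that by blast
  qed
  have K: "?K \<subseteq> {1..n}" using supp_subset[OF ij0(1)] supp_subset[OF ij0(2)] n by fastforce
  have "inj_on \<kappa> ?K" using \<kappa> by (auto simp: incr_maps_def intro: strict_mono_on_imp_inj_on)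
  moreover have "\<kappa> ` ?K \<subseteq> {1..n}" using \<kappa> by (auto simp: incr_maps_def PiE_iff)
  ultimately obtain p where p: "p permutes {1..n}" "\<And>x. x \<in> ?K \<Longrightarrow> p x = \<kappa> x"
    using extend_inj_to_permutation[OF _ K] by (metis finite_atLeastAtMost)
  have pi: "i a = p (i0 a)" "j a = p (j0 a)" if "a \<in> {1..k}" for a
    using that p(2) by (auto simp: ij supp_def)
  have is1: "is_pat i V = is_pat i0 (V \<circ> p)" "is_pat j V = is_pat j0 (V \<circ> p)" for V
    using pi by (auto simp: is_pat_def)
  have av: "avg (word_space n M) (\<lambda>V. G (V \<circ> p)) = avg (word_space n0 M) G"
    if G: "\<And>V W. (\<And>x. x \<in> {1..n0} \<Longrightarrow> V x = W x) \<Longrightarrow> G V = G W" for G :: "(nat \<Rightarrow> nat) \<Rightarrow> real"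
  proof -
    have "avg (word_space n M) (\<lambda>V. G (V \<circ> p)) = avg (word_space n M) G"
      unfolding word_space_def by (rule avg_bij[OF PiE_compose_perm_bij[OF p(1)]])
    also have "\<dots> = avg (word_space n0 M) G" unfolding word_space_def
      by (rule avg_PiE_extend[OF _ _ G n]) (use M in auto)
    finally show ?thesis .
  qed
  have loc: "is_pat h V = is_pat h W" if "h \<in> occ n0" "\<And>x. x \<in> {1..n0} \<Longrightarrow> V x = W x" for h V W
    by (rule is_pat_cong, rule that(2)) (use supp_subset[OF that(1)] in blast)
  note loc = loc[OF ij0(1)] loc[OF ij0(2)]
  have "avg (word_space n M) (\<lambda>V. of_bool (is_pat i V \<and> is_pat j V)) = avg (word_space n0 M) (\<lambda>V. of_bool (is_pat i0 V \<and> is_pat j0 V) :: real)"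
    unfolding is1
  proof (rule av[of "\<lambda>V. of_bool (is_pat i0 V \<and> is_pat j0 V)"])
    fix V W :: "nat \<Rightarrow> nat" assume h: "\<And>x. x \<in> {1..n0} \<Longrightarrow> V x = W x"
    show "of_bool (is_pat i0 V \<and> is_pat j0 V) = (of_bool (is_pat i0 W \<and> is_pat j0 W) :: real)" using loc(1)[OF h] loc(2)[OF h] by simp
  qed
  moreover have "avg (word_space n M) (\<lambda>V. of_bool (is_pat i V)) = avg (word_space n0 M) (\<lambda>V. of_bool (is_pat i0 V) :: real)"
    unfolding is1
  proof (rule av[of "\<lambda>V. of_bool (is_pat i0 V)"])
    fix V W :: "nat \<Rightarrow> nat" assume h: "\<And>x. x \<in> {1..n0} \<Longrightarrow> V x = W x"
    show "of_bool (is_pat i0 V) = (of_bool (is_pat i0 W) :: real)" using loc(1)[OF h] by simp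
  qed
  moreover have "avg (word_space n M) (\<lambda>V. of_bool (is_pat j V)) = avg (word_space n0 M) (\<lambda>V. of_bool (is_pat j0 V) :: real)"
    unfolding is1
  proof (rule av[of "\<lambda>V. of_bool (is_pat j0 V)"])
    fix V W :: "nat \<Rightarrow> nat" assume h: "\<And>x. x \<in> {1..n0} \<Longrightarrow> V x = W x"
    show "of_bool (is_pat j0 V) = (of_bool (is_pat j0 W) :: real)" using loc(2)[OF h] by simp
  qed
  ultimately show ?thesis by (simp add: pat_cov_def)
qed

lemma is_pat_order_fun:
  assumes "i \<in> occ n" "\<forall>a\<in>{1..n}. \<forall>b\<in>{1..n}. V a < V b \<longleftrightarrow> W a < W b"
  shows "is_pat i V = is_pat i W"
  using assms(2) occ_mem[OF assms(1)] unfolding is_pat_def by blast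

text \<open>The limit is the average over uniform permutations: with n fixed and a growing alphabet,
  repeated letters become rare.\<close>

lemma convergent_avg_order_fun:
  fixes G :: "(nat \<Rightarrow> nat) \<Rightarrow> real"
  assumes G: "order_fun n G" "\<And>V. norm (G V) \<le> C" and M: "filterlim M at_top sequentially"
  shows "convergent (\<lambda>j. avg (word_space n (M j)) G)"
proof -
  have lim: "(\<lambda>j. 2 * C * (real n)\<^sup>2 / real (M j)) \<longlonglongrightarrow> 0"
    by (intro real_tendsto_divide_at_top[OF tendsto_const] filterlim_compose[OF filterlim_real_sequentially M])
  have "(\<lambda>j. avg (word_space n (M j)) G - avg (perms {1..n}) G) \<longlonglongrightarrow> 0"
  proof (rule tendsto_rabs_zero_cancel, rule tendsto_sandwich[OF _ _ tendsto_const lim])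
    have "eventually (\<lambda>j. 1 \<le> M j) sequentially" using M by (simp add: filterlim_at_top)
    then show "eventually (\<lambda>j. \<bar>avg (word_space n (M j)) G - avg (perms {1..n}) G\<bar> \<le> 2 * C * (real n)\<^sup>2 / real (M j)) sequentially"
      by eventually_elim (use avg_order_fun_transfer[OF G] in \<open>simp add: word_space_def\<close>)
  qed simp
  then have "(\<lambda>j. avg (word_space n (M j)) G) \<longlonglongrightarrow> avg (perms {1..n}) G" by (rule LIM_zero_cancel)
  then show ?thesis by (rule convergentI)
qed

lemma convergent_pat_cov:
  assumes "i \<in> occ n" "j \<in> occ n" and M: "filterlim M at_top sequentially"
  shows "convergent (\<lambda>l. pat_cov n (M l) i j)"
proof -
  have eq: "is_pat i V = is_pat i W" "is_pat j V = is_pat j W"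
    if "\<forall>a\<in>{1..n}. \<forall>b\<in>{1..n}. V a < V b \<longleftrightarrow> W a < W b" for V W
    using is_pat_order_fun[OF assms(1) that] is_pat_order_fun[OF assms(2) that] .
  have "order_fun n (\<lambda>V. of_bool (is_pat i V \<and> is_pat j V) :: real)"
    "order_fun n (\<lambda>V. of_bool (is_pat i V) :: real)" "order_fun n (\<lambda>V. of_bool (is_pat j V) :: real)"
    unfolding order_fun_def by (intro allI impI; frule eq(1); drule eq(2); simp)+
  then show ?thesis unfolding pat_cov_def
    by (intro convergent_diff convergent_mult convergent_avg_order_fun[where C = 1] M) auto
qed

definition meeting :: "nat \<Rightarrow> ((nat \<Rightarrow> nat) \<times> (nat \<Rightarrow> nat)) set" where
  "meeting n = {z \<in> occ n \<times> occ n. supp (fst z) \<inter> supp (snd z) \<noteq> {}}"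

text \<open>A shared point costs one of the 2m degrees of freedom of a pair; this is the order of
  the variance.\<close>

lemma card_meeting_le: "card (meeting n) \<le> k\<^sup>2 * n ^ (2 * m - 1)"
proof -
  have "meeting n = Sigma (occ n) (\<lambda>i. {j\<in>occ n. supp j \<inter> supp i \<noteq> {}})" by (auto simp: meeting_def)
  then have "card (meeting n) = (\<Sum>i\<in>occ n. card {j\<in>occ n. supp j \<inter> supp i \<noteq> {}})"
    by (simp add: card_SigmaI finite_occ)
  also have "\<dots> \<le> (\<Sum>i\<in>occ n. k * (k * n ^ (m - 1)))"
  proof (rule sum_mono)
    fix i assume i: "i \<in> occ n"
    show "card {j\<in>occ n. supp j \<inter> supp i \<noteq> {}} \<le> k * (k * n ^ (m - 1))"
      using card_occ_meets_le[OF finite_supp, of n i] card_supp[OF i] by simp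
  qed
  also have "\<dots> = card (occ n) * (k * (k * n ^ (m - 1)))" by simp
  also have "\<dots> \<le> n ^ m * (k * (k * n ^ (m - 1)))" by (intro mult_right_mono card_occ_le) simp
  also have "\<dots> = k\<^sup>2 * (n ^ m * n ^ (m - 1))" by (simp add: power2_eq_square)
  also have "n ^ m * n ^ (m - 1) = n ^ (2 * m - 1)"
  proof -
    have "m + (m - 1) = 2 * m - 1" using qk by simp
    then show ?thesis by (simp only: power_add[symmetric])
  qed
  finally show ?thesis .
qed

text \<open>Within one type all covariances are equal. A type with disjoint supports contributes
  nothing by independence; for any other type the number of pairs is a binomial coefficient bounded
  by the number of meeting pairs, so it converges after normalization.\<close>

lemma convergent_otype_sum:
  assumes M: "filterlim M at_top sequentially"
  shows "convergent (\<lambda>n. (\<Sum>z\<in>of_otype n \<tau>. pat_cov n (M n) (fst z) (snd z)) / real n ^ (2 * m - 1))"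
proof (cases "\<exists>n0 i0 j0. i0 \<in> occ n0 \<and> j0 \<in> occ n0 \<and> otype (i0, j0) = \<tau>")
  case False
  then have "of_otype n \<tau> = {}" for n by (force simp: of_otype_def)
  then show ?thesis by (simp add: convergent_const)
next
  case True
  then obtain n0 i0 j0 where ij0: "i0 \<in> occ n0" "j0 \<in> occ n0" and \<tau>: "\<tau> = otype (i0, j0)" by auto
  have M1: "eventually (\<lambda>n. 1 \<le> M n) sequentially" using M by (simp add: filterlim_at_top)
  have ev: "eventually (\<lambda>n. real (card (of_otype n \<tau>)) / real n ^ (2 * m - 1) * pat_cov n0 (M n) i0 j0 =
    (\<Sum>z\<in>of_otype n \<tau>. pat_cov n (M n) (fst z) (snd z)) / real n ^ (2 * m - 1)) sequentially"
    using M1 eventually_ge_at_top[of n0]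
  proof eventually_elim
    case (elim n)
    have "(\<Sum>z\<in>of_otype n \<tau>. pat_cov n (M n) (fst z) (snd z)) = (\<Sum>z\<in>of_otype n \<tau>. pat_cov n0 (M n) i0 j0)"
      using pat_cov_of_otype[OF ij0 elim(2) _ elim(1)] unfolding \<tau> by (intro sum.cong) auto
    then show ?case by simp
  qed
  have "convergent (\<lambda>n. real (card (of_otype n \<tau>)) / real n ^ (2 * m - 1) * pat_cov n0 (M n) i0 j0)"
  proof (cases "supp i0 \<inter> supp j0 = {}")
    case True
    have "eventually (\<lambda>n. 0 = real (card (of_otype n \<tau>)) / real n ^ (2 * m - 1) * pat_cov n0 (M n) i0 j0) sequentially"
      using M1 by eventually_elim (simp add: pat_cov_disjoint[OF _ True])
    then show ?thesis by (rule convergentI[OF Lim_transform_eventually[OF tendsto_const]])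
  next
    case False
    have "of_otype n \<tau> \<subseteq> meeting n" for n
    proof
      fix z assume z: "z \<in> of_otype n \<tau>"
      obtain a b where ab: "a \<in> {1..k}" "b \<in> {1..k}" "i0 a = j0 b" using False unfolding supp_def by blast
      have "fst z a = snd z b" using otypeD(1)[OF _ ab(1,2), of "fst z" "snd z" i0 j0] z ab(3) by (simp add: of_otype_def \<tau>)
      then have "supp (fst z) \<inter> supp (snd z) \<noteq> {}" using ab unfolding supp_def by blast
      then show "z \<in> meeting n" using z by (simp add: of_otype_def meeting_def)
    qed
    then have "card (of_otype n \<tau>) \<le> card (meeting n)" for n
      by (intro card_mono) (auto simp: meeting_def finite_occ)
    then have "card (of_otype n \<tau>) \<le> k\<^sup>2 * n ^ (2 * m - 1)" for n
      using card_meeting_le order_trans by blast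
    then have "real (card (of_otype n \<tau>)) \<le> real (k\<^sup>2) * real n ^ (2 * m - 1)" for n
      by (metis of_nat_le_iff of_nat_mult of_nat_power)
    then have "convergent (\<lambda>n. real (card (of_otype n \<tau>)) / real n ^ (2 * m - 1))"
      unfolding \<tau> card_of_otype[OF ij0] by (rule convergent_binomial_ratio)
    then show ?thesis by (intro convergent_mult convergent_pat_cov ij0 M)
  qed
  then show ?thesis unfolding convergent_def using Lim_transform_eventually[OF _ ev] by blast
qed

theorem convergent_var_cnt:
  assumes M: "filterlim M at_top sequentially"
  shows "convergent (\<lambda>n. var (word_space n (M n)) (cnt n) / real n ^ (2 * m - 1))"
proof -
  \<comment> \<open>All pairs of relations on \<open>{1..k}\<close>, realized or not. An unrealized
    type contributes an empty sum, and the index set stays the same for all n.\<close>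
  let ?T = "Pow ({1..k} \<times> {1..k}) \<times> Pow ({1..k} \<times> {1..k})"
  have M1: "eventually (\<lambda>n. 1 \<le> M n) sequentially" using M by (simp add: filterlim_at_top)
  have ev: "eventually (\<lambda>n. (\<Sum>\<tau>\<in>?T. (\<Sum>z\<in>of_otype n \<tau>. pat_cov n (M n) (fst z) (snd z)) / real n ^ (2 * m - 1)) =
    var (word_space n (M n)) (cnt n) / real n ^ (2 * m - 1)) sequentially"
    using M1
  proof eventually_elim
    case (elim n)
    have "(\<Sum>\<tau>\<in>?T. \<Sum>z\<in>of_otype n \<tau>. pat_cov n (M n) (fst z) (snd z)) = (\<Sum>z\<in>occ n \<times> occ n. pat_cov n (M n) (fst z) (snd z))"
      unfolding of_otype_def by (rule sum.group) (auto simp: finite_occ otype_def)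
    also have "\<dots> = var (word_space n (M n)) (cnt n)" unfolding var_cnt_eq[OF elim] by (simp add: sum.cartesian_product case_prod_unfold)
    finally show ?case by (simp only: sum_divide_distrib[symmetric])
  qed
  have "convergent (\<lambda>n. \<Sum>\<tau>\<in>?T. (\<Sum>z\<in>of_otype n \<tau>. pat_cov n (M n) (fst z) (snd z)) / real n ^ (2 * m - 1))"
    by (intro convergent_sum convergent_otype_sum M)
  then show ?thesis unfolding convergent_def using Lim_transform_eventually[OF _ ev] by blast
qed

end

section \<open>Positivity of the variance\<close>

context vincular_pattern
begin

lemma avg_le_T:
  assumes M: "1 \<le> M" "T \<le> M" and p: "p \<in> {1..n}"
  shows "avg (word_space n M) (\<lambda>V. of_bool (V p \<le> T)) = (real T / real M)"
proof -
  have S: "finite {1..M}" "{1..M} \<noteq> {}" using M by auto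
  have "avg (word_space n M) (\<lambda>V. of_bool (V p \<le> T)) = avg (word_space n M) (\<lambda>V. avg {1..M} (\<lambda>y. of_bool ((V(p := y)) p \<le> T)) :: real)"
    unfolding word_space_def by (rule avg_resample[OF S p])
  also have "\<dots> = avg (word_space n M) (\<lambda>V. real T / real M)"
  proof (rule avg_cong)
    fix V :: "nat \<Rightarrow> nat"
    have "{y \<in> {1..M}. y \<le> T} = {1..T}" using M by auto
    then show "avg {1..M} (\<lambda>y. of_bool ((V(p := y)) p \<le> T)) = real T / real M"
      by (simp add: avg_def sum_of_bool_eq Int_def)
  qed
  also have "\<dots> = real T / real M" by (rule avg_const[OF word_space_fin[OF M(1)]])
  finally show ?thesis .
qed

lemma avg_le_T2:
  assumes M: "1 \<le> M" "T \<le> M" and p: "p \<in> {1..n}" "r \<in> {1..n}" "p \<noteq> r"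
  shows "avg (word_space n M) (\<lambda>V. of_bool (V p \<le> T) * of_bool (V r \<le> T)) = (real T / real M)\<^sup>2"
proof -
  have S: "finite {1..M}" "{1..M} \<noteq> {}" using M by auto
  have "avg (word_space n M) (\<lambda>V. of_bool (V p \<le> T) * of_bool (V r \<le> T)) =
    avg (word_space n M) (\<lambda>V. of_bool (V p \<le> T)) * avg (word_space n M) (\<lambda>V. of_bool (V r \<le> T) :: real)"
    unfolding word_space_def by (rule avg_indep[OF S, where J = "{p}"]) (use p in auto)
  then show ?thesis using avg_le_T[OF M] p by (simp add: power2_eq_square)
qed

text \<open>The centring makes these variables orthogonal at distinct positions and removes the
  contribution of positions outside a support.\<close>

definition low :: "nat \<Rightarrow> nat \<Rightarrow> nat \<Rightarrow> (nat \<Rightarrow> nat) \<Rightarrow> real" where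
  "low M T p V = of_bool (V p \<le> T) - real T / real M"

lemma avg_low:
  assumes "1 \<le> M" "T \<le> M" "p \<in> {1..n}"
  shows "avg (word_space n M) (low M T p) = 0"
  unfolding low_def avg_diff avg_le_T[OF assms] avg_const[OF word_space_fin[OF assms(1)]] by simp

lemma abs_low_le: "T \<le> M \<Longrightarrow> \<bar>low M T p V\<bar> \<le> 1"
  by (cases "M = 0") (auto simp: low_def field_simps)

lemma low_cong: "V p = W p \<Longrightarrow> low M T p V = low M T p W"
  by (simp add: low_def)

lemma avg_sum_low_square:
  assumes M: "1 \<le> M" "T \<le> M" and P: "P \<le> n"
  shows "avg (word_space n M) (\<lambda>V. (\<Sum>p\<in>{1..P}. low M T p V)\<^sup>2) \<le> P"
proof -
  have S: "finite {1..M}" "{1..M} \<noteq> {}" using M by auto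
  have z: "avg (word_space n M) (\<lambda>V. low M T p V * low M T r V) = 0" if "p \<in> {1..P}" "r \<in> {1..P}" "p \<noteq> r" for p r
  proof -
    have "avg (word_space n M) (\<lambda>V. low M T p V * low M T r V) = avg (word_space n M) (low M T p) * avg (word_space n M) (low M T r)"
      unfolding word_space_def
    proof (rule avg_indep[OF S, where J = "{p}"])
      fix V W :: "nat \<Rightarrow> nat"
      show "low M T p V = low M T p W" if "\<And>i. i \<in> {p} \<Longrightarrow> V i = W i" by (rule low_cong, rule that) simp
      show "low M T r V = low M T r W" if "\<And>i. i \<notin> {p} \<Longrightarrow> V i = W i"
        by (rule low_cong, rule that) (use \<open>p \<noteq> r\<close> in simp)
    qed
    also have "avg (word_space n M) (low M T p) = 0" using that P by (intro avg_low M) auto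
    finally show ?thesis by simp
  qed
  have d: "avg (word_space n M) (\<lambda>V. low M T p V * low M T p V) \<le> 1" for p
  proof (rule avg_le_const)
    fix V
    have "\<bar>low M T p V * low M T p V\<bar> \<le> 1 * 1" by (rule abs_mult_le_square[OF abs_low_le abs_low_le]) (use M in auto)
    then show "low M T p V * low M T p V \<le> 1" by simp
  qed simp
  have "avg (word_space n M) (\<lambda>V. (\<Sum>p\<in>{1..P}. low M T p V)\<^sup>2) = (\<Sum>p\<in>{1..P}. \<Sum>r\<in>{1..P}. avg (word_space n M) (\<lambda>V. low M T p V * low M T r V))"
    unfolding avg_sum[symmetric] by (intro avg_cong) (simp add: power2_eq_square sum_product)
  also have "\<dots> \<le> (\<Sum>p\<in>{1..P}. \<Sum>r\<in>{1..P}. if r = p then 1 else 0)"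
  proof (intro sum_mono)
    fix p r assume "p \<in> {1..P}" "r \<in> {1..P}"
    then show "avg (word_space n M) (\<lambda>V. low M T p V * low M T r V) \<le> (if r = p then 1 else 0)"
      using z[of p r] d[of p] by (cases "r = p") auto
  qed
  also have "\<dots> = P" by simp
  finally show ?thesis .
qed

text \<open>H is constant on the rearrangements of the letters on the support, and exactly one of
  the k! rearrangements shows the pattern when these letters are distinct.\<close>

lemma sym_avg:
  assumes i: "i \<in> occ n" and M: "1 \<le> M" and H: "\<And>V \<theta>. \<theta> permutes supp i \<Longrightarrow> H (V \<circ> \<theta>) = (H V :: real)"
  shows "fact k * avg (word_space n M) (\<lambda>V. of_bool (is_pat i V) * H V) = avg (word_space n M) (\<lambda>V. of_bool (inj_on V (supp i)) * H V)"
proof -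
  have "avg (word_space n M) (\<lambda>V. of_bool (is_pat i V) * H V) = avg (word_space n M) (\<lambda>V. of_bool (is_pat i (V \<circ> \<theta>)) * H V)"
    if \<theta>: "\<theta> \<in> perms (supp i)" for \<theta>
  proof -
    have "\<theta> permutes {1..n}" using permutes_subset[OF _ supp_subset[OF i]] \<theta> by simp
    from avg_bij[OF PiE_compose_perm_bij[OF this], where f = "\<lambda>V. of_bool (is_pat i V) * H V" and S1 = "{1..M}"]
    show ?thesis unfolding word_space_def using H \<theta> by simp
  qed
  then have "(\<Sum>\<theta>\<in>perms (supp i). avg (word_space n M) (\<lambda>V. of_bool (is_pat i V) * H V)) =
    (\<Sum>\<theta>\<in>perms (supp i). avg (word_space n M) (\<lambda>V. of_bool (is_pat i (V \<circ> \<theta>)) * H V))"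
    by (rule sum.cong[OF refl])
  also have "\<dots> = avg (word_space n M) (\<lambda>V. \<Sum>\<theta>\<in>perms (supp i). of_bool (is_pat i (V \<circ> \<theta>)) * H V)"
    by (rule avg_sum[symmetric])
  also have "\<dots> = avg (word_space n M) (\<lambda>V. of_bool (inj_on V (supp i)) * H V)"
    by (rule avg_cong) (simp only: sum_distrib_right[symmetric] sum_perms_is_pat[OF i])
  finally show ?thesis by (simp add: card_permutations[OF card_supp[OF i] finite_supp])
qed

lemma avg_not_inj_supp_le:
  assumes i: "i \<in> occ n" and M: "1 \<le> M"
  shows "avg (word_space n M) (\<lambda>V. of_bool (\<not> inj_on V (supp i))) \<le> real k ^ 2 / real M"
proof -
  have S: "finite {1..M}" "{1..M} \<noteq> {}" using M by auto
  show ?thesis using avg_not_inj_le[OF S supp_subset[OF i]] card_supp[OF i] by (simp add: word_space_def)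
qed

lemma avg_is_pat_bounds:
  assumes i: "i \<in> occ n" and M: "1 \<le> M"
  shows "(1 - real k ^ 2 / real M) / fact k \<le> avg (word_space n M) (\<lambda>V. of_bool (is_pat i V))"
    and "avg (word_space n M) (\<lambda>V. of_bool (is_pat i V)) \<le> (1 / fact k :: real)"
proof -
  let ?h = "avg (word_space n M) (\<lambda>V. of_bool (\<not> inj_on V (supp i)) :: real)"
  have "avg (word_space n M) (\<lambda>V. of_bool (inj_on V (supp i)) :: real) = avg (word_space n M) (\<lambda>V. 1 - of_bool (\<not> inj_on V (supp i)))"
    by (rule avg_cong) simp
  also have "\<dots> = 1 - ?h" by (simp only: avg_diff avg_const[OF word_space_fin[OF M]])
  finally have "fact k * avg (word_space n M) (\<lambda>V. of_bool (is_pat i V)) = 1 - ?h"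
    using sym_avg[OF i M, of "\<lambda>_. 1"] by simp
  then have eq: "avg (word_space n M) (\<lambda>V. of_bool (is_pat i V)) = (1 - ?h) / fact k" by (simp add: eq_divide_eq mult.commute)
  show "(1 - real k ^ 2 / real M) / fact k \<le> avg (word_space n M) (\<lambda>V. of_bool (is_pat i V))"
    unfolding eq using avg_not_inj_supp_le[OF i M] by (intro divide_right_mono) auto
  have "0 \<le> ?h" by (rule avg_nonneg) simp
  then show "avg (word_space n M) (\<lambda>V. of_bool (is_pat i V)) \<le> (1 / fact k :: real)"
    unfolding eq by (intro divide_right_mono) auto
qed

text \<open>The covariance between showing the pattern at i and having a small letter in role a,
  that is, at the position where i places the a-th entry of the pattern.\<close>

definition low_bias :: "nat \<Rightarrow> nat \<Rightarrow> nat \<Rightarrow> (nat \<Rightarrow> nat) \<Rightarrow> nat \<Rightarrow> real" where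
  "low_bias n M T i a = avg (word_space n M) (\<lambda>V. of_bool (is_pat i V) * low M T (i a) V)"

lemma abs_low_bias_le: "T \<le> M \<Longrightarrow> \<bar>low_bias n M T i a\<bar> \<le> 1"
proof -
  assume T: "T \<le> M"
  have "norm (low_bias n M T i a) \<le> avg (word_space n M) (\<lambda>V. norm (of_bool (is_pat i V) * low M T (i a) V))"
    unfolding low_bias_def by (rule norm_avg_le)
  also have "\<dots> \<le> 1"
    by (rule avg_le_const) (use abs_low_le[OF T] in auto)
  finally show ?thesis by simp
qed

text \<open>If role a does not carry the value 1, the role that does has a still smaller letter. A
  small letter in role a then forces two small letters, of probability (T/M)^2, whereas independence
  would give about (T/M) / k!.\<close>

lemma low_bias_le:
  assumes i: "i \<in> occ n" and M: "1 \<le> M" "T \<le> M" and a: "a \<in> {1..k}" "v a \<noteq> 1"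
  shows "low_bias n M T i a \<le> (real T / real M)\<^sup>2 - real T / real M * ((1 - real k ^ 2 / real M) / fact k)"
proof -
  have "1 \<in> {1..k}" using k2 by auto
  then obtain c where c: "c \<in> {1..k}" "v c = 1" using permutes_image[OF v] by (metis imageE)
  have va: "v a \<in> {1..k}" using permutes_in_image[OF v] a by blast
  then have vca: "v c < v a" using a(2) c(2) by auto
  have ne: "i c \<noteq> i a" using occ_inj[OF i] a c by (metis inj_on_eq_iff)
  have "low_bias n M T i a = avg (word_space n M) (\<lambda>V. of_bool (is_pat i V) * of_bool (V (i a) \<le> T)) - real T / real M * avg (word_space n M) (\<lambda>V. of_bool (is_pat i V))"
    unfolding low_bias_def low_def avg_cmult[symmetric] avg_diff[symmetric] by (intro avg_cong) (simp add: algebra_simps)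
  also have "avg (word_space n M) (\<lambda>V. of_bool (is_pat i V) * of_bool (V (i a) \<le> T)) \<le> avg (word_space n M) (\<lambda>V. of_bool (V (i c) \<le> T) * of_bool (V (i a) \<le> T) :: real)"
  proof (rule avg_mono)
    fix V
    have "V (i c) < V (i a)" if "is_pat i V" using that c(1) a(1) vca unfolding is_pat_def by blast
    then show "of_bool (is_pat i V) * of_bool (V (i a) \<le> T) \<le> (of_bool (V (i c) \<le> T) * of_bool (V (i a) \<le> T) :: real)"
      by (cases "is_pat i V") auto
  qed
  also have "\<dots> = (real T / real M)\<^sup>2" using occ_mem[OF i] a c ne by (intro avg_le_T2 M) auto
  also have "(real T / real M)\<^sup>2 - real T / real M * avg (word_space n M) (\<lambda>V. of_bool (is_pat i V)) \<le>
    (real T / real M)\<^sup>2 - real T / real M * ((1 - real k ^ 2 / real M) / fact k)"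
    using avg_is_pat_bounds(1)[OF i M(1)] by (intro diff_left_mono mult_left_mono) auto
  finally show ?thesis by simp
qed

text \<open>Summed over all roles, the centred indicators form a symmetric function of the letters
  with mean zero. Weighting it by the pattern amounts, up to 1/k!, to weighting it by injectivity,
  so only words with a repeated letter contribute.\<close>

lemma abs_sum_low_bias_le:
  assumes i: "i \<in> occ n" and M: "1 \<le> M" "T \<le> M"
  shows "\<bar>\<Sum>a\<in>{1..k}. low_bias n M T i a\<bar> \<le> real k ^ 3 / real M / fact k"
proof -
  define Y where "Y = (\<lambda>V. \<Sum>x\<in>supp i. low M T x V)"
  have Ysym: "Y (V \<circ> \<theta>) = Y V" if "\<theta> permutes supp i" for V \<theta>
    unfolding Y_def low_def using sum.reindex_bij_betw[OF permutes_imp_bij[OF that], of "\<lambda>x. of_bool (V x \<le> T) - real T / real M"] by simp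
  have Yb: "\<bar>Y V\<bar> \<le> k" for V
  proof -
    have "\<bar>Y V\<bar> \<le> (\<Sum>x\<in>supp i. 1)" unfolding Y_def by (rule order_trans[OF sum_abs sum_mono[OF abs_low_le[OF M(2)]]])
    then show ?thesis by (simp add: card_supp[OF i])
  qed
  have "(\<Sum>a\<in>{1..k}. low_bias n M T i a) = avg (word_space n M) (\<lambda>V. of_bool (is_pat i V) * Y V)"
  proof -
    have "Y V = (\<Sum>a\<in>{1..k}. low M T (i a) V)" for V
      unfolding Y_def supp_def using sum.reindex[OF occ_inj[OF i]] by simp
    then show ?thesis unfolding low_bias_def avg_sum[symmetric] by (simp add: sum_distrib_left)
  qed
  then have 1: "fact k * (\<Sum>a\<in>{1..k}. low_bias n M T i a) = avg (word_space n M) (\<lambda>V. of_bool (inj_on V (supp i)) * Y V)"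
    using sym_avg[OF i M(1) Ysym] by simp
  have EY: "avg (word_space n M) Y = 0"
  proof -
    have "avg (word_space n M) Y = (\<Sum>x\<in>supp i. avg (word_space n M) (low M T x))" unfolding Y_def by (rule avg_sum)
    also have "\<dots> = 0" using supp_subset[OF i] by (intro sum.neutral ballI avg_low M) auto
    finally show ?thesis .
  qed
  have "avg (word_space n M) (\<lambda>V. of_bool (inj_on V (supp i)) * Y V) = avg (word_space n M) (\<lambda>V. Y V - of_bool (\<not> inj_on V (supp i)) * Y V)"
    by (rule avg_cong) simp
  also have "\<dots> = - avg (word_space n M) (\<lambda>V. of_bool (\<not> inj_on V (supp i)) * Y V)" by (simp add: avg_diff EY)
  finally have "\<bar>avg (word_space n M) (\<lambda>V. of_bool (inj_on V (supp i)) * Y V)\<bar> = norm (avg (word_space n M) (\<lambda>V. of_bool (\<not> inj_on V (supp i)) * Y V))"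
    by simp
  also have "\<dots> \<le> avg (word_space n M) (\<lambda>V. norm (of_bool (\<not> inj_on V (supp i)) * Y V))" by (rule norm_avg_le)
  also have "\<dots> \<le> avg (word_space n M) (\<lambda>V. of_bool (\<not> inj_on V (supp i)) * real k)"
    by (rule avg_mono) (use Yb in \<open>auto simp: abs_mult\<close>)
  also have "\<dots> = avg (word_space n M) (\<lambda>V. of_bool (\<not> inj_on V (supp i))) * k" by (rule avg_cmult2)
  also have "\<dots> \<le> (real k ^ 2 / real M) * k" by (intro mult_right_mono avg_not_inj_supp_le[OF i M(1)]) simp
  also have "\<dots> = real k ^ 3 / real M" by (simp add: power2_eq_square power3_eq_cube)
  finally have "fact k * \<bar>\<Sum>a\<in>{1..k}. low_bias n M T i a\<bar> \<le> real k ^ 3 / real M"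
    unfolding 1[symmetric] by (simp add: abs_mult)
  then show ?thesis by (subst pos_le_divide_eq) (simp_all add: mult.commute)
qed

lemma avg_cnt_low:
  assumes M: "1 \<le> M" "T \<le> M" and P: "P \<le> n"
  shows "avg (word_space n M) (\<lambda>V. cnt n V * (\<Sum>p\<in>{1..P}. low M T p V)) = (\<Sum>i\<in>occ n. \<Sum>a\<in>{a\<in>{1..k}. i a \<le> P}. low_bias n M T i a)"
proof -
  have S: "finite {1..M}" "{1..M} \<noteq> {}" using M by auto
  have "avg (word_space n M) (\<lambda>V. cnt n V * (\<Sum>p\<in>{1..P}. low M T p V)) =
    (\<Sum>i\<in>occ n. \<Sum>p\<in>{1..P}. avg (word_space n M) (\<lambda>V. of_bool (is_pat i V) * low M T p V))"
    unfolding avg_sum[symmetric] by (intro avg_cong) (simp add: cnt_def sum_product)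
  also have "\<dots> = (\<Sum>i\<in>occ n. \<Sum>a\<in>{a\<in>{1..k}. i a \<le> P}. low_bias n M T i a)"
  proof (rule sum.cong[OF refl])
    fix i assume i: "i \<in> occ n"
    have z: "avg (word_space n M) (\<lambda>V. of_bool (is_pat i V) * low M T p V) = 0" if "p \<in> {1..P}" "p \<notin> supp i" for p
    proof -
      have "avg (word_space n M) (\<lambda>V. of_bool (is_pat i V) * low M T p V) = avg (word_space n M) (\<lambda>V. of_bool (is_pat i V)) * avg (word_space n M) (low M T p)"
        unfolding word_space_def
      proof (rule avg_indep[OF S, where J = "supp i"])
        fix V W :: "nat \<Rightarrow> nat"
        show "of_bool (is_pat i V) = (of_bool (is_pat i W) :: real)" if "\<And>x. x \<in> supp i \<Longrightarrow> V x = W x"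
          using is_pat_cong[of i V W] that by simp
        show "low M T p V = low M T p W" if "\<And>x. x \<notin> supp i \<Longrightarrow> V x = W x"
          by (rule low_cong, rule that, fact)
      qed
      also have "avg (word_space n M) (low M T p) = 0" using that P by (intro avg_low M) auto
      finally show ?thesis by simp
    qed
    have img: "{1..P} \<inter> supp i = i ` {a\<in>{1..k}. i a \<le> P}" using occ_mem[OF i] by (auto simp: supp_def)
    have "(\<Sum>p\<in>{1..P}. avg (word_space n M) (\<lambda>V. of_bool (is_pat i V) * low M T p V)) =
      (\<Sum>p\<in>{1..P} \<inter> supp i. avg (word_space n M) (\<lambda>V. of_bool (is_pat i V) * low M T p V))"
      by (rule sum.mono_neutral_right) (use z in auto)
    also have "\<dots> = (\<Sum>a\<in>{a\<in>{1..k}. i a \<le> P}. low_bias n M T i a)"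
      unfolding img low_bias_def by (rule sum.reindex_cong[OF inj_on_subset[OF occ_inj[OF i]]]) auto
    finally show "(\<Sum>p\<in>{1..P}. avg (word_space n M) (\<lambda>V. of_bool (is_pat i V) * low M T p V)) = (\<Sum>a\<in>{a\<in>{1..k}. i a \<le> P}. low_bias n M T i a)" .
  qed
  finally show ?thesis .
qed

text \<open>Cauchy-Schwarz against the centred number of small letters among the first P positions,
  whose second moment is at most P \<le> n by orthogonality.\<close>

lemma var_cnt_ge:
  assumes M: "1 \<le> M" "T \<le> M" and P: "P \<le> n"
  shows "(\<Sum>i\<in>occ n. \<Sum>a\<in>{a\<in>{1..k}. i a \<le> P}. low_bias n M T i a)\<^sup>2 \<le> var (word_space n M) (cnt n) * n"
proof -
  let ?L = "\<lambda>V. \<Sum>p\<in>{1..P}. low M T p V"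
  have EL: "avg (word_space n M) ?L = 0"
  proof -
    have "avg (word_space n M) ?L = (\<Sum>p\<in>{1..P}. avg (word_space n M) (low M T p))" by (rule avg_sum)
    also have "\<dots> = 0" using P by (intro sum.neutral ballI avg_low M) auto
    finally show ?thesis .
  qed
  have "avg (word_space n M) (\<lambda>V. (cnt n V - avg (word_space n M) (cnt n)) * ?L V) =
     avg (word_space n M) (\<lambda>V. cnt n V * ?L V) - avg (word_space n M) (cnt n) * avg (word_space n M) ?L"
    unfolding left_diff_distrib by (simp only: avg_diff avg_cmult)
  then have "(\<Sum>i\<in>occ n. \<Sum>a\<in>{a\<in>{1..k}. i a \<le> P}. low_bias n M T i a) = avg (word_space n M) (\<lambda>V. (cnt n V - avg (word_space n M) (cnt n)) * ?L V)"
    using avg_cnt_low[OF M P] EL by simp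
  then have "(\<Sum>i\<in>occ n. \<Sum>a\<in>{a\<in>{1..k}. i a \<le> P}. low_bias n M T i a)\<^sup>2 \<le> var (word_space n M) (cnt n) * avg (word_space n M) (\<lambda>V. (?L V)\<^sup>2)"
    using avg_Cauchy_Schwarz[of "word_space n M" "\<lambda>V. cnt n V - avg (word_space n M) (cnt n)" ?L] by (simp add: var_def)
  also have "\<dots> \<le> var (word_space n M) (cnt n) * n"
    using avg_sum_low_square[OF M P] P by (intro mult_left_mono var_nonneg) linarith
  finally show ?thesis .
qed

text \<open>Shifting by P moves an occurrence that starts beyond P into 1, ..., n - P.\<close>

lemma card_occ_first_gt_le: "card {i\<in>occ n. P < i 1} \<le> card (occ (n - P))"
proof (rule card_inj_on_le[where f = "\<lambda>i. restrict (\<lambda>a. i a - P) {1..k}"])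
  have gt: "P < i a" if "i \<in> occ n" "P < i 1" "a \<in> {1..k}" for i a
  proof -
    have "i 1 \<le> i a" using strict_mono_on_leD[OF occ_mono[OF that(1)], of 1 a] that(3) by auto
    then show ?thesis using that(2) by simp
  qed
  show "inj_on (\<lambda>i. restrict (\<lambda>a. i a - P) {1..k}) {i\<in>occ n. P < i 1}"
  proof (rule inj_onI)
    fix i j assume i: "i \<in> {i\<in>occ n. P < i 1}" and j: "j \<in> {i\<in>occ n. P < i 1}"
      and eq: "restrict (\<lambda>a. i a - P) {1..k} = restrict (\<lambda>a. j a - P) {1..k}"
    show "i = j"
    proof (rule PiE_ext[of i "{1..k}" "\<lambda>_. {1..n}"])
      fix a assume a: "a \<in> {1..k}"
      have "i a - P = j a - P" using fun_cong[OF eq, of a] a by simp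
      then show "i a = j a" using gt[of i a] gt[of j a] i j a by auto
    qed (use i j in \<open>auto simp: occ_def incr_maps_def\<close>)
  qed
  show "(\<lambda>i. restrict (\<lambda>a. i a - P) {1..k}) ` {i\<in>occ n. P < i 1} \<subseteq> occ (n - P)"
  proof
    fix h assume "h \<in> (\<lambda>i. restrict (\<lambda>a. i a - P) {1..k}) ` {i\<in>occ n. P < i 1}"
    then obtain i where i: "i \<in> occ n" "P < i 1" "h = restrict (\<lambda>a. i a - P) {1..k}" by auto
    note g = gt[OF i(1,2)]
    have "h \<in> {1..k} \<rightarrow>\<^sub>E {1..n - P}"
    proof (rule PiE_I)
      fix a assume a: "a \<in> {1..k}"
      show "h a \<in> {1..n - P}" using g[OF a] occ_mem[OF i(1) a] a by (auto simp: i(3))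
    qed (simp add: i(3) del: atLeastAtMost_iff)
    moreover have "strict_mono_on {1..k} h"
    proof (rule strict_mono_onI)
      fix a b assume ab: "a \<in> {1..k}" "b \<in> {1..k}" "a < b"
      then have "i a < i b" using strict_mono_onD[OF occ_mono[OF i(1)]] by blast
      then show "h a < h b" using ab g[OF ab(1)] by (simp add: i(3) diff_less_mono)
    qed
    moreover have "h (Suc a) = Suc (h a)" if a: "a \<in> A" for a
    proof -
      have "a \<in> {1..k}" "Suc a \<in> {1..k}" using a AK by auto
      then show ?thesis using occ_adj[OF i(1) a] g[of a] by (auto simp: i(3))
    qed
    ultimately show "h \<in> occ (n - P)" by (simp add: occ_def incr_maps_def)
  qed
qed (rule finite_occ)

text \<open>Complementary counting: at most n^(m-1) (n - P) / m! occurrences start beyond P. The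
  resulting lower bound is asymptotically linear in P / n, to be set against an error quadratic in P
  / n.\<close>

lemma card_occ_first_le_ge:
  assumes "P \<le> n" "1 \<le> n"
  shows "real ((n - q) choose m) / real n ^ m - (1 - real P / real n) / fact m \<le> real (card {i\<in>occ n. i 1 \<le> P}) / real n ^ m"
proof -
  have "m \<noteq> 0" using qk by auto
  then obtain m' where m': "m = Suc m'" using not0_implies_Suc by blast
  have "occ n = {i\<in>occ n. i 1 \<le> P} \<union> {i\<in>occ n. P < i 1}" by auto
  then have "card (occ n) \<le> card {i\<in>occ n. i 1 \<le> P} + card {i\<in>occ n. P < i 1}"
    using card_Un_le[of "{i\<in>occ n. i 1 \<le> P}" "{i\<in>occ n. P < i 1}"] by presburger
  also have "\<dots> \<le> card {i\<in>occ n. i 1 \<le> P} + ((n - P - q) choose m)"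
    using card_occ_first_gt_le[of n P] card_occ[of "n - P"] by simp
  finally have 1: "real ((n - q) choose m) \<le> real (card {i\<in>occ n. i 1 \<le> P}) + real ((n - P - q) choose m)"
    unfolding card_occ by linarith
  have "fact m * ((n - P - q) choose m) \<le> (n - P - q) ^ m" using binomial_fact_pow[of "n - P - q" m] by (simp add: mult.commute)
  also have "\<dots> \<le> (n - P) ^ m" by (rule power_mono) auto
  also have "\<dots> \<le> n ^ m' * (n - P)" unfolding m' by (simp add: power_mono mult.commute)
  finally have "real (fact m * ((n - P - q) choose m)) \<le> real (n ^ m' * (n - P))" by (rule of_nat_mono)
  then have "real ((n - P - q) choose m) \<le> real n ^ m' * (real n - real P) / fact m"
    using assms by (simp add: pos_le_divide_eq mult.commute of_nat_diff)
  also have "\<dots> = real n ^ m * ((1 - real P / real n) / fact m)"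
  proof -
    have "real n ^ m * (1 - real P / real n) = real n ^ m' * (real n - real P)"
      using assms by (simp add: m' right_diff_distrib)
    then show ?thesis by (simp only: times_divide_eq_right)
  qed
  finally have "real ((n - q) choose m) \<le> real (card {i\<in>occ n. i 1 \<le> P}) + real n ^ m * ((1 - real P / real n) / fact m)"
    using 1 by linarith
  then have "real ((n - q) choose m) / real n ^ m \<le> (real (card {i\<in>occ n. i 1 \<le> P}) + real n ^ m * ((1 - real P / real n) / fact m)) / real n ^ m"
    by (rule divide_right_mono) simp
  also have "\<dots> = real (card {i\<in>occ n. i 1 \<le> P}) / real n ^ m + (1 - real P / real n) / fact m"
    using assms by (simp add: add_divide_distrib)
  finally show ?thesis by linarith
qed

text \<open>A role of value at least 2 is negatively correlated with being small, since then two letters are small.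
  All roles together are almost uncorrelated with it, so the sign for the first block is decided by whether
  the block contains the value 1. The alphabet is chosen so that a letter is small with probability $1/(8\,k!)$.\<close>

lemma block_sum_sign:
  assumes b: "b \<in> starts" "2 \<le> b"
    and M: "M = 8 * fact k * T" "64 * fact k * k ^ 3 \<le> M"
  defines "\<delta> \<equiv> 1 / (64 * (fact k)\<^sup>2)"
  obtains \<epsilon> :: real where "\<bar>\<epsilon>\<bar> = 1" "\<And>i n. i \<in> occ n \<Longrightarrow> \<delta> \<le> \<epsilon> * (\<Sum>a\<in>{1..<b}. low_bias n M T i a)"
proof -
  have bk: "b \<le> k" using b by (auto simp: starts_def)
  have k0: "0 < real k ^ 3" using k2 by simp
  have f0: "0 < (fact k :: real)" by simp
  have f1: "1 \<le> (fact k :: real)" by (rule fact_ge_1)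
  have "0 < 64 * fact k * k ^ 3" using k2 by simp
  then have M1: "1 \<le> M" using M(2) by linarith
  have TM: "T \<le> M" and T1: "0 < T" using M(1) M1 by (auto simp: fact_ge_1 intro: Nat.gr0I)
  have t: "real T / real M = 1 / (8 * fact k)" using T1 by (simp add: M(1))
  have Mr: "64 * fact k * real k ^ 3 \<le> real M" 
  proof -
    have "real (64 * fact k * k ^ 3) \<le> real M" using M(2) by (rule of_nat_mono)
    then show ?thesis by simp
  qed
  have kM: "real k ^ 2 / real M \<le> 1 / 2"
  proof -
    have "2 * real k ^ 2 \<le> 64 * fact k * real k ^ 3"
    proof (intro mult_mono power_increasing)
      show "2 \<le> 64 * (fact k :: real)" using f1 by linarith
    qed (use k2 in auto)
    then have "2 * real k ^ 2 \<le> real M" using Mr by linarith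
    then show ?thesis using M1 by (simp add: field_simps)
  qed
  have \<delta>0: "0 < \<delta>" by (simp add: \<delta>_def)
  have neg: "low_bias n M T i a \<le> - 2 * \<delta>" if "i \<in> occ n" "a \<in> {1..k}" "v a \<noteq> 1" for n i a
  proof -
    have "low_bias n M T i a \<le> (1 / (8 * fact k))\<^sup>2 - 1 / (8 * fact k) * ((1 - real k ^ 2 / real M) / fact k)"
      using low_bias_le[OF that(1) M1 TM that(2,3)] unfolding t .
    also have "\<dots> \<le> (1 / (8 * fact k))\<^sup>2 - 1 / (8 * fact k) * ((1 / 2) / fact k)"
      using kM by (intro diff_left_mono mult_left_mono divide_right_mono) auto
    \<comment> \<open>In units of \<delta> the two terms are 1 and 4.\<close>
    also have "\<dots> = - 3 * \<delta>" by (simp add: \<delta>_def power2_eq_square field_simps)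
    also have "\<dots> \<le> - 2 * \<delta>" using \<delta>0 by simp
    finally show ?thesis .
  qed
  have tot: "\<bar>\<Sum>a\<in>{1..k}. low_bias n M T i a\<bar> \<le> \<delta>" if "i \<in> occ n" for n i
  proof -
    have "real k ^ 3 / real M \<le> 1 / (64 * fact k)"
      using Mr M1 by (simp add: field_simps)
    then have "real k ^ 3 / real M / fact k \<le> 1 / (64 * fact k) / fact k"
      by (rule divide_right_mono) simp
    then show ?thesis using abs_sum_low_bias_le[OF that M1 TM] by (simp add: \<delta>_def power2_eq_square)
  qed
  show ?thesis
  proof (cases "\<exists>c\<in>{1..<b}. v c = 1")
    case False
    have "\<delta> \<le> (-1) * (\<Sum>a\<in>{1..<b}. low_bias n M T i a)" if i: "i \<in> occ n" for i n
    proof -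
      have "(\<Sum>a\<in>{1..<b}. low_bias n M T i a) \<le> (\<Sum>a\<in>{1..<b}. - 2 * \<delta>)"
        by (rule sum_mono, rule neg[OF i]) (use False bk in auto)
      also have "\<dots> = real (b - 1) * (- 2 * \<delta>)" by simp
      also have "\<dots> \<le> 1 * (- 2 * \<delta>)" using b \<delta>0 by (intro mult_right_mono_neg) auto
      finally show ?thesis using \<delta>0 by simp
    qed
    then show ?thesis using that[of "-1"] by simp
  next
    case True
    then obtain c where c: "c \<in> {1..<b}" "v c = 1" by auto
    have "\<delta> \<le> 1 * (\<Sum>a\<in>{1..<b}. low_bias n M T i a)" if i: "i \<in> occ n" for i n
    proof -
      \<comment> \<open>The value 1 sits in the first block, so the later roles together have bias
        at most -2\<delta>. The total is at least -\<delta>, which leaves at least \<delta> for the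
        first block.\<close>
      have va: "v a \<noteq> 1" if "a \<in> {b..k}" for a
        using that c permutes_inj[OF v] by (metis atLeastAtMost_iff atLeastLessThan_iff injD leD)
      have "(\<Sum>a\<in>{b..k}. low_bias n M T i a) \<le> (\<Sum>a\<in>{b..k}. - 2 * \<delta>)"
        by (rule sum_mono, rule neg[OF i]) (use va b in auto)
      also have "\<dots> = real (Suc k - b) * (- 2 * \<delta>)" by simp
      also have "\<dots> \<le> 1 * (- 2 * \<delta>)" using bk \<delta>0 by (intro mult_right_mono_neg) auto
      finally have 1: "(\<Sum>a\<in>{b..k}. low_bias n M T i a) \<le> - 2 * \<delta>" by simp
      have "{1..k} = {1..<b} \<union> {b..k}" using b bk by auto
      then have "(\<Sum>a\<in>{1..k}. low_bias n M T i a) = (\<Sum>a\<in>{1..<b}. low_bias n M T i a) + (\<Sum>a\<in>{b..k}. low_bias n M T i a)"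
        by (simp add: sum.union_disjoint ivl_disj_int)
      then show ?thesis using 1 tot[OF i] by linarith
    qed
    then show ?thesis using that[of 1] by simp
  qed
qed

text \<open>For a typical occurrence starting by P, the roles placed up to P are exactly those of
  the first block, whose bias has a fixed sign. The exceptions are occurrences whose second block
  also starts by P, at most P^2 n^(m-2), and those starting within distance k of P, at most k
  n^(m-1). Each exception costs at most k.\<close>

lemma abs_sum_low_bias_ge:
  assumes b: "b \<in> starts" "2 \<le> b" and blk: "\<And>n i j. i \<in> occ n \<Longrightarrow> j \<in> {1..<b} \<Longrightarrow> i j = i 1 + (j - 1)"
    and M: "M = 8 * fact k * T" "64 * fact k * k ^ 3 \<le> M" and P: "P \<le> n"
  defines "\<delta> \<equiv> 1 / (64 * (fact k)\<^sup>2)"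
  shows "\<delta> * real (card {i\<in>occ n. i 1 \<le> P}) - real k * real P ^ 2 * real n ^ (m - 2) - real k ^ 2 * real n ^ (m - 1)
    \<le> \<bar>\<Sum>i\<in>occ n. \<Sum>a\<in>{a\<in>{1..k}. i a \<le> P}. low_bias n M T i a\<bar>"
proof -
  obtain \<epsilon> :: real where \<epsilon>: "\<bar>\<epsilon>\<bar> = 1" "\<And>i n. i \<in> occ n \<Longrightarrow> \<delta> \<le> \<epsilon> * (\<Sum>a\<in>{1..<b}. low_bias n M T i a)"
    using block_sum_sign[OF b M] unfolding \<delta>_def by blast
  have bk: "b \<le> k" using b by (auto simp: starts_def)
  have TM: "T \<le> M" unfolding M(1) using fact_ge_1[of k, where 'a=nat] by simp
  have le1: "i 1 \<le> i a" "b \<le> a \<Longrightarrow> i b \<le> i a" if "i \<in> occ n" "a \<in> {1..k}" for i a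
    using strict_mono_on_leD[OF occ_mono[OF that(1)], of 1 a] strict_mono_on_leD[OF occ_mono[OF that(1)], of b a] that(2) b bk by auto
  have abs\<epsilon>: "\<bar>\<epsilon> * s\<bar> = \<bar>s\<bar>" for s using \<epsilon>(1) by (simp add: abs_mult)
  have card_sum: "\<bar>\<Sum>a\<in>Y. low_bias n M T i a\<bar> \<le> k" if "Y \<subseteq> {1..k}" for Y i
  proof -
    have "\<bar>\<Sum>a\<in>Y. low_bias n M T i a\<bar> \<le> (\<Sum>a\<in>Y. 1)" by (rule order_trans[OF sum_abs sum_mono[OF abs_low_bias_le[OF TM]]])
    also have "\<dots> = card Y" by simp
    also have "\<dots> \<le> k" using card_mono[OF _ that] by simp
    finally show ?thesis .
  qed
  have tm: "\<delta> * of_bool (i 1 \<le> P) - real k * of_bool (i 1 \<le> P \<and> i b \<le> P) - real k * of_bool (P < i 1 + k \<and> i 1 \<le> P)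
    \<le> \<epsilon> * (\<Sum>a\<in>{a\<in>{1..k}. i a \<le> P}. low_bias n M T i a)" if i: "i \<in> occ n" for i
  proof (cases "i 1 \<le> P")
    case False
    then have "{a\<in>{1..k}. i a \<le> P} = {}" using le1(1)[OF i] by fastforce
    then show ?thesis using False by (simp only:) simp
  next
    case True
    let ?Y = "{a\<in>{1..k}. i a \<le> P}"
    have split: "?Y = {a\<in>{1..<b}. i a \<le> P} \<union> {a\<in>{b..k}. i a \<le> P}" using b bk by auto
    have s1: "(\<Sum>a\<in>?Y. low_bias n M T i a) = (\<Sum>a\<in>{a\<in>{1..<b}. i a \<le> P}. low_bias n M T i a) + (\<Sum>a\<in>{a\<in>{b..k}. i a \<le> P}. low_bias n M T i a)"
      unfolding split by (rule sum.union_disjoint) auto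
    have "(\<Sum>a\<in>{a\<in>{1..<b}. i a \<le> P} \<union> {a\<in>{1..<b}. P < i a}. low_bias n M T i a) =
      (\<Sum>a\<in>{a\<in>{1..<b}. i a \<le> P}. low_bias n M T i a) + (\<Sum>a\<in>{a\<in>{1..<b}. P < i a}. low_bias n M T i a)"
      by (rule sum.union_disjoint) auto
    moreover have "{a\<in>{1..<b}. i a \<le> P} \<union> {a\<in>{1..<b}. P < i a} = {1..<b}" by auto
    ultimately have s2: "(\<Sum>a\<in>{1..<b}. low_bias n M T i a) = (\<Sum>a\<in>{a\<in>{1..<b}. i a \<le> P}. low_bias n M T i a) + (\<Sum>a\<in>{a\<in>{1..<b}. P < i a}. low_bias n M T i a)"
      by (simp only:)
    have r1: "\<bar>\<Sum>a\<in>{a\<in>{b..k}. i a \<le> P}. low_bias n M T i a\<bar> \<le> real k * of_bool (i 1 \<le> P \<and> i b \<le> P)"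
    proof (cases "i b \<le> P")
      case bP: True
      have "\<bar>\<Sum>a\<in>{a\<in>{b..k}. i a \<le> P}. low_bias n M T i a\<bar> \<le> k" by (rule card_sum) (use b in auto)
      then show ?thesis using True bP by simp
    next
      case False
      have "\<not> i a \<le> P" if "a \<in> {b..k}" for a using le1(2)[OF i, of a] that b False by auto
      then have "{a\<in>{b..k}. i a \<le> P} = {}" by auto
      then show ?thesis by (simp only:) simp
    qed
    have r2: "\<bar>\<Sum>a\<in>{a\<in>{1..<b}. P < i a}. low_bias n M T i a\<bar> \<le> real k * of_bool (P < i 1 + k \<and> i 1 \<le> P)"
    proof (cases "P < i 1 + k")
      case pk: True
      have "\<bar>\<Sum>a\<in>{a\<in>{1..<b}. P < i a}. low_bias n M T i a\<bar> \<le> k" by (rule card_sum) (use bk in auto)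
      then show ?thesis using True pk by simp
    next
      case False
      have "\<not> P < i a" if "a \<in> {1..<b}" for a using blk[OF i that] that bk False by auto
      then have "{a\<in>{1..<b}. P < i a} = {}" by auto
      then show ?thesis by (simp only:) simp
    qed
    have "\<epsilon> * (\<Sum>a\<in>?Y. low_bias n M T i a) = \<epsilon> * (\<Sum>a\<in>{1..<b}. low_bias n M T i a) - \<epsilon> * (\<Sum>a\<in>{a\<in>{1..<b}. P < i a}. low_bias n M T i a)
       + \<epsilon> * (\<Sum>a\<in>{a\<in>{b..k}. i a \<le> P}. low_bias n M T i a)"
      unfolding s1 s2 by (simp add: algebra_simps)
    moreover have "\<delta> * of_bool (i 1 \<le> P) = \<delta>" using True by simp
    ultimately show ?thesis
      using \<epsilon>(2)[OF i] r1 r2 abs\<epsilon>[of "\<Sum>a\<in>{a\<in>{1..<b}. P < i a}. low_bias n M T i a"]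
        abs\<epsilon>[of "\<Sum>a\<in>{a\<in>{b..k}. i a \<le> P}. low_bias n M T i a"] by linarith
  qed
  have c1: "(\<Sum>i\<in>occ n. of_bool (i 1 \<le> P) :: real) = card {i\<in>occ n. i 1 \<le> P}"
    using finite_occ by (simp add: sum_of_bool_eq Int_def)
  have c2: "(\<Sum>i\<in>occ n. of_bool (i 1 \<le> P \<and> i b \<le> P) :: real) \<le> real P ^ 2 * real n ^ (m - 2)"
  proof -
    have "(\<Sum>i\<in>occ n. of_bool (i 1 \<le> P \<and> i b \<le> P) :: real) = real (card {i\<in>occ n. i 1 \<le> P \<and> i b \<le> P})"
      using finite_occ by (subst sum_of_bool_eq) (simp_all add: Int_def)
    also have "\<dots> \<le> real (P\<^sup>2 * n ^ (m - 2))" using card_occ_two_le[OF b] by (rule of_nat_mono)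
    finally show ?thesis by simp
  qed
  have c3: "(\<Sum>i\<in>occ n. of_bool (P < i 1 + k \<and> i 1 \<le> P) :: real) \<le> real k * real n ^ (m - 1)"
  proof -
    have "card {i\<in>occ n. P < i 1 + k \<and> i 1 \<le> P} \<le> card (\<Union>x\<in>{P + 1 - k..P}. {i\<in>occ n. i 1 = x})"
      by (rule card_mono) (auto simp: finite_occ)
    also have "\<dots> \<le> (\<Sum>x\<in>{P + 1 - k..P}. card {i\<in>occ n. i 1 = x})" by (rule card_UN_le) simp
    also have "\<dots> \<le> (\<Sum>x\<in>{P + 1 - k..P}. n ^ (m - 1))"
      by (rule sum_mono, rule card_occ_at_le) (use k2 in simp)
    also have "\<dots> = card {P + 1 - k..P} * n ^ (m - 1)" by simp
    also have "\<dots> \<le> k * n ^ (m - 1)"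
    proof (rule mult_right_mono)
      show "card {P + 1 - k..P} \<le> k" unfolding card_atLeastAtMost by linarith
    qed simp
    finally have "real (card {i\<in>occ n. P < i 1 + k \<and> i 1 \<le> P}) \<le> real (k * n ^ (m - 1))" by (rule of_nat_mono)
    moreover have "(\<Sum>i\<in>occ n. of_bool (P < i 1 + k \<and> i 1 \<le> P) :: real) = real (card {i\<in>occ n. P < i 1 + k \<and> i 1 \<le> P})"
      using finite_occ by (subst sum_of_bool_eq) (simp_all add: Int_def)
    ultimately show ?thesis by simp
  qed
  have "\<delta> * real (card {i\<in>occ n. i 1 \<le> P}) - real k * (real P ^ 2 * real n ^ (m - 2)) - real k * (real k * real n ^ (m - 1))
    \<le> \<delta> * (\<Sum>i\<in>occ n. of_bool (i 1 \<le> P)) - real k * (\<Sum>i\<in>occ n. of_bool (i 1 \<le> P \<and> i b \<le> P)) - real k * (\<Sum>i\<in>occ n. of_bool (P < i 1 + k \<and> i 1 \<le> P))"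
    unfolding c1 using mult_left_mono[OF c2, of "real k"] mult_left_mono[OF c3, of "real k"] by simp
  also have "\<dots> = (\<Sum>i\<in>occ n. \<delta> * of_bool (i 1 \<le> P) - real k * of_bool (i 1 \<le> P \<and> i b \<le> P) - real k * of_bool (P < i 1 + k \<and> i 1 \<le> P))"
    by (simp only: sum_subtractf sum_distrib_left)
  also have "\<dots> \<le> (\<Sum>i\<in>occ n. \<epsilon> * (\<Sum>a\<in>{a\<in>{1..k}. i a \<le> P}. low_bias n M T i a))" by (rule sum_mono[OF tm])
  also have "\<dots> = \<epsilon> * (\<Sum>i\<in>occ n. \<Sum>a\<in>{a\<in>{1..k}. i a \<le> P}. low_bias n M T i a)" by (simp only: sum_distrib_left)
  also have "\<dots> \<le> \<bar>\<Sum>i\<in>occ n. \<Sum>a\<in>{a\<in>{1..k}. i a \<le> P}. low_bias n M T i a\<bar>" by (rule order_trans[OF abs_ge_self eq_refl[OF abs\<epsilon>]])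
  finally show ?thesis by (simp add: power2_eq_square mult.assoc)
qed

lemma tendsto_div_ratio:
  assumes "0 < Q"
  shows "(\<lambda>n. real (n div Q) / real n) \<longlonglongrightarrow> 1 / real Q"
proof (rule tendsto_sandwich)
  show "(\<lambda>n. (real n / real Q - 1) / real n) \<longlonglongrightarrow> 1 / real Q"
  proof -
    have "(\<lambda>n. (real n / real Q - 1) / real n) \<longlonglongrightarrow> inverse (real Q)" using assms by real_asymp
    then show ?thesis by (simp add: inverse_eq_divide)
  qed
  have eq: "real (n div Q) = of_int \<lfloor>real n / real Q\<rfloor>" for n
    by (simp add: floor_divide_of_nat_eq)
  show "eventually (\<lambda>n. (real n / real Q - 1) / real n \<le> real (n div Q) / real n) sequentially"
    by (rule always_eventually, intro allI divide_right_mono) (simp_all add: eq)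
  show "eventually (\<lambda>n. real (n div Q) / real n \<le> 1 / real Q) sequentially"
    using eventually_gt_at_top[of 0]
  proof eventually_elim
    case (elim n)
    have "real (n div Q) \<le> real n / real Q" by (simp add: eq)
    then have "real (n div Q) / real n \<le> real n / real Q / real n" by (rule divide_right_mono) simp
    then show ?case using elim by simp
  qed
qed simp

text \<open>With P about n/Q the main term is linear in 1/Q and the error from two early blocks is
  quadratic, so a large fixed Q leaves a covariance of order n^m. Its square divided by n has order
  n^(2m-1).\<close>

theorem var_cnt_lower:
  "\<exists>c>0. eventually (\<lambda>n. c \<le> var (word_space n (8 * fact k * n ^ 4)) (cnt n) / real n ^ (2 * m - 1)) sequentially"
proof -
  obtain b where b: "b \<in> starts" "2 \<le> b" and blk: "\<And>n i j. i \<in> occ n \<Longrightarrow> j \<in> {1..<b} \<Longrightarrow> i j = i 1 + (j - 1)"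
    using first_block_exists by blast
  define \<delta> :: real where "\<delta> = 1 / (64 * (fact k)\<^sup>2)"
  have \<delta>0: "0 < \<delta>" by (simp add: \<delta>_def)
  \<comment> \<open>This choice makes \<delta> / (Q m!) exceed k / Q^2. Half of the gap becomes
    \<eta>, so that the limit 2\<eta> is eventually above it.\<close>
  obtain Q :: nat where Q: "real k * fact m / \<delta> < real Q" using reals_Archimedean2 by blast
  have Q0: "0 < real Q" using Q \<delta>0 by (metis divide_nonneg_pos fact_ge_zero mult_nonneg_nonneg of_nat_0_le_iff order.strict_trans1)
  define \<eta> where "\<eta> = (\<delta> / (Q * fact m) - k * (1 / real Q)\<^sup>2) / 2"
  have \<eta>0: "0 < \<eta>"
  proof -
    have "real k * fact m < \<delta> * real Q" using Q \<delta>0 by (simp add: field_simps)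
    then have "real k / real Q < \<delta> / fact m" using Q0 by (simp add: field_simps)
    then have "real k / real Q / real Q < \<delta> / fact m / real Q" using Q0 by (rule divide_strict_right_mono)
    then show ?thesis by (simp add: \<eta>_def power2_eq_square mult.commute)
  qed
  define P where "P = (\<lambda>n::nat. n div Q)"
  define f where "f = (\<lambda>n. \<delta> * (real ((n - q) choose m) / real n ^ m - (1 - real (P n) / real n) / fact m)
    - k * (real (P n) / real n)\<^sup>2 - real k ^ 2 / real n)"
  have Pl: "(\<lambda>n. real (P n) / real n) \<longlonglongrightarrow> 1 / real Q"
    unfolding P_def using Q0 by (intro tendsto_div_ratio) simp
  have "f \<longlonglongrightarrow> \<delta> * (1 / fact m - (1 - 1 / real Q) / fact m) - k * (1 / real Q)\<^sup>2 - 0"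
    unfolding f_def
    by (intro tendsto_diff tendsto_mult tendsto_const tendsto_binomial_ratio tendsto_divide tendsto_power Pl lim_const_over_n) simp
  also have "\<delta> * (1 / fact m - (1 - 1 / real Q) / fact m) - k * (1 / real Q)\<^sup>2 - 0 = 2 * \<eta>"
    by (simp add: \<eta>_def diff_divide_distrib)
  finally have "eventually (\<lambda>n. \<eta> < f n) sequentially" using \<eta>0 by (intro order_tendstoD(1)) auto
  moreover have "eventually (\<lambda>n. 64 * fact k * k ^ 3 \<le> 8 * fact k * n ^ 4) sequentially"
    using eventually_ge_at_top[of "8 * k ^ 3 + 1"]
  proof eventually_elim
    case (elim n)
    have "8 * k ^ 3 \<le> n" using elim by simp
    also have "n \<le> n ^ 4" using elim by (simp add: self_le_power)
    finally show ?case by simp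
  qed
  ultimately have "eventually (\<lambda>n. \<eta>\<^sup>2 \<le> var (word_space n (8 * fact k * n ^ 4)) (cnt n) / real n ^ (2 * m - 1)) sequentially"
    using eventually_ge_at_top[of 1]
  proof eventually_elim
    case (elim n)
    \<comment> \<open>The threshold for small letters is n^4, so a letter is small with probability
      exactly 1/(8 k!).\<close>
    define M where "M = 8 * fact k * n ^ 4"
    have n: "1 \<le> n" using elim by simp
    have Pn: "P n \<le> n" by (simp add: P_def)
    have TM: "n ^ 4 \<le> M" unfolding M_def using fact_ge_1[of k, where 'a=nat] by simp
    have M1: "1 \<le> M" using TM n by (meson one_le_power order_trans)
    have "2 \<le> m" using qk by auto
    then obtain m2 where "m = 2 + m2" using le_Suc_ex by blast
    then have m2: "m = Suc (Suc m2)" by simp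
    let ?s = "\<Sum>i\<in>occ n. \<Sum>a\<in>{a\<in>{1..k}. i a \<le> P n}. low_bias n M (n ^ 4) i a"
    have lim: "\<delta> * real (card {i\<in>occ n. i 1 \<le> P n}) - real k * real (P n) ^ 2 * real n ^ (m - 2) - real k ^ 2 * real n ^ (m - 1) \<le> \<bar>?s\<bar>"
      unfolding \<delta>_def by (rule abs_sum_low_bias_ge[OF b blk M_def _ Pn]) (use elim M_def in auto)
    have "real n ^ m * f n = \<delta> * (real n ^ m * (real ((n - q) choose m) / real n ^ m - (1 - real (P n) / real n) / fact m))
      - real k * real (P n) ^ 2 * real n ^ (m - 2) - real k ^ 2 * real n ^ (m - 1)"
    proof -
      have "real n ^ m * (k * (real (P n) / real n)\<^sup>2) = real k * real (P n) ^ 2 * real n ^ (m - 2)"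
        using n by (simp add: m2 power_divide power2_eq_square)
      moreover have "real n ^ m * (real k ^ 2 / real n) = real k ^ 2 * real n ^ (m - 1)" using n by (simp add: m2)
      moreover have "real n ^ m * (\<delta> * X - Y - Z) = \<delta> * (real n ^ m * X) - real n ^ m * Y - real n ^ m * Z" for X Y Z
        by (simp add: right_diff_distrib)
      ultimately show ?thesis unfolding f_def by (simp only:)
    qed
    also have "\<dots> \<le> \<bar>?s\<bar>"
    proof -
      have "real n ^ m * (real ((n - q) choose m) / real n ^ m - (1 - real (P n) / real n) / fact m) \<le>
         real n ^ m * (real (card {i\<in>occ n. i 1 \<le> P n}) / real n ^ m)"
        by (rule mult_left_mono[OF card_occ_first_le_ge[OF Pn n]]) simp
      also have "\<dots> = real (card {i\<in>occ n. i 1 \<le> P n})" using n by simp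
      finally have "\<delta> * (real n ^ m * (real ((n - q) choose m) / real n ^ m - (1 - real (P n) / real n) / fact m)) \<le> \<delta> * real (card {i\<in>occ n. i 1 \<le> P n})"
        using \<delta>0 by (intro mult_left_mono) auto
      then show ?thesis using lim by linarith
    qed
    finally have 1: "real n ^ m * f n \<le> \<bar>?s\<bar>" .
    have "real n ^ m * \<eta> \<le> real n ^ m * f n" using elim(1) by (intro mult_left_mono) auto
    with 1 have "real n ^ m * \<eta> \<le> \<bar>?s\<bar>" by linarith
    then have "(real n ^ m * \<eta>)\<^sup>2 \<le> \<bar>?s\<bar>\<^sup>2" using \<eta>0 by (intro power_mono) auto
    also have "\<dots> \<le> var (word_space n M) (cnt n) * n" using var_cnt_ge[OF M1 TM Pn] by simp
    finally have "real n * (real n ^ (2 * m - 1) * \<eta>\<^sup>2) \<le> real n * var (word_space n M) (cnt n)"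
    proof -
      have "2 * m = Suc (2 * m - 1)" by (simp add: m2)
      then have p: "(real n ^ m)\<^sup>2 = real n * real n ^ (2 * m - 1)" by (metis power_Suc power_even_eq)
      assume "(real n ^ m * \<eta>)\<^sup>2 \<le> var (word_space n M) (cnt n) * real n"
      then show ?thesis unfolding power_mult_distrib p by (simp only: mult.assoc mult.commute[of "real n" "var (word_space n M) (cnt n)"])
    qed
    then have "real n ^ (2 * m - 1) * \<eta>\<^sup>2 \<le> var (word_space n M) (cnt n)" using n by simp
    then show ?case unfolding M_def[symmetric] using n by (simp add: pos_le_divide_eq mult.commute)
  qed
  then show ?thesis using \<eta>0 by (intro exI[of _ "\<eta>\<^sup>2"]) simp
qed

end

section \<open>The central limit theorem\<close>

lemma iexp_Lipschitz: "norm (iexp x - iexp y) \<le> \<bar>x - y\<bar>"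
proof -
  have "iexp x = iexp y * iexp (x - y)" by (simp add: exp_add[symmetric] algebra_simps)
  then have "iexp x - iexp y = iexp y * (iexp (x - y) - 1)" by (simp add: right_diff_distrib)
  then have "norm (iexp x - iexp y) = norm (iexp (x - y) - 1)" by (simp add: norm_mult)
  also have "\<dots> \<le> \<bar>x - y\<bar>" using iexp_approx1[of "x - y" 0] by simp
  finally show ?thesis .
qed

lemma avg_perms_conj:
  assumes "finite X"
  shows "avg (perms X) g = avg (perms X) (\<lambda>s. avg (perms X) (\<lambda>p. g (conj_by p s)))"
proof -
  have fin: "finite (perms X)" "perms X \<noteq> {}" using assms finite_permutations perms_nonempty by auto
  have "avg (perms X) (\<lambda>s. g (conj_by p s)) = avg (perms X) g" if "p \<in> perms X" for p
  proof -
    have p: "p permutes X" using that by simp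
    have "avg (perms X) (\<lambda>s. g (conj_by p s)) = avg (perms X) (\<lambda>s. g (p \<circ> s))"
      unfolding conj_by_def using avg_bij[OF perms_right_bij[OF permutes_inv[OF p]], of "\<lambda>s. g (p \<circ> s)"] by (simp add: o_assoc)
    also have "\<dots> = avg (perms X) g" by (rule avg_bij[OF perms_left_bij[OF p]])
    finally show ?thesis .
  qed
  then have "avg (perms X) (\<lambda>p. avg (perms X) (\<lambda>s. g (conj_by p s))) = avg (perms X) (\<lambda>p. avg (perms X) g)"
    by (rule avg_cong)
  then show ?thesis unfolding avg_const[OF fin] by (subst avg_swap) simp
qed

lemma card_fixed_conj_by:
  assumes r: "r permutes X"
  shows "card {x\<in>X. conj_by r s x = x} = card {x\<in>X. s x = x}"
proof -
  have "{x\<in>X. conj_by r s x = x} = r ` {x\<in>X. s x = x}"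
  proof (intro equalityI subsetI)
    fix x assume "x \<in> {x\<in>X. conj_by r s x = x}"
    then have x: "x \<in> X" "r (s (inv r x)) = x" by (auto simp: conj_by_def)
    then have "s (inv r x) = inv r x" using permutes_inverses[OF r] by metis
    moreover have "inv r x \<in> X" using x permutes_in_image[OF permutes_inv[OF r]] by simp
    ultimately have "inv r x \<in> {x\<in>X. s x = x}" by simp
    moreover have "x = r (inv r x)" using permutes_inverses[OF r] by simp
    ultimately show "x \<in> r ` {x\<in>X. s x = x}" by blast
  next
    fix x assume "x \<in> r ` {x\<in>X. s x = x}"
    then show "x \<in> {x\<in>X. conj_by r s x = x}" using permutes_inverses[OF r] permutes_in_image[OF r] by (auto simp: conj_by_def)
  qed
  then show ?thesis using permutes_inj[OF r] by (simp add: card_image inj_on_subset)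
qed

lemma char_distr_pmf_of_set:
  assumes "finite S" "S \<noteq> {}"
  shows "char (distr (measure_pmf (pmf_of_set S)) borel f) t = avg S (\<lambda>x. iexp (t * f x))"
proof -
  have "char (distr (measure_pmf (pmf_of_set S)) borel f) t = (LINT x|measure_pmf (pmf_of_set S). iexp (t * f x))"
    unfolding char_def by (subst integral_distr) simp_all
  also have "\<dots> = (\<Sum>x\<in>S. pmf (pmf_of_set S) x *\<^sub>R iexp (t * f x))"
    using assms by (intro integral_measure_pmf) auto
  also have "\<dots> = avg S (\<lambda>x. iexp (t * f x))"
    using assms by (simp add: avg_def scaleR_conv_of_real divide_inverse mult.commute sum_distrib_left)
  finally show ?thesis .
qed

lemma char_normal:
  assumes "0 < \<sigma>"
  shows "char (density lborel (normal_density 0 \<sigma>)) t = of_real (exp (- (\<sigma>\<^sup>2 * t\<^sup>2 / 2)))"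
proof -
  have "distributed std_normal_distribution lborel (\<lambda>x. x) std_normal_density"
    by (simp add: distributed_def distr_id2 cong: distr_cong)
  from prob_space.normal_density_affine[OF prob_space_normal_density[of 1 0] this, of \<sigma> 0]
  have "distributed std_normal_distribution lborel (\<lambda>x. \<sigma> * x) (normal_density 0 \<sigma>)" using assms by simp
  then have "density lborel (normal_density 0 \<sigma>) = distr std_normal_distribution lborel (\<lambda>x. \<sigma> * x)"
    by (simp add: distributed_def)
  also have "\<dots> = distr std_normal_distribution borel (\<lambda>x. \<sigma> * x)" by (rule distr_cong) auto
  finally have "char (density lborel (normal_density 0 \<sigma>)) t = (CLINT x|std_normal_distribution. iexp (t * (\<sigma> * x)))"
    unfolding char_def by (simp add: integral_distr)
  also have "\<dots> = char std_normal_distribution (t * \<sigma>)" by (simp add: char_def mult.assoc)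
  also have "\<dots> = of_real (exp (- (\<sigma>\<^sup>2 * t\<^sup>2 / 2)))" by (simp add: char_std_normal_distribution power_mult_distrib mult.commute)
  finally show ?thesis .
qed

context vincular_pattern
begin

definition std_cnt :: "nat \<Rightarrow> (nat \<Rightarrow> nat) \<Rightarrow> real" where
  "std_cnt n w = (cnt n w - real n ^ m / (fact k * fact m)) / scaling n"

lemma scaling_square: "1 \<le> n \<Longrightarrow> (scaling n)\<^sup>2 = real n ^ (2 * m - 1)"
proof -
  assume n: "1 \<le> n"
  have "(scaling n)\<^sup>2 = real n powr (2 * (real m - 1/2))" using n by (simp add: scaling_def power2_eq_square powr_add[symmetric])
  also have "2 * (real m - 1/2) = real (2 * m - 1)" using qk by (simp add: of_nat_diff)
  finally show ?thesis using n by (simp add: powr_realpow)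
qed

lemma pow_div_scaling: "1 \<le> n \<Longrightarrow> real n ^ m / scaling n = sqrt n"
proof -
  assume n: "1 \<le> n"
  have "m \<noteq> 0" using qk by auto
  then have "real n ^ m = real n * real n ^ (m - 1)" by (simp add: power_eq_if)
  then have "real n ^ m / scaling n = real n * (real n ^ (m - 1) / scaling n)" by (simp only: times_divide_eq_right)
  then have "real n ^ m / scaling n = real n * (1 / sqrt n)" unfolding scaling_eq[OF n] .
  then show ?thesis using n by (simp add: real_div_sqrt)
qed

text \<open>For each occurrence the deviation from 1/k! comes from words with a repeated letter on
  its support, of probability at most \<open>k\<^sup>2 / M\<close>.\<close>

lemma avg_cnt_near:
  assumes M: "1 \<le> M"
  shows "\<bar>avg (word_space n M) (cnt n) - real ((n - q) choose m) / fact k\<bar> \<le> real n ^ m * (real k ^ 2 / real M)"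
proof -
  have eq: "avg (word_space n M) (cnt n) - real ((n - q) choose m) / fact k =
     (\<Sum>i\<in>occ n. avg (word_space n M) (\<lambda>V. of_bool (is_pat i V)) - 1 / fact k)"
    unfolding cnt_def avg_sum by (simp add: sum_subtractf card_occ)
  have "\<bar>avg (word_space n M) (cnt n) - real ((n - q) choose m) / fact k\<bar> \<le> (\<Sum>i\<in>occ n. real k ^ 2 / real M)"
    unfolding eq
  proof (rule order_trans[OF sum_abs sum_mono])
    fix i assume i: "i \<in> occ n"
    have f1: "1 \<le> (fact k :: real)" by (rule fact_ge_1)
    have "(1 - real k ^ 2 / real M) / fact k = 1 / fact k - real k ^ 2 / real M / fact k" by (simp add: diff_divide_distrib)
    moreover have "real k ^ 2 / real M / fact k \<le> real k ^ 2 / real M / 1" using f1 by (intro divide_left_mono) auto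
    ultimately show "\<bar>avg (word_space n M) (\<lambda>V. of_bool (is_pat i V)) - 1 / fact k\<bar> \<le> real k ^ 2 / real M"
      using avg_is_pat_bounds[OF i M] by (simp add: abs_le_iff)
  qed
  also have "\<dots> = real (card (occ n)) * (real k ^ 2 / real M)" by simp
  also have "\<dots> \<le> real n ^ m * (real k ^ 2 / real M)"
    using of_nat_mono[OF card_occ_le[of n], where 'a=real] by (intro mult_right_mono) auto
  finally show ?thesis .
qed

lemma cnt_order_fun:
  fixes g :: "real \<Rightarrow> 'b"
  shows "order_fun n (\<lambda>V. g (cnt n V))"
  unfolding order_fun_def
proof (intro allI impI)
  fix V W :: "nat \<Rightarrow> nat" assume h: "\<forall>a\<in>{1..n}. \<forall>b\<in>{1..n}. V a < V b \<longleftrightarrow> W a < W b"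
  have "cnt n V = cnt n W" unfolding cnt_def using is_pat_order_fun[OF _ h] by (intro sum.cong) auto
  then show "g (cnt n V) = g (cnt n W)" by simp
qed

text \<open>s2 is the limit of the normalized variances in the word model, hence common to all t,
  and positive by the lower bound along the same alphabets. The characteristic function splits into
  the error of passing to words, a centred part covered by the normal approximation, and a phase
  that accounts for the recentring.\<close>

theorem uniform_char_limit:
  obtains s2 :: real where "0 < s2"
    "\<And>t. (\<lambda>n. avg (perms {1..n}) (\<lambda>w. iexp (t * std_cnt n w))) \<longlonglongrightarrow> of_real (exp (- (s2 * t\<^sup>2 / 2)))"
proof -
  \<comment> \<open>The power n^4 makes the collision bound n^2 / M and the mean error sqrt n / M
    vanish; the factor 8 k! matches the alphabet of \<open>var_cnt_lower\<close>.\<close>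
  define M where "M = (\<lambda>n::nat. 8 * fact k * n ^ 4)"
  have Mge: "n ^ 4 \<le> M n" for n unfolding M_def using fact_ge_1[of k, where 'a=nat] by simp
  have M1: "1 \<le> M n" if "1 \<le> n" for n using Mge[of n] that by (meson one_le_power order_trans)
  have nM: "n \<le> M n" for n
  proof (cases "n = 0")
    case False
    then have "n \<le> n ^ 4" by (simp add: self_le_power)
    then show ?thesis using Mge[of n] by linarith
  qed simp
  have Mlim: "filterlim M at_top sequentially"
    using nM by (intro filterlim_at_top_mono[OF filterlim_ident]) auto
  obtain s2 where s2: "(\<lambda>n. var (word_space n (M n)) (cnt n) / real n ^ (2 * m - 1)) \<longlonglongrightarrow> s2"
    using convergent_var_cnt[OF Mlim] by (auto simp: convergent_def)
  obtain c where c: "0 < c" "eventually (\<lambda>n. c \<le> var (word_space n (M n)) (cnt n) / real n ^ (2 * m - 1)) sequentially"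
    using var_cnt_lower unfolding M_def by blast
  have "c \<le> s2" by (rule tendsto_lowerbound[OF s2 c(2)]) simp
  then have s20: "0 < s2" using c(1) by simp
  have "(\<lambda>n. avg (perms {1..n}) (\<lambda>w. iexp (t * std_cnt n w))) \<longlonglongrightarrow> of_real (exp (- (s2 * t\<^sup>2 / 2)))" for t
  proof -
    define e1 where "e1 = (\<lambda>n. avg (perms {1..n}) (\<lambda>w. iexp (t * std_cnt n w)) - avg (word_space n (M n)) (\<lambda>w. iexp (t * std_cnt n w)))"
    define mu where "mu = (\<lambda>n. avg (word_space n (M n)) (cnt n))"
    define w where "w = (\<lambda>n. avg (word_space n (M n)) (\<lambda>V. iexp (t * ((cnt n V - mu n) / scaling n))))"
    \<comment> \<open>The move from the exact mean of the word model to n^m / (k! m!), measured on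
      the scale of the fluctuations.\<close>
    define sh where "sh = (\<lambda>n. (mu n - real n ^ m / (fact k * fact m)) / scaling n)"
    have e1: "e1 \<longlonglongrightarrow> 0"
    proof (rule Lim_null_comparison)
      show "eventually (\<lambda>n. norm (e1 n) \<le> 2 * real n ^ 2 / real n ^ 4) sequentially"
        using eventually_ge_at_top[of 1]
      proof eventually_elim
        case (elim n)
        have "norm (avg (word_space n (M n)) (\<lambda>w. iexp (t * std_cnt n w)) - avg (perms {1..n}) (\<lambda>w. iexp (t * std_cnt n w))) \<le> 2 * 1 * (real n)\<^sup>2 / real (M n)"
          unfolding word_space_def std_cnt_def
          by (rule avg_order_fun_transfer[OF cnt_order_fun[where g = "\<lambda>x::real. iexp (t * ((x - real n ^ m / (fact k * fact m)) / scaling n))"] _ M1[OF elim]]) (simp only: norm_exp_i_times order_refl)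
        also have "\<dots> \<le> 2 * 1 * (real n)\<^sup>2 / real (n ^ 4)"
          using elim M1[OF elim] by (intro divide_left_mono of_nat_mono Mge) auto
        finally show ?case unfolding e1_def by (simp add: norm_minus_commute)
      qed
      show "(\<lambda>n. 2 * real n ^ 2 / real n ^ 4) \<longlonglongrightarrow> 0" by real_asymp
    qed
    have w: "(\<lambda>n. w n - of_real (exp (- (var (word_space n (M n)) (cnt n) / (scaling n)\<^sup>2 * t\<^sup>2 / 2)))) \<longlonglongrightarrow> 0"
    proof (rule Lim_null_comparison)
      show "eventually (\<lambda>n. norm (w n - of_real (exp (- (var (word_space n (M n)) (cnt n) / (scaling n)\<^sup>2 * t\<^sup>2 / 2)))) \<le>
        (t\<^sup>2 * (k\<^sup>2 * (1 + 2 * k)) + \<bar>t\<bar>^3 * k^3) / sqrt n) sequentially"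
        using eventually_ge_at_top[of 1]
      proof eventually_elim
        case (elim n)
        have S: "finite {1..M n}" "{1..M n} \<noteq> {}" using M1[OF elim] by auto
        show ?case unfolding w_def mu_def word_space_def by (rule cnt_char_bound[OF S elim])
      qed
      show "(\<lambda>n. (t\<^sup>2 * (k\<^sup>2 * (1 + 2 * k)) + \<bar>t\<bar>^3 * k^3) / sqrt n) \<longlonglongrightarrow> 0" by real_asymp
    qed
    have v: "(\<lambda>n. complex_of_real (exp (- (var (word_space n (M n)) (cnt n) / (scaling n)\<^sup>2 * t\<^sup>2 / 2)))) \<longlonglongrightarrow> of_real (exp (- (s2 * t\<^sup>2 / 2)))"
    proof (rule Lim_transform_eventually)
      show "(\<lambda>n. complex_of_real (exp (- (var (word_space n (M n)) (cnt n) / real n ^ (2 * m - 1) * t\<^sup>2 / 2)))) \<longlonglongrightarrow> of_real (exp (- (s2 * t\<^sup>2 / 2)))"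
        by (intro tendsto_intros s2) simp_all
      show "eventually (\<lambda>n. complex_of_real (exp (- (var (word_space n (M n)) (cnt n) / real n ^ (2 * m - 1) * t\<^sup>2 / 2))) =
        of_real (exp (- (var (word_space n (M n)) (cnt n) / (scaling n)\<^sup>2 * t\<^sup>2 / 2)))) sequentially"
        using eventually_ge_at_top[of 1] by eventually_elim (simp add: scaling_square)
    qed
    have wl: "w \<longlonglongrightarrow> of_real (exp (- (s2 * t\<^sup>2 / 2)))" using tendsto_add[OF w v] by simp
    have sh: "sh \<longlonglongrightarrow> 0"
    proof -
      \<comment> \<open>a compares the mean with the number of occurrences divided by k!; b then
        replaces the binomial coefficient by n^m / m!.\<close>
      define a where "a = (\<lambda>n. (mu n - real ((n - q) choose m) / fact k) / scaling n)"
      define b where "b = (\<lambda>n. sqrt (real n) * (real ((n - q) choose m) / real n ^ m - 1 / fact m) / fact k)"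
      have "a \<longlonglongrightarrow> 0"
      proof (rule Lim_null_comparison)
        show "eventually (\<lambda>n. norm (a n) \<le> real k ^ 2 * (sqrt n / real n ^ 4)) sequentially"
          using eventually_ge_at_top[of 1]
        proof eventually_elim
          case (elim n)
          have "norm (a n) = \<bar>mu n - real ((n - q) choose m) / fact k\<bar> / scaling n"
            using scaling_pos[OF elim] by (simp add: a_def)
          also have "\<dots> \<le> real n ^ m * (real k ^ 2 / real (M n)) / scaling n"
            using avg_cnt_near[OF M1[OF elim], of n] scaling_pos[OF elim] unfolding mu_def by (intro divide_right_mono) auto
          also have "\<dots> = (real n ^ m / scaling n) * (real k ^ 2 / real (M n))" by simp
          also have "\<dots> \<le> sqrt n * (real k ^ 2 / real (n ^ 4))"
            unfolding pow_div_scaling[OF elim] using elim M1[OF elim] by (intro mult_left_mono divide_left_mono of_nat_mono Mge) auto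
          finally show ?case by (simp add: mult.commute)
        qed
        show "(\<lambda>n. real k ^ 2 * (sqrt n / real n ^ 4)) \<longlonglongrightarrow> 0" by real_asymp
      qed
      moreover have "b \<longlonglongrightarrow> 0 / fact k" unfolding b_def by (intro tendsto_divide tendsto_binomial_rate tendsto_const) simp
      ultimately have "(\<lambda>n. a n + b n) \<longlonglongrightarrow> 0 + 0 / fact k" by (rule tendsto_add)
      moreover have "eventually (\<lambda>n. a n + b n = sh n) sequentially"
        using eventually_ge_at_top[of 1]
      proof eventually_elim
        case (elim n)
        have "b n = (real n ^ m / scaling n) * (real ((n - q) choose m) / real n ^ m - 1 / fact m) / fact k"
          unfolding b_def pow_div_scaling[OF elim] ..
        also have "\<dots> = (real ((n - q) choose m) / fact k - real n ^ m / (fact k * fact m)) / scaling n"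
          using elim scaling_pos[OF elim] by (simp add: field_simps)
        finally show ?case by (simp add: a_def sh_def add_divide_distrib[symmetric])
      qed
      ultimately show ?thesis using Lim_transform_eventually by fastforce
    qed
    have ish: "(\<lambda>n. iexp (t * sh n)) \<longlonglongrightarrow> 1"
    proof -
      have "(\<lambda>n. iexp (t * sh n)) \<longlonglongrightarrow> iexp (t * 0)" by (intro tendsto_intros sh)
      then show ?thesis by simp
    qed
    have dec: "avg (perms {1..n}) (\<lambda>w. iexp (t * std_cnt n w)) = e1 n + w n * iexp (t * sh n)" for n
    proof -
      have "w n * iexp (t * sh n) = avg (word_space n (M n)) (\<lambda>w. iexp (t * std_cnt n w))"
        unfolding w_def avg_cmult2[symmetric]
      proof (rule avg_cong)
        fix V
        have "t * std_cnt n V = t * ((cnt n V - mu n) / scaling n) + t * sh n"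
          by (simp add: std_cnt_def sh_def add_divide_distrib[symmetric] distrib_left[symmetric])
        then show "iexp (t * ((cnt n V - mu n) / scaling n)) * iexp (t * sh n) = iexp (t * std_cnt n V)"
          by (simp only: exp_add[symmetric] of_real_add distrib_left)
      qed
      then show ?thesis by (simp add: e1_def)
    qed
    have "(\<lambda>n. e1 n + w n * iexp (t * sh n)) \<longlonglongrightarrow> 0 + of_real (exp (- (s2 * t\<^sup>2 / 2))) * 1"
      by (intro tendsto_add tendsto_mult e1 wl ish)
    then show ?thesis unfolding dec by simp
  qed
  then show ?thesis using that s20 by blast
qed

text \<open>Averages over p do not notice when s and s' are relabelled separately. After
  relabelling, each follows the shift except at one point per cycle, so the two disagree in at most
  as many points as they have cycles in total; the numbers of fixed points are unchanged.\<close>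

lemma conj_pair_bound:
  assumes s: "s permutes {1..n}" "s' permutes {1..n}" and n: "2 \<le> n"
  defines "os u \<equiv> real (card (orbit u ` {1..n}))"
  defines "fx u \<equiv> real (card {x\<in>{1..n}. u x = x})"
  shows "norm (avg (perms {1..n}) (\<lambda>p. iexp (t * std_cnt n (conj_by p s))) - avg (perms {1..n}) (\<lambda>p. iexp (t * std_cnt n (conj_by p s'))))
    \<le> \<bar>t\<bar> / sqrt n * (sqrt (1152 * real k ^ 3 * (os s + os s')) + 4 * real k ^ 2 + real k * (fx s + fx s'))"
proof -
  let ?P = "perms {1..n}"
  have n1: "1 \<le> n" using n by simp
  obtain \<rho> where \<rho>: "\<rho> permutes {1..n}" "card {x\<in>{1..n}. conj_by (inv \<rho>) s x \<noteq> Suc x} \<le> card (orbit s ` {1..n})"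
    using near_shift[OF s(1)] by auto
  obtain \<rho>' where \<rho>': "\<rho>' permutes {1..n}" "card {x\<in>{1..n}. conj_by (inv \<rho>') s' x \<noteq> Suc x} \<le> card (orbit s' ` {1..n})"
    using near_shift[OF s(2)] by auto
  define a where "a = conj_by (inv \<rho>) s"
  define b where "b = conj_by (inv \<rho>') s'"
  have ab: "a permutes {1..n}" "b permutes {1..n}"
    unfolding a_def b_def by (rule conj_by_permutes[OF permutes_inv[OF \<rho>(1)] s(1)], rule conj_by_permutes[OF permutes_inv[OF \<rho>'(1)] s(2)])
  have fxa: "fx a = fx s" "fx b = fx s'"
    unfolding fx_def a_def b_def using card_fixed_conj_by[OF permutes_inv[OF \<rho>(1)]] card_fixed_conj_by[OF permutes_inv[OF \<rho>'(1)]] by auto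
  have "card {x\<in>{1..n}. a x \<noteq> b x} \<le> card ({x\<in>{1..n}. a x \<noteq> Suc x} \<union> {x\<in>{1..n}. b x \<noteq> Suc x})"
    by (rule card_mono) auto
  also have "\<dots> \<le> card {x\<in>{1..n}. a x \<noteq> Suc x} + card {x\<in>{1..n}. b x \<noteq> Suc x}" by (rule card_Un_le)
  also have "\<dots> \<le> card (orbit s ` {1..n}) + card (orbit s' ` {1..n})" using \<rho>(2) \<rho>'(2) unfolding a_def b_def by (rule add_mono)
  finally have "card {x\<in>{1..n}. a x \<noteq> b x} \<le> card (orbit s ` {1..n}) + card (orbit s' ` {1..n})" .
  then have r: "real (card {x\<in>{1..n}. a x \<noteq> b x}) \<le> os s + os s'" unfolding os_def by linarith
  have "avg ?P (\<lambda>p. iexp (t * std_cnt n (conj_by p s))) - avg ?P (\<lambda>p. iexp (t * std_cnt n (conj_by p s'))) =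
    avg ?P (\<lambda>p. iexp (t * std_cnt n (conj_by p a)) - iexp (t * std_cnt n (conj_by p b)))"
    unfolding avg_diff a_def b_def
    using avg_perms_conj_by[OF permutes_inv[OF \<rho>(1)], of "\<lambda>w. iexp (t * std_cnt n w)" s]
      avg_perms_conj_by[OF permutes_inv[OF \<rho>'(1)], of "\<lambda>w. iexp (t * std_cnt n w)" s'] by simp
  then have "norm (avg ?P (\<lambda>p. iexp (t * std_cnt n (conj_by p s))) - avg ?P (\<lambda>p. iexp (t * std_cnt n (conj_by p s')))) \<le>
    avg ?P (\<lambda>p. norm (iexp (t * std_cnt n (conj_by p a)) - iexp (t * std_cnt n (conj_by p b))))"
    by (simp only: norm_avg_le)
  also have "\<dots> \<le> avg ?P (\<lambda>p. \<bar>t\<bar> / scaling n * \<bar>cnt_diff n a b p\<bar>)"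
  proof (rule avg_mono)
    fix p
    have "norm (iexp (t * std_cnt n (conj_by p a)) - iexp (t * std_cnt n (conj_by p b))) \<le> \<bar>t * std_cnt n (conj_by p a) - t * std_cnt n (conj_by p b)\<bar>"
      by (rule iexp_Lipschitz)
    also have "t * std_cnt n (conj_by p a) - t * std_cnt n (conj_by p b) = t / scaling n * cnt_diff n a b p"
      by (simp add: std_cnt_def cnt_diff_def right_diff_distrib diff_divide_distrib)
    also have "\<bar>t / scaling n * cnt_diff n a b p\<bar> = \<bar>t\<bar> / scaling n * \<bar>cnt_diff n a b p\<bar>"
      using scaling_pos[OF n1] by (simp add: abs_mult)
    finally show "norm (iexp (t * std_cnt n (conj_by p a)) - iexp (t * std_cnt n (conj_by p b))) \<le> \<bar>t\<bar> / scaling n * \<bar>cnt_diff n a b p\<bar>" .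
  qed
  also have "\<dots> = \<bar>t\<bar> / scaling n * avg ?P (\<lambda>p. \<bar>cnt_diff n a b p\<bar>)" by (rule avg_cmult)
  also have "\<dots> \<le> \<bar>t\<bar> / scaling n * (sqrt (1152 * real k ^ 3 * real (card {x\<in>{1..n}. a x \<noteq> b x})) * real n ^ (m - 1)
      + real n ^ (m - 1) * (4 * real k ^ 2 + real k * (fx a + fx b)))"
    using avg_abs_cnt_diff[OF ab n] scaling_pos[OF n1] unfolding fx_def by (intro mult_left_mono) auto
  also have "\<dots> \<le> \<bar>t\<bar> / scaling n * (sqrt (1152 * real k ^ 3 * (os s + os s')) * real n ^ (m - 1)
      + real n ^ (m - 1) * (4 * real k ^ 2 + real k * (fx a + fx b)))"
    using r scaling_pos[OF n1] by (intro mult_left_mono add_right_mono mult_right_mono real_sqrt_le_mono) auto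
  also have "\<dots> = \<bar>t\<bar> * (real n ^ (m - 1) / scaling n) * (sqrt (1152 * real k ^ 3 * (os s + os s')) + 4 * real k ^ 2 + real k * (fx a + fx b))"
    by (simp add: algebra_simps add_divide_distrib)
  also have "\<dots> = \<bar>t\<bar> / sqrt n * (sqrt (1152 * real k ^ 3 * (os s + os s')) + 4 * real k ^ 2 + real k * (fx s + fx s'))"
    unfolding scaling_eq[OF n1] fxa by simp
  finally show ?thesis .
qed

text \<open>The bound for a pair is averaged over s in the class, which has \<open>size lam\<close>
  cycles and no fixed point, and over a uniform s', whose fixed points are at most as many as its
  cycles.\<close>

lemma class_uniform_bound:
  assumes n: "2 \<le> n" and C: "perms_of_cycle_type n lam \<noteq> {}" and no1: "count lam 1 = 0"
  defines "K \<equiv> sqrt (1152 * real k ^ 3)"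
  shows "norm (avg (perms_of_cycle_type n lam) (\<lambda>w. iexp (t * std_cnt n w)) - avg (perms {1..n}) (\<lambda>w. iexp (t * std_cnt n w)))
    \<le> \<bar>t\<bar> / sqrt n * (K * sqrt (size lam) + 4 * real k ^ 2 + (K + k) * harm n)"
proof -
  let ?P = "perms {1..n}" and ?C = "perms_of_cycle_type n lam"
  define h where "h = (\<lambda>w. iexp (t * std_cnt n w))"
  have finP: "finite ?P" "?P \<noteq> {}" using finite_permutations perms_nonempty by auto
  have K0: "0 \<le> K" by (simp add: K_def)
  let ?a = "\<lambda>s. avg ?P (\<lambda>p. h (conj_by p s))"
  have "avg ?C h - avg ?P h = avg ?C ?a - avg ?P ?a"
    using avg_class_conj_by[of n lam h] avg_perms_conj[of "{1..n}" h] by simp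
  also have "\<dots> = avg ?C (\<lambda>s. avg ?P (\<lambda>s'. ?a s - ?a s'))"
    by (simp only: avg_diff avg_const[OF finP] avg_const[OF finite_class C])
  finally have "norm (avg ?C h - avg ?P h) \<le> avg ?C (\<lambda>s. norm (avg ?P (\<lambda>s'. ?a s - ?a s')))" by (simp only: norm_avg_le)
  also have "\<dots> \<le> \<bar>t\<bar> / sqrt n * (K * sqrt (size lam) + 4 * real k ^ 2 + (K + k) * harm n)"
  proof (rule avg_le_const)
    fix s assume s: "s \<in> ?C"
    have sp: "s permutes {1..n}" using class_mem_orbits(1)[OF s] .
    have "norm (avg ?P (\<lambda>s'. ?a s - ?a s')) \<le> avg ?P (\<lambda>s'. norm (?a s - ?a s'))" by (rule norm_avg_le)
    also have "\<dots> \<le> avg ?P (\<lambda>s'. \<bar>t\<bar> / sqrt n * ((K * sqrt (size lam) + 4 * real k ^ 2) + (K + k) * real (card (orbit s' ` {1..n}))))"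
    proof (rule avg_mono)
      fix s' assume "s' \<in> ?P"
      then have s': "s' permutes {1..n}" by simp
      let ?o = "real (card (orbit s' ` {1..n}))"
      have "norm (?a s - ?a s') \<le> \<bar>t\<bar> / sqrt n * (sqrt (1152 * real k ^ 3 * (real (size lam) + ?o)) + 4 * real k ^ 2 + real k * (0 + real (card {x\<in>{1..n}. s' x = x})))"
        using conj_pair_bound[OF sp s' n, of t]
        unfolding h_def class_mem_orbits(2)[OF s] class_mem_no_fixed[OF s no1] of_nat_0 .
      also have "\<dots> \<le> \<bar>t\<bar> / sqrt n * ((K * sqrt (size lam) + 4 * real k ^ 2) + (K + k) * ?o)"
      proof (intro mult_left_mono)
        have "sqrt (real (size lam) + ?o) \<le> sqrt (size lam) + sqrt ?o" by (rule sqrt_add_le_add_sqrt) auto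
        \<comment> \<open>Crude but affordable: the mean number of cycles of s' is only logarithmic,
          so a linear dependence is harmless after division by sqrt n, and the mean of the cycle
          count suffices.\<close>
        also have "sqrt ?o \<le> ?o"
        proof (cases "card (orbit s' ` {1..n}) = 0")
          case False
          then have "1 \<le> ?o" by linarith
          then have "?o \<le> ?o\<^sup>2" by (simp add: self_le_power)
          then show ?thesis by (simp add: real_le_lsqrt)
        qed simp
        finally have "K * sqrt (real (size lam) + ?o) \<le> K * (sqrt (size lam) + ?o)" using K0 by (intro mult_left_mono) auto
        moreover have "sqrt (1152 * real k ^ 3 * (real (size lam) + ?o)) = K * sqrt (real (size lam) + ?o)"
          unfolding K_def by (rule real_sqrt_mult)
        moreover have "real k * (0 + real (card {x\<in>{1..n}. s' x = x})) \<le> real k * ?o"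
          using fixed_le_orbits[OF s'] by (intro mult_left_mono) auto
        ultimately show "sqrt (1152 * real k ^ 3 * (real (size lam) + ?o)) + 4 * real k ^ 2 + real k * (0 + real (card {x\<in>{1..n}. s' x = x}))
          \<le> (K * sqrt (size lam) + 4 * real k ^ 2) + (K + k) * ?o" by (simp add: algebra_simps)
      qed simp
      finally show "norm (?a s - ?a s') \<le> \<bar>t\<bar> / sqrt n * ((K * sqrt (size lam) + 4 * real k ^ 2) + (K + k) * ?o)" .
    qed
    also have "\<dots> = \<bar>t\<bar> / sqrt n * ((K * sqrt (size lam) + 4 * real k ^ 2) + (K + k) * avg ?P (\<lambda>s'. real (card (orbit s' ` {1..n}))))"
      by (simp only: avg_cmult avg_add avg_const[OF finP])
    also have "\<dots> \<le> \<bar>t\<bar> / sqrt n * ((K * sqrt (size lam) + 4 * real k ^ 2) + (K + k) * harm n)"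
      using avg_card_orbits_le[of "{1..n}"] K0 by (intro mult_left_mono add_left_mono) auto
    finally show "norm (avg ?P (\<lambda>s'. ?a s - ?a s')) \<le> \<bar>t\<bar> / sqrt n * (K * sqrt (size lam) + 4 * real k ^ 2 + (K + k) * harm n)" .
  qed (intro mult_nonneg_nonneg divide_nonneg_nonneg add_nonneg_nonneg harm_nonneg real_sqrt_ge_zero; use K0 in simp)
  finally show ?thesis unfolding h_def .
qed

text \<open>What separates the class from the uniform law is the square root of (number of cycles) /
  n, which vanishes for long cycles, and a term of order (log n) / sqrt n.\<close>

lemma class_char_limit:
  assumes part: "\<And>n. lam n partition_of n" and long: "all_long_cycles lam"
    and lim: "(\<lambda>n. avg (perms {1..n}) (\<lambda>w. iexp (t * std_cnt n w))) \<longlonglongrightarrow> l"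
  shows "(\<lambda>n. avg (perms_of_cycle_type n (lam n)) (\<lambda>w. iexp (t * std_cnt n w))) \<longlonglongrightarrow> l"
proof -
  define K where "K = sqrt (1152 * real k ^ 3)"
  have K0: "0 \<le> K" by (simp add: K_def)
  have ne: "perms_of_cycle_type n (lam n) \<noteq> {}" for n
    using class_nonempty[of "lam n"] part[of n] by (simp add: partition_of_def)
  have "(\<lambda>n. avg (perms_of_cycle_type n (lam n)) (\<lambda>w. iexp (t * std_cnt n w)) - avg (perms {1..n}) (\<lambda>w. iexp (t * std_cnt n w))) \<longlonglongrightarrow> 0"
  proof (rule Lim_null_comparison)
    show "eventually (\<lambda>n. norm (avg (perms_of_cycle_type n (lam n)) (\<lambda>w. iexp (t * std_cnt n w)) - avg (perms {1..n}) (\<lambda>w. iexp (t * std_cnt n w)))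
      \<le> \<bar>t\<bar> * (K * sqrt (real (size (lam n)) / real n) + (4 * real k ^ 2 + (K + k) * (1 + ln n)) / sqrt n)) sequentially"
      using eventually_ge_at_top[of 2] all_long_size(2)[OF part long]
    proof eventually_elim
      case (elim n)
      have "norm (avg (perms_of_cycle_type n (lam n)) (\<lambda>w. iexp (t * std_cnt n w)) - avg (perms {1..n}) (\<lambda>w. iexp (t * std_cnt n w)))
        \<le> \<bar>t\<bar> / sqrt n * (K * sqrt (size (lam n)) + 4 * real k ^ 2 + (K + k) * harm n)"
        unfolding K_def by (rule class_uniform_bound[OF elim(1) ne elim(2)])
      also have "\<dots> \<le> \<bar>t\<bar> / sqrt n * (K * sqrt (size (lam n)) + 4 * real k ^ 2 + (K + k) * (1 + ln n))"
        using harm_le_1_ln[of n] elim K0 by (intro mult_left_mono add_left_mono) auto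
      also have "\<dots> = \<bar>t\<bar> * (K * sqrt (real (size (lam n)) / real n) + (4 * real k ^ 2 + (K + k) * (1 + ln n)) / sqrt n)"
        by (simp add: real_sqrt_divide add_divide_distrib algebra_simps)
      finally show ?case .
    qed
    have 1: "(\<lambda>n. sqrt (real (size (lam n)) / real n)) \<longlonglongrightarrow> sqrt 0"
      by (intro tendsto_real_sqrt all_long_size(1)[OF part long])
    have 2: "(\<lambda>n. (4 * real k ^ 2 + (K + k) * (1 + ln n)) / sqrt n) \<longlonglongrightarrow> 0" by real_asymp
    have "(\<lambda>n. \<bar>t\<bar> * (K * sqrt (real (size (lam n)) / real n) + (4 * real k ^ 2 + (K + k) * (1 + ln n)) / sqrt n)) \<longlonglongrightarrow> \<bar>t\<bar> * (K * sqrt 0 + 0)"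
      by (intro tendsto_mult tendsto_add tendsto_const 1 2)
    then show "(\<lambda>n. \<bar>t\<bar> * (K * sqrt (real (size (lam n)) / real n) + (4 * real k ^ 2 + (K + k) * (1 + ln n)) / sqrt n)) \<longlonglongrightarrow> 0" by simp
  qed
  from tendsto_add[OF this lim] show ?thesis by simp
qed

end

theorem theorem8p8:
  fixes k q :: nat and v :: "nat \<Rightarrow> nat" and A :: "nat set"
  assumes "v permutes {1..k}" and "A \<subset> {1..k-1}" and "card A = q"
  shows "\<exists>\<sigma>>0. \<forall>lam :: nat \<Rightarrow> nat multiset.
    (\<forall>n. lam n partition_of n) \<longrightarrow> all_long_cycles lam \<longrightarrow>
      weak_conv_m
        (\<lambda>n. distr (measure_pmf (pmf_of_set (perms_of_cycle_type n (lam n)))) borel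
          (\<lambda>w. (real (vincular_count k v A n w) - real n ^ (k - q) / (fact k * fact (k - q)))
               / real n powr (real (k - q) - 1 / 2)))
        (density lborel (normal_density 0 \<sigma>))"
proof -
  interpret vincular_pattern k q v A by standard fact+
  obtain s2 :: real where s2: "0 < s2"
    and lim: "\<And>t. (\<lambda>n. avg (perms {1..n}) (\<lambda>w. iexp (t * std_cnt n w))) \<longlonglongrightarrow> of_real (exp (- (s2 * t\<^sup>2 / 2)))"
    using uniform_char_limit by blast
  have std_cnt: "(real (vincular_count k v A n w) - real n ^ (k - q) / (fact k * fact (k - q))) / real n powr (real (k - q) - 1 / 2) = std_cnt n w" for n w
    by (simp only: std_cnt_def scaling_def vincular_count_eq)
  show ?thesis
  \<comment> \<open>The standard deviation comes from uniform permutations and is fixed before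
    \<open>lam\<close>, so it serves all sequences at once.\<close>
  proof (intro exI[of _ "sqrt s2"] conjI allI impI)
    show "0 < sqrt s2" using s2 by simp
    fix lam :: "nat \<Rightarrow> nat multiset" assume part: "\<forall>n. lam n partition_of n" and long: "all_long_cycles lam"
    have ne: "perms_of_cycle_type n (lam n) \<noteq> {}" for n
      using class_nonempty[of "lam n"] part by (simp add: partition_of_def)
    show "weak_conv_m
        (\<lambda>n. distr (measure_pmf (pmf_of_set (perms_of_cycle_type n (lam n)))) borel
          (\<lambda>w. (real (vincular_count k v A n w) - real n ^ (k - q) / (fact k * fact (k - q)))
               / real n powr (real (k - q) - 1 / 2)))
        (density lborel (normal_density 0 (sqrt s2)))"
      unfolding std_cnt
    proof (rule levy_continuity)
      show "real_distribution (distr (measure_pmf (pmf_of_set (perms_of_cycle_type n (lam n)))) borel (std_cnt n))" for n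
        by (rule prob_space.real_distribution_distr[OF measure_pmf.prob_space_axioms]) simp
      interpret N: prob_space "density lborel (normal_density 0 (sqrt s2))"
        by (rule prob_space_normal_density) (use s2 in simp)
      show "real_distribution (density lborel (normal_density 0 (sqrt s2)))" by standard auto
      show "(\<lambda>n. char (distr (measure_pmf (pmf_of_set (perms_of_cycle_type n (lam n)))) borel (std_cnt n)) t)
        \<longlonglongrightarrow> char (density lborel (normal_density 0 (sqrt s2))) t" for t
      proof -
        have "char (density lborel (normal_density 0 (sqrt s2))) t = of_real (exp (- (s2 * t\<^sup>2 / 2)))"
          using char_normal[of "sqrt s2" t] s2 by simp
        moreover have "(\<lambda>n. avg (perms_of_cycle_type n (lam n)) (\<lambda>w. iexp (t * std_cnt n w))) \<longlonglongrightarrow> of_real (exp (- (s2 * t\<^sup>2 / 2)))"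
          by (rule class_char_limit[OF _ long lim]) (use part in blast)
        ultimately show ?thesis using char_distr_pmf_of_set[OF finite_class ne] by simp
      qed
    qed
  qed
qed

end
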